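(* Let $m\in\mathbb{N}$, $m\geq 1$. Let $w\in C^\infty(\mathbb{R}^m)$ (complex-valued) be everywhere nonzero, let $\alpha\in\mathbb{C}\setminus\mathbb{R}$, and let $\check p\in\mathscr{S}_c'(\mathbb{R}^m)\setminus\{0\}$. Define operators $F,F_{\mathrm{lin}}:\mathscr{S}_c'(\mathbb{R}^m)\to C^\infty(\mathbb{R}^m)$ by $$F(h)(\xi)=\left|\mathcal{F}(\check p)(\xi)\exp(\alpha\xi^2)+\mathcal{F}(w\cdot h)(\xi)\right|^2,$$ $$F_{\mathrm{lin}}(h)(\xi)=\left|\mathcal{F}(\check p)(\xi)\exp(\alpha\xi^2)+\mathcal{F}(w\cdot h)(\xi)\right|^2-\left|\mathcal{F}(w\cdot h)(\xi)\right|^2$$ for $\xi\in\mathbb{R}^m$. Then $F$ and $F_{\mathrm{lin}}$ are well-defined (i.e. $F(h),F_{\mathrm{lin}}(h)\in C^\infty(\mathbb{R}^m)$ for every $h\in\mathscr{S}_c'(\mathbb{R}^m)$) and injective. Moreover, for every nonempty open set $U\subset\mathbb{R}^m$, any $h\in\mathscr{S}_c'(\mathbb{R}^m)$ is uniquely determined by the restricted data $F(h)|_U$, and likewise by $F_{\mathrm{lin}}(h)|_U$; that is, for $h,\tilde h\in\mathscr{S}_c'(\mathbb{R}^m)$, each of $F(h)|_U=F(\tilde h)|_U$ and $F_{\mathrm{lin}}(h)|_U=F_{\mathrm{lin}}(\tilde h)|_U$ implies $h=\tilde h$.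
   Context: $\mathscr{S}'(\mathbb{R}^m)$ denotes the (complex) tempered distributions on $\mathbb{R}^m$ and $\mathscr{S}_c'(\mathbb{R}^m)\subset\mathscr{S}'(\mathbb{R}^m)$ those with compact support. $\mathcal{F}:\mathscr{S}'(\mathbb{R}^m)\to\mathscr{S}'(\mathbb{R}^m)$ is the Fourier transform, given on integrable functions by $\mathcal{F}(f)(\xi)=(2\pi)^{-m/2}\int_{\mathbb{R}^m}f(x)e^{-i\xi\cdot x}\,dx$; the Fourier transform of a compactly supported distribution is identified with the smooth function representing it. For $\xi=(\xi_1,\dots,\xi_m)$, $\xi^2:=\xi_1^2+\dots+\xi_m^2$. *)

theory Defs
  imports "HOL-Analysis.Analysis"
begin

definition partial_deriv ::
    "'m::finite \<Rightarrow> (real^'m \<Rightarrow> 'b::real_normed_vector) \<Rightarrow> real^'m \<Rightarrow> 'b" where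
  "partial_deriv i f x = frechet_derivative f (at x) (axis i 1)"

text \<open>A derivative of order \<open>k\<close> is indexed by the list of its \<open>k\<close> directions rather than by a
  multi-index; for smooth functions the order of the directions is immaterial.\<close>

definition partial_derivs ::
    "'m::finite list \<Rightarrow> (real^'m \<Rightarrow> 'b::real_normed_vector) \<Rightarrow> real^'m \<Rightarrow> 'b" where
  "partial_derivs is f = foldr partial_deriv is f"

text \<open>Differentiability is total (Frechet) differentiability, so every iterated partial derivative
  is in particular continuous: this is membership in \<open>C\<^sup>\<infinity>\<close>.\<close>

definition smooth :: "(real^'m \<Rightarrow> 'b::real_normed_vector) \<Rightarrow> bool" where
  "smooth f \<longleftrightarrow> (\<forall>is x. partial_derivs is f differentiable (at x))"

definition fun_support :: "(real^'m \<Rightarrow> complex) \<Rightarrow> (real^'m) set" where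
  "fun_support f = closure {x. f x \<noteq> 0}"

definition test_functions :: "(real^'m \<Rightarrow> complex) set" where
  "test_functions = {\<phi>. smooth \<phi> \<and> compact (fun_support \<phi>)}"

definition schwartz :: "(real^'m \<Rightarrow> complex) set" where
  "schwartz = {\<phi>. smooth \<phi> \<and>
     (\<forall>k is. bounded (range (\<lambda>x. (1 + norm x) ^ k *\<^sub>R partial_derivs is \<phi> x)))}"

text \<open>The increasing sequence of norms generating the Frechet topology of the Schwartz space.\<close>

definition schwartz_norm :: "nat \<Rightarrow> (real^'m \<Rightarrow> complex) \<Rightarrow> real" where
  "schwartz_norm N \<phi> =
     (SUP (is, x) \<in> {is. length is \<le> N} \<times> UNIV. (1 + norm x) ^ N * norm (partial_derivs is \<phi> x))"

text \<open>A tempered distribution is a linear functional on \<open>schwartz\<close> that is continuous, i.e. bounded by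
  a multiple of one of the norms above. Since functionals are total functions in HOL, they are
  normalised to vanish outside \<open>schwartz\<close>, so that equality of distributions is equality in HOL
  and the zero distribution is \<open>\<lambda>_. 0\<close>.\<close>

type_synonym 'm functional = "((real, 'm) vec \<Rightarrow> complex) \<Rightarrow> complex"

definition tempered :: "'m::finite functional set" where
  "tempered = {u.
     (\<forall>\<phi>\<in>schwartz. \<forall>\<psi>\<in>schwartz. u (\<lambda>x. \<phi> x + \<psi> x) = u \<phi> + u \<psi>) \<and>
     (\<forall>c. \<forall>\<phi>\<in>schwartz. u (\<lambda>x. c * \<phi> x) = c * u \<phi>) \<and>
     (\<exists>C N. \<forall>\<phi>\<in>schwartz. norm (u \<phi>) \<le> C * schwartz_norm N \<phi>) \<and>
     (\<forall>\<phi>. \<phi> \<notin> schwartz \<longrightarrow> u \<phi> = 0)}"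

definition distr_support :: "'m::finite functional \<Rightarrow> (real^'m) set" where
  "distr_support u =
     - \<Union>{V. open V \<and> (\<forall>\<phi>\<in>test_functions. fun_support \<phi> \<subseteq> V \<longrightarrow> u \<phi> = 0)}"

definition tempered_c :: "'m::finite functional set" where
  "tempered_c = {u \<in> tempered. compact (distr_support u)}"

definition is_cutoff :: "(real^'m) set \<Rightarrow> (real^'m \<Rightarrow> complex) \<Rightarrow> bool" where
  "is_cutoff K \<eta> \<longleftrightarrow> \<eta> \<in> test_functions \<and> (\<exists>V. open V \<and> K \<subseteq> V \<and> (\<forall>x\<in>V. \<eta> x = 1))"

text \<open>The product \<open>w \<cdot> h\<close> of a smooth function, of arbitrary growth, and a compactly supported
  distribution is \<open>\<phi> \<mapsto> h (w \<phi>)\<close>. As \<open>w \<phi>\<close> need not be a Schwartz function, \<open>h\<close> is evaluated on it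
  through a cutoff equal to 1 near the support of \<open>h\<close>; the value does not depend on the cutoff.\<close>

definition distr_mult :: "(real^'m \<Rightarrow> complex) \<Rightarrow> 'm::finite functional \<Rightarrow> 'm functional" where
  "distr_mult w h =
     (let \<eta> = (SOME \<eta>. is_cutoff (distr_support h) \<eta>)
      in (\<lambda>\<phi>. if \<phi> \<in> schwartz then h (\<lambda>x. \<eta> x * (w x * \<phi> x)) else 0))"

definition fourier_fun :: "(real^'m \<Rightarrow> complex) \<Rightarrow> real^'m \<Rightarrow> complex" where
  "fourier_fun f \<xi> =
     of_real ((2 * pi) powr (- real CARD('m) / 2)) *
     (LINT x|lborel. f x * exp (- \<i> * of_real (\<xi> \<bullet> x)))"

definition fourier :: "'m::finite functional \<Rightarrow> 'm functional" where
  "fourier u = (\<lambda>\<phi>. if \<phi> \<in> schwartz then u (fourier_fun \<phi>) else 0)"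

text \<open>A smooth function represents a distribution if it acts by integration against test functions;
  as these are dense in \<open>schwartz\<close>, this determines both the function and the tempered
  distribution, and no growth condition on the function is needed.\<close>

definition represents :: "(real^'m \<Rightarrow> complex) \<Rightarrow> 'm::finite functional \<Rightarrow> bool" where
  "represents f u \<longleftrightarrow> (\<forall>\<phi>\<in>test_functions. u \<phi> = (LINT x|lborel. f x * \<phi> x))"

definition smooth_rep :: "'m::finite functional \<Rightarrow> real^'m \<Rightarrow> complex" where
  "smooth_rep u = (THE f. smooth f \<and> represents f u)"

definition fourier_c :: "'m::finite functional \<Rightarrow> real^'m \<Rightarrow> complex" where
  "fourier_c u = smooth_rep (fourier u)"

definition F_op ::
    "(real^'m \<Rightarrow> complex) \<Rightarrow> complex \<Rightarrow> 'm::finite functional \<Rightarrow> 'm functional \<Rightarrow> real^'m \<Rightarrow> real" where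
  "F_op w \<alpha> p h \<xi> =
     (cmod (fourier_c p \<xi> * exp (\<alpha> * of_real (\<Sum>i\<in>UNIV. (\<xi> $ i)\<^sup>2))
            + fourier_c (distr_mult w h) \<xi>))\<^sup>2"

definition F_lin ::
    "(real^'m \<Rightarrow> complex) \<Rightarrow> complex \<Rightarrow> 'm::finite functional \<Rightarrow> 'm functional \<Rightarrow> real^'m \<Rightarrow> real" where
  "F_lin w \<alpha> p h \<xi> =
     (cmod (fourier_c p \<xi> * exp (\<alpha> * of_real (\<Sum>i\<in>UNIV. (\<xi> $ i)\<^sup>2))
            + fourier_c (distr_mult w h) \<xi>))\<^sup>2
     - (cmod (fourier_c (distr_mult w h) \<xi>))\<^sup>2"

end

(* The Fourier transform of a compactly supported distribution extends along every line a + z b to an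
   entire function of exponential type in z. Write P, A, B for the extensions of the transforms of p,
   w h and w h', and X^c for z |-> cnj (X (cnj z)). Equality of the data on an open set, expanded and
   continued analytically, becomes f exp (beta z^2) + g exp (cnj beta z^2) = k with f, g, k of
   exponential type, beta not real, and f equal to P (A^c - B^c) up to an exponential factor. As beta is
   not real, there is a sector in which the first Gaussian grows while the second decays; hence f
   decays like a Gaussian there. Finitely many rotations of the sector cover the plane, so the product
   of the rotated copies of f tends to 0 at infinity and vanishes by Liouville's theorem. Therefore
   f = 0, and A = B on lines through a point where P does not vanish.

   That the Fourier transform is injective is seen without an inversion formula: if the transform of u
   vanishes, then u annihilates all polynomials times a cutoff (differentiate in xi), and convolution
   with Landau kernels approximates test functions by polynomials with all derivatives. *)

theory Submission imports Defs "HOL-Complex_Analysis.Complex_Analysis"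
begin

section \<open>Calculus of smooth functions\<close>

text \<open>A compactly supported distribution has to be applied to exponentials and polynomials,
  which are not Schwartz functions. A cutoff equal to 1 near the support gives this a meaning, and
  on products of a fixed test function with a smooth f a tempered distribution is bounded by
  finitely many derivatives of f on one compact set. Each exchange of the distribution with a limit
  (Riemann sums, the exponential series, polynomial approximation) thus comes down to convergence of
  derivatives on compact sets, with no control at infinity.

  In the difference of the two data the squared modulus of P times the Gaussian cancels. It is the
  only term in which the Gaussian meets its own conjugate; each remaining Gaussian stands alone,
  next to factors of exponential type. Decay in one sector is enough because the factor exp (- d
  r^2) of a single rotated copy outweighs the exponential growth of all the others. That the
  transform of p has a nonzero value inside the given open set already rests on injectivity of the
  Fourier transform, which is therefore used twice.\<close>

lemma partial_derivs_Nil [simp]: "partial_derivs [] f = f"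
  by (simp add: partial_derivs_def)

lemma partial_derivs_Cons: "partial_derivs (i # is) f = partial_deriv i (partial_derivs is f)"
  by (simp add: partial_derivs_def)

lemma partial_derivs_snoc: "partial_derivs (is @ [i]) f = partial_derivs is (partial_deriv i f)"
  by (simp add: partial_derivs_def)

lemma partial_deriv_eqI:
  "(f has_derivative f') (at x) \<Longrightarrow> partial_deriv i f x = f' (axis i 1)"
  by (simp add: partial_deriv_def frechet_derivative_at[symmetric])

lemma partial_deriv_const [simp]: "partial_deriv i (\<lambda>x. c) = (\<lambda>x. 0)"
  by (rule ext, subst partial_deriv_eqI[OF has_derivative_const]) simp

lemma partial_deriv_add:
  assumes "f differentiable at x" "g differentiable at x"
  shows "partial_deriv i (\<lambda>x. f x + g x) x = partial_deriv i f x + partial_deriv i g x"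
proof -
  obtain f' g' where *: "(f has_derivative f') (at x)" "(g has_derivative g') (at x)"
    using assms by (auto simp: differentiable_def)
  show ?thesis
    by (simp add: partial_deriv_eqI[OF has_derivative_add[OF *]] partial_deriv_eqI[OF *(1)]
        partial_deriv_eqI[OF *(2)])
qed

lemma partial_deriv_mult:
  fixes f g :: "real^'m \<Rightarrow> 'b::real_normed_algebra"
  assumes "f differentiable at x" "g differentiable at x"
  shows "partial_deriv i (\<lambda>x. f x * g x) x = f x * partial_deriv i g x + partial_deriv i f x * g x"
proof -
  obtain f' g' where *: "(f has_derivative f') (at x)" "(g has_derivative g') (at x)"
    using assms by (auto simp: differentiable_def)
  show ?thesis
    by (simp add: partial_deriv_eqI[OF has_derivative_mult[OF *]] partial_deriv_eqI[OF *(1)]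
        partial_deriv_eqI[OF *(2)])
qed

lemma partial_deriv_bounded_linear:
  assumes "bounded_linear T" "f differentiable at x"
  shows "partial_deriv i (\<lambda>x. T (f x)) x = T (partial_deriv i f x)"
proof -
  obtain f' where *: "(f has_derivative f') (at x)"
    using assms by (auto simp: differentiable_def)
  show ?thesis
    by (simp add: partial_deriv_eqI[OF bounded_linear.has_derivative[OF assms(1) *]]
        partial_deriv_eqI[OF *])
qed

lemma partial_deriv_linear:
  assumes "bounded_linear T"
  shows "partial_deriv i T = (\<lambda>x. T (axis i 1))"
  using partial_deriv_eqI[OF bounded_linear_imp_has_derivative[OF assms]] by blast

lemma partial_deriv_compose:
  fixes g :: "'b::real_normed_field \<Rightarrow> 'b"
  assumes "(g has_field_derivative d) (at (f x))" "f differentiable at x"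
  shows "partial_deriv i (\<lambda>x. g (f x)) x = d * partial_deriv i f x"
proof -
  obtain f' where *: "(f has_derivative f') (at x)"
    using assms by (auto simp: differentiable_def)
  show ?thesis
    by (simp add: partial_deriv_eqI[OF has_derivative_compose[OF * assms(1)[unfolded has_field_derivative_def]]]
        partial_deriv_eqI[OF *])
qed

lemma partial_deriv_affine:
  assumes "\<And>x. f differentiable (at x)"
  shows "partial_deriv i (\<lambda>x. f (c *\<^sub>R x + d)) = (\<lambda>x. c *\<^sub>R partial_deriv i f (c *\<^sub>R x + d))"
proof
  fix x
  obtain f' where *: "(f has_derivative f') (at (c *\<^sub>R x + d))"
    using assms unfolding differentiable_def by blast
  have l: "((\<lambda>x. c *\<^sub>R x + d) has_derivative (\<lambda>x. c *\<^sub>R x)) (at x)"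
    by (auto intro!: derivative_eq_intros)
  have scale: "f' (a *\<^sub>R y) = a *\<^sub>R f' y" for a y
    using linear_scale[OF has_derivative_linear[OF *]] .
  show "partial_deriv i (\<lambda>x. f (c *\<^sub>R x + d)) x = c *\<^sub>R partial_deriv i f (c *\<^sub>R x + d)"
    by (simp add: partial_deriv_eqI[OF has_derivative_compose[OF l *]] partial_deriv_eqI[OF *] scale)
qed

lemma partial_deriv_cong_open:
  assumes "open S" "\<And>x. x \<in> S \<Longrightarrow> f x = g x" "x \<in> S"
  shows "partial_deriv i f x = partial_deriv i g x"
proof -
  have "(f has_derivative D) (at x) \<longleftrightarrow> (g has_derivative D) (at x)" for D
    using has_derivative_transform_within_open[OF _ assms(1,3), where f = f and g = g]
      has_derivative_transform_within_open[OF _ assms(1,3), where f = g and g = f] assms(2) by auto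
  then show ?thesis by (simp add: partial_deriv_def frechet_derivative_def)
qed

lemma partial_derivs_cong_open:
  assumes "open S" "\<And>x. x \<in> S \<Longrightarrow> f x = g x"
  shows "x \<in> S \<Longrightarrow> partial_derivs is f x = partial_derivs is g x"
proof (induction "is" arbitrary: x)
  case (Cons i "is")
  then show ?case
    unfolding partial_derivs_Cons by (intro partial_deriv_cong_open[OF assms(1)])
qed (use assms in auto)

lemma partial_derivs_zero [simp]: "partial_derivs is (\<lambda>x. 0) = (\<lambda>x. 0)"
  by (induction "is") (auto simp: partial_derivs_Cons)

lemma partial_derivs_eq_0_open:
  assumes "open S" "\<And>x. x \<in> S \<Longrightarrow> f x = 0" "x \<in> S"
  shows "partial_derivs is f x = 0"
  using partial_derivs_cong_open[of S f "\<lambda>_. 0"] assms by simp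

text \<open>Smoothness offers no induction of its own. Derivatives of products, reciprocals and
  composites are built from expressions of the same kind and of lower order, so the closure
  properties are proved by induction on a finite order n.\<close>

definition diff_order :: "nat \<Rightarrow> (real^'m \<Rightarrow> 'b::real_normed_vector) \<Rightarrow> bool" where
  "diff_order n f \<longleftrightarrow> (\<forall>is x. length is < n \<longrightarrow> partial_derivs is f differentiable (at x))"

lemma diff_order_0 [simp]: "diff_order 0 f"
  by (simp add: diff_order_def)

text \<open>\<open>partial_derivs\<close> applies the last direction of the list first. Splitting
  the list at its end moves one derivative onto f itself, which is the form in which the product and
  chain rules enter an induction.\<close>

lemma diff_order_Suc:
  "diff_order (Suc n) f \<longleftrightarrow> (\<forall>x. f differentiable (at x)) \<and> (\<forall>i. diff_order n (partial_deriv i f))"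
  (is "?L \<longleftrightarrow> ?R")
proof
  assume L: ?L
  show ?R unfolding diff_order_def
  proof (intro conjI allI impI)
    show "f differentiable (at x)" for x
      using L[unfolded diff_order_def, rule_format, of "[]"] by simp
    show "partial_derivs is (partial_deriv i f) differentiable (at x)" if "length is < n" for i "is" x
      using L[unfolded diff_order_def, rule_format, of "is @ [i]"] that by (simp add: partial_derivs_snoc)
  qed
next
  assume R: ?R
  show ?L unfolding diff_order_def
  proof (intro allI impI)
    fix "is" :: "'a list" and x
    assume "length is < Suc n"
    then show "partial_derivs is f differentiable (at x)"
      using R by (cases "is" rule: rev_cases) (auto simp: diff_order_def partial_derivs_snoc)
  qed
qed

lemma smooth_iff_diff_order: "smooth f \<longleftrightarrow> (\<forall>n. diff_order n f)"
  by (auto simp: smooth_def diff_order_def)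

lemma smooth_iff:
  "smooth f \<longleftrightarrow> (\<forall>x. f differentiable (at x)) \<and> (\<forall>i. smooth (partial_deriv i f))"
proof -
  have "smooth f \<longleftrightarrow> (\<forall>n. diff_order (Suc n) f)"
    unfolding smooth_iff_diff_order by (metis diff_order_0 not0_implies_Suc)
  then show ?thesis by (auto simp: diff_order_Suc smooth_iff_diff_order)
qed

lemma smooth_differentiable: "smooth f \<Longrightarrow> f differentiable (at x)"
  using smooth_iff by blast

lemma smooth_partial_deriv: "smooth f \<Longrightarrow> smooth (partial_deriv i f)"
  using smooth_iff by blast

lemma smooth_partial_derivs: "smooth f \<Longrightarrow> smooth (partial_derivs is f)"
  by (induction "is") (auto simp: partial_derivs_Cons smooth_partial_deriv)

lemma smooth_continuous_on: "smooth f \<Longrightarrow> continuous_on S f"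
  using differentiable_at_imp_differentiable_on differentiable_imp_continuous_on smooth_differentiable
  by blast

section \<open>Closure properties of smooth functions\<close>

lemma smooth_const [simp]: "smooth ((\<lambda>x. c) :: real^'m \<Rightarrow> 'b::real_normed_vector)"
proof -
  have "diff_order n ((\<lambda>x. c) :: real^'m \<Rightarrow> 'b)" for n and c :: 'b
    by (induction n arbitrary: c) (auto simp: diff_order_Suc)
  then show ?thesis by (auto simp: smooth_iff_diff_order)
qed

lemma smooth_linear:
  assumes "bounded_linear T"
  shows "smooth T"
  by (rule smooth_iff[THEN iffD2])
    (simp add: partial_deriv_linear[OF assms] bounded_linear_imp_differentiable[OF assms])

lemma smooth_bounded_linear:
  assumes "bounded_linear T" "smooth f"
  shows "smooth (\<lambda>x. T (f x))"
proof -
  have "diff_order n f \<Longrightarrow> diff_order n (\<lambda>x. T (f x))" for n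
  proof (induction n arbitrary: f)
    case (Suc n)
    then have d: "\<And>x. f differentiable (at x)" by (simp add: diff_order_Suc)
    have "(\<lambda>x. T (f x)) differentiable (at x)" for x
      using d[of x] bounded_linear.has_derivative[OF assms(1)] by (auto simp: differentiable_def)
    moreover have "partial_deriv i (\<lambda>x. T (f x)) = (\<lambda>x. T (partial_deriv i f x))" for i
      using partial_deriv_bounded_linear[OF assms(1) d] by blast
    ultimately show ?case using Suc by (auto simp: diff_order_Suc)
  qed auto
  then show ?thesis using assms(2) by (auto simp: smooth_iff_diff_order)
qed

lemma diff_order_add: "diff_order n f \<Longrightarrow> diff_order n g \<Longrightarrow> diff_order n (\<lambda>x. f x + g x)"
proof (induction n arbitrary: f g)
  case (Suc n)
  then have "partial_deriv i (\<lambda>x. f x + g x) = (\<lambda>x. partial_deriv i f x + partial_deriv i g x)" for i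
    by (intro ext partial_deriv_add) (auto simp: diff_order_Suc)
  with Suc show ?case by (auto simp: diff_order_Suc)
qed auto

lemma smooth_add: "smooth f \<Longrightarrow> smooth g \<Longrightarrow> smooth (\<lambda>x. f x + g x)"
  by (auto simp: smooth_iff_diff_order diff_order_add)

lemma diff_order_Suc_D: "diff_order (Suc n) f \<Longrightarrow> diff_order n f"
  by (auto simp: diff_order_def)

lemma diff_order_mult:
  fixes f g :: "real^'m \<Rightarrow> 'b::real_normed_algebra"
  shows "diff_order n f \<Longrightarrow> diff_order n g \<Longrightarrow> diff_order n (\<lambda>x. f x * g x)"
proof (induction n arbitrary: f g)
  case (Suc n)
  have "partial_deriv i (\<lambda>x. f x * g x) = (\<lambda>x. f x * partial_deriv i g x + partial_deriv i f x * g x)" for i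
    using Suc.prems by (intro ext partial_deriv_mult) (auto simp: diff_order_Suc)
  moreover have "diff_order n (\<lambda>x. f x * partial_deriv i g x + partial_deriv i f x * g x)" for i
    using Suc.prems diff_order_Suc_D[OF Suc.prems(1)] diff_order_Suc_D[OF Suc.prems(2)]
    by (intro diff_order_add Suc.IH) (simp_all add: diff_order_Suc)
  ultimately show ?case using Suc.prems by (auto simp: diff_order_Suc)
qed auto

lemma smooth_mult:
  fixes f g :: "real^'m \<Rightarrow> 'b::real_normed_algebra"
  shows "smooth f \<Longrightarrow> smooth g \<Longrightarrow> smooth (\<lambda>x. f x * g x)"
  by (auto simp: smooth_iff_diff_order diff_order_mult)

lemma smooth_power:
  fixes f :: "real^'m \<Rightarrow> 'b::real_normed_algebra_1"
  shows "smooth f \<Longrightarrow> smooth (\<lambda>x. f x ^ k)"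
  by (induction k) (simp_all add: smooth_mult)

lemma smooth_cmult:
  fixes f :: "real^'m \<Rightarrow> 'b::real_normed_algebra"
  shows "smooth f \<Longrightarrow> smooth (\<lambda>x. c * f x)"
  by (simp add: smooth_mult)

lemma smooth_minus: "smooth f \<Longrightarrow> smooth (\<lambda>x. - f x)"
  by (rule smooth_bounded_linear[OF bounded_linear_minus[OF bounded_linear_ident]])

lemma smooth_diff: "smooth f \<Longrightarrow> smooth g \<Longrightarrow> smooth (\<lambda>x. f x - g x)"
  using smooth_add[of f "\<lambda>x. - g x"] smooth_minus[of g] by simp

lemma smooth_sum: "(\<And>i. i \<in> I \<Longrightarrow> smooth (f i)) \<Longrightarrow> smooth (\<lambda>x. \<Sum>i\<in>I. f i x)"
  by (induction I rule: infinite_finite_induct) (simp_all add: smooth_add)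

lemma smooth_of_real:
  "smooth f \<Longrightarrow> smooth (\<lambda>x. of_real (f x) :: 'b::real_normed_algebra_1)"
  by (rule smooth_bounded_linear[OF bounded_linear_of_real])

text \<open>Composition with a scalar function, given together with all its derivatives \<open>G k\<close>.\<close>

lemma smooth_compose:
  fixes G :: "nat \<Rightarrow> 'b::real_normed_field \<Rightarrow> 'b"
  assumes G: "\<And>k x. (G k has_field_derivative G (Suc k) x) (at x)" and "smooth f"
  shows "smooth (\<lambda>x. G k (f x))"
proof -
  have "diff_order n (\<lambda>x. G k (f x))" for n
  proof (induction n arbitrary: k)
    case (Suc n)
    have "partial_deriv i (\<lambda>x. G k (f x)) = (\<lambda>x. G (Suc k) (f x) * partial_deriv i f x)" for i
      using assms by (intro ext partial_deriv_compose) (auto simp: smooth_differentiable)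
    moreover have "diff_order n (\<lambda>x. G (Suc k) (f x) * partial_deriv i f x)" for i
      using Suc.IH smooth_partial_deriv[OF assms(2)] by (intro diff_order_mult) (auto simp: smooth_iff_diff_order)
    moreover have "(\<lambda>x. G k (f x)) differentiable (at x)" for x
      using has_derivative_compose[OF _ G[unfolded has_field_derivative_def]]
        smooth_differentiable[OF assms(2)] unfolding differentiable_def by blast
    ultimately show ?case by (auto simp: diff_order_Suc)
  qed auto
  then show ?thesis by (simp add: smooth_iff_diff_order)
qed

lemma smooth_exp:
  fixes f :: "real^'m \<Rightarrow> 'b::{real_normed_field, banach}"
  shows "smooth f \<Longrightarrow> smooth (\<lambda>x. exp (f x))"
  using smooth_compose[of "\<lambda>_. exp"] DERIV_exp by blast

text \<open>\<open>smooth_compose\<close> does not apply: it wants derivatives of the outer function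
  at every point, and the reciprocal has a pole at 0. Induction works directly because the
  derivative is again a product of reciprocals of f and a derivative of f.\<close>

lemma smooth_inverse:
  fixes f :: "real^'m \<Rightarrow> 'b::real_normed_field"
  assumes "smooth f" "\<And>x. f x \<noteq> 0"
  shows "smooth (\<lambda>x. inverse (f x))"
proof -
  have d: "(\<lambda>x. inverse (f x)) differentiable (at x)" for x
    using assms smooth_differentiable by (intro differentiable_inverse) auto
  have "diff_order n (\<lambda>x. inverse (f x))" for n
  proof (induction n)
    case (Suc n)
    have "partial_deriv i (\<lambda>x. inverse (f x)) =
      (\<lambda>x. - (inverse (f x) * inverse (f x)) * partial_deriv i f x)" for i
      using assms DERIV_inverse[of _ UNIV]
      by (intro ext partial_deriv_compose) (auto simp: smooth_differentiable power2_eq_square)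
    \<comment> \<open>The sign is written as the constant factor \<open>- 1\<close>, so that only
      products occur.\<close>
    moreover have "diff_order n (\<lambda>x. - 1 * (inverse (f x) * inverse (f x)) * partial_deriv i f x)" for i
      using Suc.IH smooth_partial_deriv[OF assms(1)] smooth_const[of "- 1 :: 'b"]
      by (intro diff_order_mult) (auto simp only: smooth_iff_diff_order)
    ultimately show ?case using d by (auto simp: diff_order_Suc)
  qed auto
  then show ?thesis by (simp add: smooth_iff_diff_order)
qed

section \<open>Iterated derivatives and bounds for them\<close>

lemma differentiable_affine:
  fixes f :: "'a::real_normed_vector \<Rightarrow> 'b::real_normed_vector"
  assumes "\<And>x. f differentiable (at x)"
  shows "(\<lambda>x. f (c *\<^sub>R x + d)) differentiable (at x)"
  by (rule differentiable_compose[of f, OF assms]) simp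

lemma partial_derivs_affine:
  assumes "smooth f"
  shows "partial_derivs is (\<lambda>x. f (c *\<^sub>R x + d)) =
    (\<lambda>x. c ^ length is *\<^sub>R partial_derivs is f (c *\<^sub>R x + d))"
proof (induction "is")
  case (Cons i "is")
  have s: "smooth (partial_derivs is f)" using assms by (rule smooth_partial_derivs)
  have "(\<lambda>x. partial_derivs is f (c *\<^sub>R x + d)) differentiable (at x)" for x
    using smooth_differentiable[OF s] by (rule differentiable_affine)
  then have "partial_deriv i (\<lambda>x. c ^ length is *\<^sub>R partial_derivs is f (c *\<^sub>R x + d)) x =
     c ^ length is *\<^sub>R partial_deriv i (\<lambda>x. partial_derivs is f (c *\<^sub>R x + d)) x" for x
    by (intro partial_deriv_bounded_linear bounded_linear_scaleR_right)
  then show ?case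
    using smooth_differentiable[OF s]
    by (auto simp: partial_derivs_Cons Cons.IH partial_deriv_affine fun_eq_iff)
qed auto

lemma smooth_affine:
  assumes "smooth f"
  shows "smooth (\<lambda>x. f (c *\<^sub>R x + d))"
  unfolding smooth_def partial_derivs_affine[OF assms]
  using smooth_differentiable[OF smooth_partial_derivs[OF assms]]
  by (intro allI differentiable_scaleR differentiable_const differentiable_affine)

lemma partial_derivs_add:
  assumes "smooth f" "smooth g"
  shows "partial_derivs is (\<lambda>x. f x + g x) = (\<lambda>x. partial_derivs is f x + partial_derivs is g x)"
proof (induction "is")
  case (Cons i "is")
  show ?case
    unfolding partial_derivs_Cons Cons.IH using assms
    by (intro ext partial_deriv_add smooth_differentiable smooth_partial_derivs)
qed auto

lemma partial_derivs_bounded_linear: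
  assumes "smooth f" "bounded_linear T"
  shows "partial_derivs is (\<lambda>x. T (f x)) = (\<lambda>x. T (partial_derivs is f x))"
proof (induction "is")
  case (Cons i "is")
  show ?case
    unfolding partial_derivs_Cons Cons.IH using assms
    by (intro ext partial_deriv_bounded_linear smooth_differentiable smooth_partial_derivs)
qed auto

text \<open>A bound for the C^N norm over S, kept as a relation so that no supremum has to
  exist.\<close>

definition deriv_bound :: "nat \<Rightarrow> (real^'m) set \<Rightarrow> (real^'m \<Rightarrow> 'b::real_normed_vector) \<Rightarrow> real \<Rightarrow> bool" where
  "deriv_bound N S f c \<longleftrightarrow> (\<forall>is x. length is \<le> N \<longrightarrow> x \<in> S \<longrightarrow> norm (partial_derivs is f x) \<le> c)"

lemma deriv_bound_0: "deriv_bound 0 S f c \<longleftrightarrow> (\<forall>x\<in>S. norm (f x) \<le> c)"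
  by (auto simp: deriv_bound_def)

lemma deriv_bound_Suc:
  "deriv_bound (Suc N) S f c \<longleftrightarrow> (\<forall>x\<in>S. norm (f x) \<le> c) \<and> (\<forall>i. deriv_bound N S (partial_deriv i f) c)"
  (is "?L \<longleftrightarrow> ?R")
proof
  assume L: ?L
  show ?R unfolding deriv_bound_def
  proof (intro conjI allI impI ballI)
    show "norm (f x) \<le> c" if "x \<in> S" for x
      using L[unfolded deriv_bound_def, rule_format, of "[]"] that by simp
    show "norm (partial_derivs is (partial_deriv i f) x) \<le> c" if "length is \<le> N" "x \<in> S" for i "is" x
      using L[unfolded deriv_bound_def, rule_format, of "is @ [i]"] that by (simp add: partial_derivs_snoc)
  qed
next
  assume R: ?R
  show ?L unfolding deriv_bound_def
  proof (intro allI impI)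
    fix "is" :: "'a list" and x
    assume "length is \<le> Suc N" "x \<in> S"
    then show "norm (partial_derivs is f x) \<le> c"
      using R by (cases "is" rule: rev_cases) (auto simp: deriv_bound_def partial_derivs_snoc)
  qed
qed

lemma deriv_bound_mono:
  "deriv_bound N S f c \<Longrightarrow> M \<le> N \<Longrightarrow> T \<subseteq> S \<Longrightarrow> c \<le> d \<Longrightarrow> deriv_bound M T f d"
  unfolding deriv_bound_def by (meson order_trans subsetD)

lemma deriv_bound_add:
  assumes "smooth f" "smooth g" "deriv_bound N S f c" "deriv_bound N S g d"
  shows "deriv_bound N S (\<lambda>x. f x + g x) (c + d)"
  unfolding deriv_bound_def partial_derivs_add[OF assms(1,2)]
  using assms(3,4) by (intro allI impI norm_triangle_mono) (simp_all add: deriv_bound_def)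

lemma deriv_bound_minus:
  assumes "smooth f" "deriv_bound N S f c"
  shows "deriv_bound N S (\<lambda>x. - f x) c"
  using assms by (auto simp: deriv_bound_def
      partial_derivs_bounded_linear[OF _ bounded_linear_minus[OF bounded_linear_ident]])

lemma deriv_bound_diff:
  assumes "smooth f" "smooth g" "deriv_bound N S f c" "deriv_bound N S g d"
  shows "deriv_bound N S (\<lambda>x. f x - g x) (c + d)"
  using deriv_bound_add[OF assms(1) smooth_minus[OF assms(2)] assms(3) deriv_bound_minus[OF assms(2,4)]]
  by simp

text \<open>Each order of differentiation doubles the number of terms in the product rule, hence the
  factor \<open>2 ^ N\<close>.\<close>

lemma deriv_bound_mult:
  fixes f g :: "real^'m \<Rightarrow> 'b::real_normed_algebra"
  assumes "smooth f" "smooth g" "deriv_bound N S f c" "deriv_bound N S g d" "0 \<le> c" "0 \<le> d"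
  shows "deriv_bound N S (\<lambda>x. f x * g x) (2 ^ N * c * d)"
  using assms
proof (induction N arbitrary: f g)
  case 0
  have "norm (f x * g x) \<le> c * d" if "x \<in> S" for x
    using 0 that by (intro order_trans[OF norm_mult_ineq] mult_mono) (simp_all add: deriv_bound_0)
  then show ?case by (auto simp: deriv_bound_0)
next
  case (Suc N)
  have "norm (f x * g x) \<le> 2 ^ Suc N * c * d" if "x \<in> S" for x
  proof -
    have "norm (f x * g x) \<le> 1 * (c * d)"
      unfolding mult_1 using Suc.prems that
      by (intro order_trans[OF norm_mult_ineq] mult_mono) (simp_all add: deriv_bound_Suc)
    also have "\<dots> \<le> 2 ^ Suc N * (c * d)"
      using Suc.prems by (intro mult_right_mono one_le_power) auto
    finally show ?thesis by (simp add: mult.assoc)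
  qed
  moreover have "deriv_bound N S (partial_deriv i (\<lambda>x. f x * g x)) (2 ^ Suc N * c * d)" for i
  proof -
    have "partial_deriv i (\<lambda>x. f x * g x) = (\<lambda>x. f x * partial_deriv i g x + partial_deriv i f x * g x)"
      using Suc.prems by (intro ext partial_deriv_mult) (auto simp: smooth_differentiable)
    moreover have "deriv_bound N S (\<lambda>x. f x * partial_deriv i g x + partial_deriv i f x * g x)
        (2 ^ N * c * d + 2 ^ N * c * d)"
      using Suc.prems deriv_bound_mono[OF Suc.prems(3), of N S c] deriv_bound_mono[OF Suc.prems(4), of N S d]
      by (intro deriv_bound_add Suc.IH smooth_mult smooth_partial_deriv) (simp_all add: deriv_bound_Suc)
    ultimately show ?thesis by (simp add: mult_ac)
  qed
  ultimately show ?case by (simp add: deriv_bound_Suc)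
qed

lemma deriv_bound_compact:
  fixes f :: "real^'m \<Rightarrow> 'b::real_normed_vector"
  assumes "smooth f" "compact S"
  obtains c where "c \<ge> 0" "deriv_bound N S f c"
proof -
  have fin: "finite {is::'m list. length is \<le> N}"
    using finite_lists_length_le[of "UNIV::'m set" N] by simp
  have "\<exists>b. \<forall>x\<in>S. norm (partial_derivs is f x) \<le> b" for "is"
    using compact_imp_bounded[OF compact_continuous_image[OF smooth_continuous_on[OF smooth_partial_derivs[OF assms(1)]] assms(2)]]
    by (auto simp: bounded_iff)
  then obtain b where b: "\<And>is x. x \<in> S \<Longrightarrow> norm (partial_derivs is f x) \<le> b is" by metis
  show ?thesis
  proof (rule that)
    let ?c = "\<Sum>is | length is \<le> N. \<bar>b is\<bar>"
    show "?c \<ge> 0" by (simp add: sum_nonneg)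
    have "b is \<le> ?c" if "length is \<le> N" for "is"
      using member_le_sum[of "is" "{is. length is \<le> N}" "\<lambda>is. \<bar>b is\<bar>"] that fin by auto
    then show "deriv_bound N S f ?c"
      unfolding deriv_bound_def using b by (meson order_trans)
  qed
qed

section \<open>Test functions and Schwartz functions\<close>

lemma tendsto_poly_exp_minus_at_top:
  fixes p :: "real poly"
  shows "((\<lambda>y. poly p y * exp (- y)) \<longlongrightarrow> 0) at_top"
proof -
  have "((\<lambda>y. \<Sum>i\<le>degree p. coeff p i * (y ^ i / exp y)) \<longlongrightarrow> (\<Sum>i\<le>degree p. coeff p i * 0)) at_top"
    by (intro tendsto_intros tendsto_power_div_exp_0)
  then show ?thesis
    by (simp add: poly_altdef exp_minus divide_inverse sum_distrib_right mult.assoc)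
qed

text \<open>\<open>flat 1\<close> is the classical exp (- 1 / t), extended by 0. The polynomial
  factor in 1 / t makes the family closed under differentiation, as \<open>smooth_compose\<close>
  demands.\<close>

definition flat :: "real poly \<Rightarrow> real \<Rightarrow> real" where
  "flat p t = (if t > 0 then poly p (1 / t) * exp (- (1 / t)) else 0)"

text \<open>With x = 1 / t one has dx/dt = - x^2, so the derivative of p(x) exp (- x) in t is x^2 (p
  - p')(x) exp (- x). At t = 0 the exponential beats every polynomial.\<close>

lemma flat_has_derivative:
  "(flat p has_field_derivative flat (monom 1 2 * (p - pderiv p)) t) (at t)"
proof -
  consider "t < 0" | "t > 0" | "t = 0" by linarith
  then show ?thesis
  proof cases
    case 1
    have "((\<lambda>_. 0) has_field_derivative 0) (at t)" by simp
    then have "(flat p has_field_derivative 0) (at t)"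
      by (rule has_field_derivative_transform_within_open[where S = "{..<0}"]) (use 1 in \<open>auto simp: flat_def\<close>)
    with 1 show ?thesis by (simp add: flat_def)
  next
    case 2
    have "((\<lambda>t. poly p (1 / t) * exp (- (1 / t))) has_field_derivative
        flat (monom 1 2 * (p - pderiv p)) t) (at t)"
      using 2 by (auto intro!: derivative_eq_intros
          simp: flat_def poly_monom power2_eq_square field_simps)
    then show ?thesis
      by (rule has_field_derivative_transform_within_open[where S = "{0<..}"]) (use 2 in \<open>auto simp: flat_def\<close>)
  next
    case 3
    have "((\<lambda>y. flat p y / y) \<longlongrightarrow> 0) (at_right 0)"
    proof -
      \<comment> \<open>\<open>pCons 0 p\<close> is x p(x): the extra factor x = 1 / y is the
        denominator of the difference quotient at 0.\<close>
      have "((\<lambda>y. poly (pCons 0 p) (inverse y) * exp (- inverse y)) \<longlongrightarrow> 0) (at_right 0)"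
        by (rule filterlim_compose[OF tendsto_poly_exp_minus_at_top filterlim_inverse_at_top_right])
      moreover have "eventually (\<lambda>y. poly (pCons 0 p) (inverse y) * exp (- inverse y) = flat p y / y) (at_right 0)"
        using eventually_at_right_less[of "0::real"] by eventually_elim (simp add: flat_def divide_inverse)
      ultimately show ?thesis by (rule Lim_transform_eventually)
    qed
    moreover have "((\<lambda>y. flat p y / y) \<longlongrightarrow> 0) (at_left 0)"
    proof (rule Lim_transform_eventually[OF tendsto_const])
      show "eventually (\<lambda>y. 0 = flat p y / y) (at_left 0)"
        unfolding eventually_at_filter by (auto simp: flat_def)
    qed
    ultimately have "((\<lambda>y. flat p y / y) \<longlongrightarrow> 0) (at 0)"
      by (simp add: filterlim_at_split)
    then show ?thesis using 3 by (simp add: DERIV_def flat_def)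
  qed
qed

lemma smooth_flat:
  assumes "smooth q"
  shows "smooth (\<lambda>x. flat p (q x))"
proof -
  define G where "G k = flat (((\<lambda>p. monom 1 2 * (p - pderiv p)) ^^ k) p)" for k
  have "(G k has_field_derivative G (Suc k) x) (at x)" for k x
    unfolding G_def by (simp add: flat_has_derivative)
  from smooth_compose[of G q 0, OF this assms] show ?thesis by (simp add: G_def)
qed

text \<open>A smooth descent from 1 to 0 without an integral, by nesting the flat function. For y
  \<le> 0 the inner difference is the full constant \<open>flat 1 1\<close>, which the denominator
  normalises; for y \<ge> 1 it is not positive, since exp (- 1 / y) increases, and the outer
  function vanishes.\<close>

definition step :: "real \<Rightarrow> real" where
  "step y = flat 1 (flat 1 1 - flat 1 y) / flat 1 (flat 1 1)"

lemma step_eq_1: "y \<le> 0 \<Longrightarrow> step y = 1"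
  by (simp add: step_def flat_def)

lemma step_eq_0: "y \<ge> 1 \<Longrightarrow> step y = 0"
  by (simp add: step_def flat_def)

lemma smooth_step: "smooth q \<Longrightarrow> smooth (\<lambda>x. step (q x))"
  unfolding step_def divide_inverse by (intro smooth_mult smooth_flat smooth_diff smooth_const)

lemma bounded_linear_component: "bounded_linear (\<lambda>x::real^'m. x $ i)"
  by (rule bounded_linear_vec_nth)

lemma smooth_component: "smooth (\<lambda>x::real^'m. x $ i)"
  by (rule smooth_linear[OF bounded_linear_component])

lemma norm_power2_vec: "norm (x::real^'m) ^ 2 = (\<Sum>i\<in>UNIV. (x $ i) ^ 2)"
  unfolding power2_norm_eq_inner inner_vec_def by (simp add: power2_eq_square)

lemma smooth_norm_power2: "smooth (\<lambda>x::real^'m. norm (x - a) ^ 2)"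
  unfolding norm_power2_vec vector_minus_component
  by (intro smooth_sum smooth_power smooth_diff smooth_component smooth_const)

text \<open>For 0 \<le> r < R this is 1 on the closed ball of radius r around a and 0 from radius R
  on. The squared norm is used because the norm is not differentiable at the centre.\<close>

definition bump :: "real^'m \<Rightarrow> real \<Rightarrow> real \<Rightarrow> real^'m \<Rightarrow> complex" where
  "bump a r R x = of_real (step ((norm (x - a) ^ 2 - r ^ 2) / (R ^ 2 - r ^ 2)))"

lemma smooth_bump: "smooth (bump a r R)"
  unfolding bump_def divide_inverse
  by (intro smooth_of_real smooth_step smooth_mult smooth_diff smooth_norm_power2 smooth_const)

lemma bump_eq_1:
  assumes "0 \<le> r" "r < R" "norm (x - a) \<le> r"
  shows "bump a r R x = 1"
proof -
  have "norm (x - a) ^ 2 \<le> r ^ 2" "r ^ 2 < R ^ 2" using assms by (auto intro: power_mono power_strict_mono)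
  then show ?thesis unfolding bump_def by (subst step_eq_1) (auto simp: divide_le_0_iff)
qed

lemma bump_eq_0:
  assumes "0 \<le> r" "r < R" "norm (x - a) \<ge> R"
  shows "bump a r R x = 0"
proof -
  have "norm (x - a) ^ 2 \<ge> R ^ 2" "r ^ 2 < R ^ 2" using assms by (auto intro: power_mono power_strict_mono)
  then show ?thesis unfolding bump_def by (subst step_eq_0) auto
qed

section \<open>Supports, test functions and cutoffs\<close>

lemma fun_support_subset: "closed S \<Longrightarrow> (\<And>x. x \<notin> S \<Longrightarrow> f x = 0) \<Longrightarrow> fun_support f \<subseteq> S"
  unfolding fun_support_def by (rule closure_minimal) auto

lemma not_in_fun_support: "x \<notin> fun_support f \<Longrightarrow> f x = 0"
  unfolding fun_support_def using closure_subset[of "{x. f x \<noteq> 0}"] by auto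

lemma test_functionsI:
  assumes "smooth f" "\<And>x. norm x > R \<Longrightarrow> f x = 0"
  shows "f \<in> test_functions"
proof -
  have "fun_support f \<subseteq> cball 0 R" using assms by (intro fun_support_subset) auto
  moreover have "closed (fun_support f)" by (simp add: fun_support_def)
  ultimately show ?thesis
    using assms(1) bounded_subset[OF bounded_cball]
    by (auto simp: test_functions_def compact_eq_bounded_closed)
qed

lemma test_functionsE:
  assumes "f \<in> test_functions"
  obtains R where "R > 0" "\<And>x. norm x \<ge> R \<Longrightarrow> f x = 0"
proof -
  have "bounded (fun_support f)" using assms compact_imp_bounded by (auto simp: test_functions_def)
  then obtain R where R: "\<And>x. x \<in> fun_support f \<Longrightarrow> norm x \<le> R" by (auto simp: bounded_iff)
  show ?thesis
  proof (rule that)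
    show "\<bar>R\<bar> + 1 > 0" by simp
    show "f x = 0" if "norm x \<ge> \<bar>R\<bar> + 1" for x
      using R[of x] that by (intro not_in_fun_support) auto
  qed
qed

lemma test_functions_smooth: "f \<in> test_functions \<Longrightarrow> smooth f"
  by (simp add: test_functions_def)

lemma test_functions_mult:
  assumes "g \<in> test_functions" "smooth f"
  shows "(\<lambda>x. g x * f x) \<in> test_functions"
proof -
  obtain R where "\<And>x. norm x \<ge> R \<Longrightarrow> g x = 0" using assms test_functionsE by blast
  then show ?thesis using assms by (intro test_functionsI[of _ R] smooth_mult) (auto simp: test_functions_smooth)
qed

lemma test_functions_add:
  assumes "g \<in> test_functions" "f \<in> test_functions"
  shows "(\<lambda>x. g x + f x) \<in> test_functions"
proof -
  obtain R where R: "\<And>x. norm x \<ge> R \<Longrightarrow> g x = 0" using assms test_functionsE by blast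
  obtain R' where R': "\<And>x. norm x \<ge> R' \<Longrightarrow> f x = 0" using assms test_functionsE by blast
  show ?thesis using assms R R'
    by (intro test_functionsI[of _ "max R R'"] smooth_add) (auto simp: test_functions_smooth)
qed

lemma test_functions_partial_derivs:
  assumes "f \<in> test_functions"
  shows "partial_derivs is f \<in> test_functions"
proof -
  obtain R where R: "\<And>x. norm x \<ge> R \<Longrightarrow> f x = 0" using assms test_functionsE by blast
  show ?thesis
  proof (rule test_functionsI[of _ R])
    show "partial_derivs is f x = 0" if "norm x > R" for x
      by (rule partial_derivs_eq_0_open[of "- cball 0 R"]) (use R that in auto)
  qed (use assms test_functions_smooth smooth_partial_derivs in blast)
qed

lemma bump_test_function: "0 \<le> r \<Longrightarrow> r < R \<Longrightarrow> bump a r R \<in> test_functions"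
proof (rule test_functionsI[of _ "norm a + R", OF smooth_bump])
  fix x :: "real^'a" assume "0 \<le> r" "r < R" "norm x > norm a + R"
  moreover have "norm (x - a) \<ge> norm x - norm a" by (rule norm_triangle_ineq2)
  ultimately show "bump a r R x = 0" by (intro bump_eq_0) auto
qed

lemma cutoff_exists:
  assumes "compact K"
  shows "\<exists>\<eta>. is_cutoff K \<eta>"
proof -
  obtain r where r: "\<And>x. x \<in> K \<Longrightarrow> norm x \<le> r"
    using compact_imp_bounded[OF assms] by (auto simp: bounded_iff)
  let ?r = "\<bar>r\<bar> + 1"
  have "is_cutoff K (bump 0 ?r (?r + 1))"
    unfolding is_cutoff_def
  proof (intro conjI exI[of _ "ball 0 ?r"])
    show "K \<subseteq> ball 0 ?r" using r by fastforce
    show "\<forall>x\<in>ball 0 ?r. bump 0 ?r (?r + 1) x = 1" by (auto intro!: bump_eq_1)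
  qed (auto intro: bump_test_function)
  then show ?thesis by blast
qed

lemma is_cutoff_mono: "is_cutoff K \<eta> \<Longrightarrow> L \<subseteq> K \<Longrightarrow> is_cutoff L \<eta>"
  unfolding is_cutoff_def by blast

lemma is_cutoff_test_function: "is_cutoff K \<eta> \<Longrightarrow> \<eta> \<in> test_functions"
  unfolding is_cutoff_def by blast

section \<open>Schwartz functions and their norms\<close>

lemma schwartz_smooth: "f \<in> schwartz \<Longrightarrow> smooth f"
  by (simp add: schwartz_def)

lemma schwartzI:
  assumes "smooth f" "\<And>k is. \<exists>B. \<forall>x. (1 + norm x) ^ k * norm (partial_derivs is f x) \<le> B"
  shows "f \<in> schwartz"
  using assms by (auto simp: schwartz_def bounded_iff)

lemma schwartz_bound:
  assumes "f \<in> schwartz"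
  obtains B where "\<And>x. (1 + norm x) ^ k * norm (partial_derivs is f x) \<le> B"
proof -
  have "bounded (range (\<lambda>x. (1 + norm x) ^ k *\<^sub>R partial_derivs is f x))"
    using assms by (auto simp: schwartz_def)
  then show ?thesis using that by (auto simp: bounded_iff)
qed

lemma schwartz_add:
  assumes "f \<in> schwartz" "g \<in> schwartz"
  shows "(\<lambda>x. f x + g x) \<in> schwartz"
proof (rule schwartzI)
  note s = schwartz_smooth[OF assms(1)] schwartz_smooth[OF assms(2)]
  show "smooth (\<lambda>x. f x + g x)" using s by (rule smooth_add)
  fix k "is"
  obtain A where A: "\<And>x. (1 + norm x) ^ k * norm (partial_derivs is f x) \<le> A"
    using schwartz_bound[OF assms(1)] by blast
  obtain B where B: "\<And>x. (1 + norm x) ^ k * norm (partial_derivs is g x) \<le> B"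
    using schwartz_bound[OF assms(2)] by blast
  have "(1 + norm x) ^ k * norm (partial_derivs is f x + partial_derivs is g x) \<le> A + B" for x
  proof -
    have "(1 + norm x) ^ k * norm (partial_derivs is f x + partial_derivs is g x)
      \<le> (1 + norm x) ^ k * (norm (partial_derivs is f x) + norm (partial_derivs is g x))"
      by (intro mult_left_mono norm_triangle_ineq) simp
    also have "\<dots> \<le> A + B" using A[of x] B[of x] by (simp add: distrib_left)
    finally show ?thesis .
  qed
  then show "\<exists>B. \<forall>x. (1 + norm x) ^ k * norm (partial_derivs is (\<lambda>x. f x + g x) x) \<le> B"
    by (auto simp: partial_derivs_add[OF s])
qed

lemma schwartz_cmult:
  assumes "f \<in> schwartz"
  shows "(\<lambda>x. c * f x) \<in> schwartz"
proof (rule schwartzI)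
  note s = schwartz_smooth[OF assms(1)]
  show "smooth (\<lambda>x. c * f x)" using s by (rule smooth_cmult)
  fix k "is"
  obtain A where A: "\<And>x. (1 + norm x) ^ k * norm (partial_derivs is f x) \<le> A"
    using schwartz_bound[OF assms(1)] by blast
  have "(1 + norm x) ^ k * norm (c * partial_derivs is f x) \<le> norm c * A" for x
    using mult_left_mono[OF A[of x], of "norm c"] by (simp add: norm_mult mult_ac)
  then show "\<exists>B. \<forall>x. (1 + norm x) ^ k * norm (partial_derivs is (\<lambda>x. c * f x) x) \<le> B"
    by (auto simp: partial_derivs_bounded_linear[OF s bounded_linear_mult_right])
qed

lemma schwartz_diff: "f \<in> schwartz \<Longrightarrow> g \<in> schwartz \<Longrightarrow> (\<lambda>x. f x - g x) \<in> schwartz"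
  using schwartz_add[of f "\<lambda>x. - 1 * g x"] schwartz_cmult[of g "- 1"] by simp

lemma test_functions_schwartz:
  assumes "f \<in> test_functions"
  shows "f \<in> schwartz"
proof (rule schwartzI)
  note s = test_functions_smooth[OF assms]
  show "smooth f" by fact
  fix k "is"
  obtain R where R: "\<And>x. norm x \<ge> R \<Longrightarrow> partial_derivs is f x = 0"
    using test_functionsE[OF test_functions_partial_derivs[OF assms]] by metis
  have "continuous_on (cball 0 R) (\<lambda>x. (1 + norm x) ^ k * norm (partial_derivs is f x))"
    by (intro continuous_intros smooth_continuous_on smooth_partial_derivs s)
  from compact_imp_bounded[OF compact_continuous_image[OF this]]
  obtain B where "\<forall>x\<in>cball 0 R. (1 + norm x) ^ k * norm (partial_derivs is f x) \<le> B"
    by (auto simp: bounded_iff)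
  then have B: "\<And>x. norm x \<le> R \<Longrightarrow> (1 + norm x) ^ k * norm (partial_derivs is f x) \<le> B"
    by simp
  have "(1 + norm x) ^ k * norm (partial_derivs is f x) \<le> max B 0" for x
    using B[of x] R[of x] by (cases "norm x \<le> R") auto
  then show "\<exists>B. \<forall>x. (1 + norm x) ^ k * norm (partial_derivs is f x) \<le> B" by blast
qed

text \<open>Under this hypothesis the supremum is that of a bounded set, and the pair
  \<open>([], 0)\<close> shows that it is nonnegative. The absolute value spares later estimates a
  sign argument.\<close>

lemma schwartz_norm_le:
  assumes "\<And>is x. length is \<le> N \<Longrightarrow> (1 + norm x) ^ N * norm (partial_derivs is f x) \<le> c"
  shows "\<bar>schwartz_norm N f\<bar> \<le> c"
proof -
  let ?A = "{is. length is \<le> N} \<times> UNIV"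
  let ?g = "\<lambda>(is, x). (1 + norm x) ^ N * norm (partial_derivs is f x)"
  have mem: "([], 0) \<in> ?A" by simp
  have "bdd_above (?g ` ?A)" using assms by (intro bdd_aboveI2[of _ _ c]) auto
  then have "?g ([], 0) \<le> schwartz_norm N f"
    unfolding schwartz_norm_def by (rule cSUP_upper2[OF _ mem]) auto
  moreover have "?g ([], 0) \<ge> 0" by (simp del: norm_zero)
  moreover have "schwartz_norm N f \<le> c"
    unfolding schwartz_norm_def using assms by (intro cSUP_least) (auto intro: exI[of _ "[]"])
  ultimately show ?thesis by linarith
qed

lemma schwartz_norm_upper:
  assumes "f \<in> schwartz" "length is \<le> N"
  shows "(1 + norm x) ^ N * norm (partial_derivs is f x) \<le> schwartz_norm N f"
proof -
  have "\<exists>B. \<forall>x. (1 + norm x) ^ N * norm (partial_derivs is f x) \<le> B" for "is"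
    using schwartz_bound[OF assms(1)] by metis
  then obtain B where B: "\<And>is x. (1 + norm x) ^ N * norm (partial_derivs is f x) \<le> B is" by metis
  have fin: "finite {is::'a list. length is \<le> N}"
    using finite_lists_length_le[of "UNIV::'a set" N] by simp
  have "B is \<le> (\<Sum>is | length is \<le> N. \<bar>B is\<bar>)" if "length is \<le> N" for "is"
    using member_le_sum[of "is" "{is. length is \<le> N}" "\<lambda>is. \<bar>B is\<bar>"] that fin by auto
  then have "(1 + norm x) ^ N * norm (partial_derivs is f x) \<le> (\<Sum>is | length is \<le> N. \<bar>B is\<bar>)"
    if "length is \<le> N" for "is" x
    using B that by (meson order_trans)
  then have "bdd_above ((\<lambda>(is, x). (1 + norm x) ^ N * norm (partial_derivs is f x)) ` ({is. length is \<le> N} \<times> UNIV))"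
    by (intro bdd_aboveI2) auto
  then show ?thesis
    unfolding schwartz_norm_def using assms(2) by (intro cSUP_upper2[where x = "(is, x)"]) auto
qed

section \<open>Tempered distributions of compact support\<close>

lemma tempered_add:
  "u \<in> tempered \<Longrightarrow> f \<in> schwartz \<Longrightarrow> g \<in> schwartz \<Longrightarrow> u (\<lambda>x. f x + g x) = u f + u g"
  by (simp add: tempered_def)

lemma tempered_cmult: "u \<in> tempered \<Longrightarrow> f \<in> schwartz \<Longrightarrow> u (\<lambda>x. c * f x) = c * u f"
  by (simp add: tempered_def)

lemma tempered_diff:
  "u \<in> tempered \<Longrightarrow> f \<in> schwartz \<Longrightarrow> g \<in> schwartz \<Longrightarrow> u (\<lambda>x. f x - g x) = u f - u g"
  using tempered_add[of u f "\<lambda>x. - 1 * g x"] tempered_cmult[of u g "- 1"] schwartz_cmult[of g "- 1"]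
  by simp

lemma zero_test_function: "(\<lambda>x. 0) \<in> test_functions"
  by (rule test_functionsI[of _ 0]) auto

lemma tempered_zero: "u \<in> tempered \<Longrightarrow> u (\<lambda>x. 0) = 0"
  using tempered_cmult[of u "\<lambda>x. 0" 0] test_functions_schwartz[OF zero_test_function] by simp

lemma tempered_sum:
  assumes "u \<in> tempered" "finite I" "\<And>i. i \<in> I \<Longrightarrow> f i \<in> test_functions"
  shows "(\<lambda>x. \<Sum>i\<in>I. f i x) \<in> test_functions \<and> u (\<lambda>x. \<Sum>i\<in>I. f i x) = (\<Sum>i\<in>I. u (f i))"
  using assms(2,3)
  by (induction I rule: finite_induct)
    (auto simp: zero_test_function tempered_zero[OF assms(1)] tempered_add[OF assms(1)] test_functions_add
      test_functions_schwartz)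

lemma tempered_normE:
  assumes "u \<in> tempered"
  obtains C N where "C \<ge> 0" "\<And>f. f \<in> schwartz \<Longrightarrow> norm (u f) \<le> C * \<bar>schwartz_norm N f\<bar>"
proof -
  obtain C N where C: "\<And>f. f \<in> schwartz \<Longrightarrow> norm (u f) \<le> C * schwartz_norm N f"
    using assms unfolding tempered_def by blast
  have "norm (u f) \<le> \<bar>C\<bar> * \<bar>schwartz_norm N f\<bar>" if "f \<in> schwartz" for f
    using C[OF that] by (metis abs_ge_self abs_mult order_trans)
  then show ?thesis using that[of "\<bar>C\<bar>"] by auto
qed

text \<open>Only a ball of radius R containing the support of g matters. There the weight is at most
  (1 + R)^N, and the product rule bounds the derivatives of g f. The growth of f at infinity is
  thereby irrelevant, so that f may be an exponential or a polynomial.\<close>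

lemma tempered_test_bound:
  fixes u :: "'m::finite functional"
  assumes "u \<in> tempered" "g \<in> test_functions"
  shows "\<exists>C N S. C \<ge> 0 \<and> compact S \<and> (\<forall>(f :: real^'m \<Rightarrow> complex) c.
    smooth f \<longrightarrow> 0 \<le> c \<longrightarrow> deriv_bound N S f c \<longrightarrow> norm (u (\<lambda>x. g x * f x)) \<le> C * c)"
proof -
  obtain D N where D: "D \<ge> 0" "\<And>f. f \<in> schwartz \<Longrightarrow> norm (u f) \<le> D * \<bar>schwartz_norm N f\<bar>"
    using tempered_normE[OF assms(1)] by blast
  obtain R where R: "R > 0" "\<And>x. norm x \<ge> R \<Longrightarrow> g x = 0" using test_functionsE[OF assms(2)] by blast
  note sg = test_functions_smooth[OF assms(2)]
  obtain b where b: "b \<ge> 0" "deriv_bound N (cball 0 R) g b"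
    using deriv_bound_compact[OF sg compact_cball] by blast
  show ?thesis
  proof (intro exI conjI allI impI)
    fix f :: "real^'m \<Rightarrow> complex" and c assume f: "smooth f" "0 \<le> c" "deriv_bound N (cball 0 R) f c"
    let ?h = "\<lambda>x. g x * f x"
    have *: "deriv_bound N (cball 0 R) ?h (2 ^ N * b * c)"
      by (intro deriv_bound_mult sg f b)
    have "(1 + norm x) ^ N * norm (partial_derivs is ?h x) \<le> (1 + R) ^ N * (2 ^ N * b * c)"
      if "length is \<le> N" for "is" x
    proof (cases "norm x \<le> R")
      case True
      then show ?thesis using * that R f(2) b(1)
        by (intro mult_mono power_mono) (auto simp: deriv_bound_def)
    next
      case False
      have "partial_derivs is ?h x = 0"
        by (rule partial_derivs_eq_0_open[of "- cball 0 R"]) (use False R in auto)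
      then show ?thesis using R f(2) b(1) by simp
    qed
    then have "\<bar>schwartz_norm N ?h\<bar> \<le> (1 + R) ^ N * (2 ^ N * b * c)" by (rule schwartz_norm_le)
    then have "norm (u ?h) \<le> D * ((1 + R) ^ N * (2 ^ N * b * c))"
      using D(2)[OF test_functions_schwartz[OF test_functions_mult[OF assms(2) f(1)]]] D(1)
      by (meson mult_left_mono order_trans)
    then show "norm (u ?h) \<le> (D * (1 + R) ^ N * 2 ^ N * b) * c" by (simp add: mult_ac)
  qed (use D b R in auto)
qed

text \<open>The union of all null open sets has to be shown null itself. In place of a partition of
  unity, \<open>\<phi>\<close> is multiplied by finitely many factors \<open>1 - b x\<close>: each
  of them changes \<open>\<phi>\<close> by a test function supported in a null ball, and together
  they annihilate it.\<close>

lemma tempered_vanishes_off_support: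
  fixes u :: "'m::finite functional"
  assumes "u \<in> tempered" "\<phi> \<in> test_functions" "fun_support \<phi> \<inter> distr_support u = {}"
  shows "u \<phi> = 0"
proof -
  let ?C = "fun_support \<phi>"
  \<comment> \<open>The doubled radius leaves room for a bump that is 1 on the ball of radius r, and
    it is those smaller balls that cover the support.\<close>
  have "\<exists>r>0. \<forall>\<psi>\<in>test_functions. fun_support \<psi> \<subseteq> cball x (2 * r) \<longrightarrow> u \<psi> = 0" if "x \<in> ?C" for x
  proof -
    have "x \<notin> distr_support u" using that assms(3) by blast
    then have "\<exists>V. open V \<and> (\<forall>\<psi>\<in>test_functions. fun_support \<psi> \<subseteq> V \<longrightarrow> u \<psi> = 0) \<and> x \<in> V"
      by (simp add: distr_support_def)
    then obtain V where V: "open V" "x \<in> V"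
      "\<And>\<psi>. \<psi> \<in> test_functions \<Longrightarrow> fun_support \<psi> \<subseteq> V \<Longrightarrow> u \<psi> = 0"
      by auto
    then obtain e where e: "e > 0" "cball x e \<subseteq> V" by (metis open_contains_cball)
    show ?thesis
    proof (intro exI[of _ "e/2"] conjI ballI impI)
      show "u \<psi> = 0" if "\<psi> \<in> test_functions" "fun_support \<psi> \<subseteq> cball x (2 * (e/2))" for \<psi>
        using that e(2) by (intro V(3)) auto
    qed (use e in auto)
  qed
  then obtain r where r: "\<And>x. x \<in> ?C \<Longrightarrow> r x > 0"
    "\<And>x \<psi>. x \<in> ?C \<Longrightarrow> \<psi> \<in> test_functions \<Longrightarrow> fun_support \<psi> \<subseteq> cball x (2 * r x) \<Longrightarrow> u \<psi> = 0"
    by metis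
  have "compact ?C" using assms(2) by (simp add: test_functions_def)
  moreover have "?C \<subseteq> (\<Union>x\<in>?C. ball x (r x))" using r(1) by force
  ultimately obtain D where D: "D \<subseteq> ?C" "finite D" "?C \<subseteq> (\<Union>x\<in>D. ball x (r x))"
    using compactE_image[of ?C ?C "\<lambda>x. ball x (r x)"] by auto
  define b where "b x = bump x (r x) (2 * r x)" for x
  have bs: "smooth (\<lambda>y. 1 - b x y)" for x
    unfolding b_def by (intro smooth_diff smooth_const smooth_bump)
  have "(\<lambda>y. \<phi> y * (\<Prod>x\<in>E. 1 - b x y)) \<in> test_functions \<and> u (\<lambda>y. \<phi> y * (\<Prod>x\<in>E. 1 - b x y)) = u \<phi>"
    if "finite E" "E \<subseteq> D" for E
    using that
  proof (induction E rule: finite_induct)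
    case empty
    then show ?case using assms(2) by simp
  next
    case (insert x E)
    define g where "g = (\<lambda>y. \<phi> y * (\<Prod>x\<in>E. 1 - b x y))"
    have g: "g \<in> test_functions" "u g = u \<phi>" using insert by (auto simp: g_def)
    have x: "x \<in> ?C" "r x > 0" using insert D r by auto
    have bt: "b x \<in> test_functions" unfolding b_def using x by (intro bump_test_function) auto
    have gb: "(\<lambda>y. g y * b x y) \<in> test_functions"
      using g bt by (intro test_functions_mult) (auto simp: test_functions_smooth)
    have "b x y = 0" if "y \<notin> cball x (2 * r x)" for y
      unfolding b_def using that x by (intro bump_eq_0) (auto simp: dist_norm norm_minus_commute)
    then have "fun_support (\<lambda>y. g y * b x y) \<subseteq> cball x (2 * r x)"
      by (intro fun_support_subset) auto
    then have "u (\<lambda>y. g y * b x y) = 0" using r(2) x gb by blast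
    then have "u (\<lambda>y. g y - g y * b x y) = u \<phi>"
      using tempered_diff[OF assms(1) test_functions_schwartz[OF g(1)] test_functions_schwartz[OF gb]] g by simp
    moreover have "(\<lambda>y. \<phi> y * (\<Prod>x\<in>insert x E. 1 - b x y)) = (\<lambda>y. g y - g y * b x y)"
      using insert by (auto simp: g_def algebra_simps)
    moreover have "(\<lambda>y. g y - g y * b x y) = (\<lambda>y. g y * (1 - b x y))" by (auto simp: algebra_simps)
    ultimately show ?case using test_functions_mult[OF g(1) bs] by simp
  qed
  from this[OF D(2)] have "u (\<lambda>y. \<phi> y * (\<Prod>x\<in>D. 1 - b x y)) = u \<phi>" by simp
  moreover have "\<phi> y * (\<Prod>x\<in>D. 1 - b x y) = 0" for y
  proof (cases "y \<in> ?C")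
    case True
    then obtain x where x: "x \<in> D" "y \<in> ball x (r x)" using D(3) by blast
    moreover have "r x > 0" using r(1) D(1) x by blast
    ultimately have "b x y = 1"
      unfolding b_def by (intro bump_eq_1) (auto simp: dist_norm norm_minus_commute)
    then have "(\<Prod>x\<in>D. 1 - b x y) = 0" using D(2) x(1) by (auto intro!: prod_zero)
    then show ?thesis by simp
  qed (auto simp: not_in_fun_support)
  ultimately show ?thesis using tempered_zero[OF assms(1)] by simp
qed

lemma deriv_bound_const: "deriv_bound N S (\<lambda>x. c) (norm c)"
  by (cases N) (simp_all add: deriv_bound_0 deriv_bound_Suc, simp add: deriv_bound_def)

lemma test_functions_deriv_bound:
  assumes "g \<in> test_functions"
  obtains c where "c \<ge> 0" "deriv_bound N UNIV g c"
proof -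
  obtain R where R: "R > 0" "\<And>x. norm x \<ge> R \<Longrightarrow> g x = 0" using test_functionsE[OF assms] by blast
  obtain c where c: "c \<ge> 0" "deriv_bound N (cball 0 R) g c"
    using deriv_bound_compact[OF test_functions_smooth[OF assms] compact_cball] by blast
  have "norm (partial_derivs is g x) \<le> c" if "length is \<le> N" for "is" x
  proof (cases "norm x \<le> R")
    case False
    have "partial_derivs is g x = 0"
      by (rule partial_derivs_eq_0_open[of "- cball 0 R"]) (use False R in auto)
    then show ?thesis using c by simp
  qed (use c that in \<open>auto simp: deriv_bound_def\<close>)
  then show ?thesis using that c by (auto simp: deriv_bound_def)
qed

text \<open>The difference of \<open>\<phi>\<close> and its cutoff vanishes near the support of u
  but need not have compact support. Truncated at radius about n it is annihilated by u; the tail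
  tends to 0 in the N-th Schwartz norm. This also shows that values computed through a cutoff do not
  depend on its choice.\<close>

lemma tempered_cutoff:
  fixes u :: "'m::finite functional"
  assumes u: "u \<in> tempered" and \<eta>: "is_cutoff (distr_support u) \<eta>" and \<phi>: "\<phi> \<in> schwartz"
  shows "u (\<lambda>x. \<eta> x * \<phi> x) = u \<phi>"
proof -
  obtain V where V: "open V" "distr_support u \<subseteq> V" "\<And>x. x \<in> V \<Longrightarrow> \<eta> x = 1" and \<eta>t: "\<eta> \<in> test_functions"
    using \<eta> by (auto simp: is_cutoff_def)
  have \<eta>\<phi>: "(\<lambda>x. \<eta> x * \<phi> x) \<in> schwartz"
    using test_functions_schwartz[OF test_functions_mult[OF \<eta>t schwartz_smooth[OF \<phi>]]] .
  define \<rho> where "\<rho> = (\<lambda>x. \<phi> x - \<eta> x * \<phi> x)"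
  have \<rho>: "\<rho> \<in> schwartz" unfolding \<rho>_def by (intro schwartz_diff \<phi> \<eta>\<phi>)
  have s\<rho>: "smooth \<rho>" using \<rho> schwartz_smooth by blast
  define \<theta> :: "real^'m \<Rightarrow> complex" where "\<theta> = (\<lambda>x. 1 - bump 0 1 2 x)"
  have s\<theta>: "smooth \<theta>" unfolding \<theta>_def by (intro smooth_diff smooth_const smooth_bump)
  obtain D N where D: "D \<ge> 0" "\<And>f. f \<in> schwartz \<Longrightarrow> norm (u f) \<le> D * \<bar>schwartz_norm N f\<bar>"
    using tempered_normE[OF u] by blast
  obtain b where b: "b \<ge> 0" "deriv_bound N UNIV \<theta> b"
  proof -
    have "(bump 0 1 2 :: real^'m \<Rightarrow> complex) \<in> test_functions" by (rule bump_test_function) auto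
    then obtain c where c: "c \<ge> 0" "deriv_bound N UNIV (bump 0 1 2 :: real^'m \<Rightarrow> complex) c"
      by (rule test_functions_deriv_bound)
    then have "deriv_bound N UNIV \<theta> (norm (1::complex) + c)" "norm (1::complex) + c \<ge> 0"
      unfolding \<theta>_def by (intro deriv_bound_diff deriv_bound_const smooth_bump smooth_const) (simp_all add: c)
    then show ?thesis by (rule that[rotated])
  qed
  \<comment> \<open>One weight more than the continuity estimate of u involves: the surplus factor 1
    + |x| is what makes the tail of order 1 / (n + 1).\<close>
  define M where "M = \<bar>schwartz_norm (Suc N) \<rho>\<bar>"
  have est: "norm (u \<rho>) \<le> (D * 2 ^ N * b * M) * inverse (real (Suc n))" for n
  proof -
    define s where "s = inverse (real (Suc n))"
    have s: "s > 0" "s \<le> 1" by (auto simp: s_def inverse_le_1_iff)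
    \<comment> \<open>\<open>\<theta>'\<close> is 0 up to radius n + 1 and 1 from radius 2 (n + 1)
      on. Every derivative brings a factor s \<le> 1, so the bound b is independent of n.\<close>
    define \<theta>' where "\<theta>' = (\<lambda>x. \<theta> (s *\<^sub>R x + 0))"
    have s\<theta>': "smooth \<theta>'" unfolding \<theta>'_def using s\<theta> by (rule smooth_affine)
    have b': "deriv_bound N UNIV \<theta>' b"
      unfolding deriv_bound_def \<theta>'_def partial_derivs_affine[OF s\<theta>]
    proof (intro allI impI)
      fix "is" :: "'m list" and x assume "length is \<le> N"
      have "norm (s ^ length is *\<^sub>R partial_derivs is \<theta> (s *\<^sub>R x + 0)) \<le> 1 * b"
        unfolding norm_scaleR using b \<open>length is \<le> N\<close> s
        by (intro mult_mono) (auto simp: deriv_bound_def power_le_one)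
      then show "norm (s ^ length is *\<^sub>R partial_derivs is \<theta> (s *\<^sub>R x + 0)) \<le> b" by simp
    qed
    define f where "f = (\<lambda>x. (1 - \<theta>' x) * \<rho> x)"
    have ft: "f \<in> test_functions"
    proof (rule test_functionsI[of _ "2 * real (Suc n)"])
      show "smooth f" unfolding f_def by (intro smooth_mult smooth_diff smooth_const s\<theta>' s\<rho>)
      show "f x = 0" if "2 * real (Suc n) < norm x" for x
      proof -
        have "bump 0 1 2 (s *\<^sub>R x) = 0"
          using that by (intro bump_eq_0) (auto simp: s_def field_simps)
        then show ?thesis by (simp add: f_def \<theta>'_def \<theta>_def)
      qed
    qed
    have "fun_support f \<subseteq> - V"
      by (rule fun_support_subset) (use V in \<open>auto simp: f_def \<rho>_def\<close>)
    then have "u f = 0" using V(2) by (intro tempered_vanishes_off_support[OF u ft]) auto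
    define g where "g = (\<lambda>x. \<theta>' x * \<rho> x)"
    have g: "g = (\<lambda>x. \<rho> x - f x)" by (auto simp: g_def f_def algebra_simps)
    have gS: "g \<in> schwartz" unfolding g using \<rho> test_functions_schwartz[OF ft] by (rule schwartz_diff)
    have "u g = u \<rho>" using tempered_diff[OF u \<rho> test_functions_schwartz[OF ft]] \<open>u f = 0\<close> g by simp
    have "(1 + norm x) ^ N * norm (partial_derivs is g x) \<le> 2 ^ N * b * M * s" if "length is \<le> N" for "is" x
    proof (cases "norm x < real (Suc n)")
      case True
      have "partial_derivs is g x = 0"
      proof (rule partial_derivs_eq_0_open[of "ball 0 (real (Suc n))"])
        fix y :: "real^'m" assume "y \<in> ball 0 (real (Suc n))"
        then have "bump 0 1 2 (s *\<^sub>R y) = 1"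
          by (intro bump_eq_1) (auto simp: s_def field_simps)
        then show "g y = 0" by (simp add: g_def \<theta>'_def \<theta>_def)
      qed (use True in auto)
      then show ?thesis using b s by (simp add: M_def)
    next
      case False
      define P where "P = 1 + norm x"
      have P: "P > 0" by (simp add: P_def add_pos_nonneg)
      have "norm (partial_derivs js \<rho> x) \<le> M / P ^ Suc N" if "length js \<le> N" for js
        using schwartz_norm_upper[OF \<rho>, of js "Suc N" x] that P
        by (simp add: M_def P_def[symmetric] pos_le_divide_eq mult.commute)
      then have "deriv_bound N {x} \<rho> (M / P ^ Suc N)" by (simp add: deriv_bound_def)
      from deriv_bound_mult[OF s\<theta>' s\<rho> deriv_bound_mono[OF b'] this]
      have "norm (partial_derivs is g x) \<le> 2 ^ N * b * (M / P ^ Suc N)"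
        using that b P by (simp add: deriv_bound_def g_def M_def)
      then have "P ^ N * norm (partial_derivs is g x) \<le> P ^ N * (2 ^ N * b * (M / P ^ Suc N))"
        using P by (intro mult_left_mono) auto
      also have "\<dots> = 2 ^ N * b * M * inverse P" using P by (simp add: field_simps)
      also have "\<dots> \<le> 2 ^ N * b * M * s"
        unfolding s_def using False b by (intro mult_left_mono le_imp_inverse_le) (auto simp: P_def M_def)
      finally show ?thesis by (simp add: P_def)
    qed
    then have "\<bar>schwartz_norm N g\<bar> \<le> 2 ^ N * b * M * s" by (rule schwartz_norm_le)
    then have "norm (u g) \<le> D * (2 ^ N * b * M * s)"
      using D(2)[OF gS] D(1) by (meson mult_left_mono order_trans)
    then show ?thesis using \<open>u g = u \<rho>\<close> by (simp add: s_def mult_ac)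
  qed
  have "(\<lambda>n. (D * 2 ^ N * b * M) * inverse (real (Suc n))) \<longlonglongrightarrow> (D * 2 ^ N * b * M) * 0"
    by (intro tendsto_intros LIMSEQ_inverse_real_of_nat)
  then have "norm (u \<rho>) \<le> (D * 2 ^ N * b * M) * 0"
    by (rule LIMSEQ_le_const) (use est in blast)
  then have "u \<rho> = 0" by simp
  then show ?thesis using tempered_diff[OF u \<phi> \<eta>\<phi>] by (simp add: \<rho>_def)
qed

section \<open>Kernels depending on a parameter in a box\<close>

lemma has_derivative_partial_deriv:
  fixes f :: "real^'m \<Rightarrow> 'b::real_normed_vector"
  assumes "f differentiable (at x)"
  shows "(f has_derivative (\<lambda>h. \<Sum>i\<in>UNIV. (h $ i) *\<^sub>R partial_deriv i f x)) (at x)"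
proof -
  obtain f' where f': "(f has_derivative f') (at x)" using assms by (auto simp: differentiable_def)
  note lin = has_derivative_linear[OF f']
  have "f' = (\<lambda>h. \<Sum>i\<in>UNIV. (h $ i) *\<^sub>R partial_deriv i f x)"
  proof
    fix h
    have "f' h = f' (\<Sum>i\<in>UNIV. h $ i *\<^sub>R axis i 1)"
      using basis_expansion[of h] by (simp add: scalar_mult_eq_scaleR)
    then show "f' h = (\<Sum>i\<in>UNIV. (h $ i) *\<^sub>R partial_deriv i f x)"
      by (simp add: linear_sum[OF lin] linear_scale[OF lin] partial_deriv_eqI[OF f'])
  qed
  with f' show ?thesis by simp
qed

text \<open>The Leibniz rule asks for the total derivative as a continuous function into bounded
  linear maps. Sums of these rank-one maps assemble it from partial derivatives.\<close>

definition blinfun_coord :: "'m::finite \<Rightarrow> 'b::real_normed_vector \<Rightarrow> (real^'m) \<Rightarrow>\<^sub>L 'b" where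
  "blinfun_coord i c = blinfun_scaleR_left c o\<^sub>L blinfun_inner_left (axis i 1)"

lemma blinfun_coord_apply [simp]: "blinfun_apply (blinfun_coord i c) h = (h $ i) *\<^sub>R c"
  by (simp add: blinfun_coord_def inner_axis)

lemma continuous_on_blinfun_coord [continuous_intros]:
  "continuous_on S f \<Longrightarrow> continuous_on S (\<lambda>x. blinfun_coord i (f x))"
  unfolding blinfun_coord_def by (intro continuous_intros)

lemma continuous_on_slice:
  assumes "continuous_on (UNIV \<times> Y) (\<lambda>(x, y). k x y)"
  shows "continuous_on Y (k x)"
proof -
  have "continuous_on Y (\<lambda>y. (x, y))" by (intro continuous_intros)
  from continuous_on_compose2[OF assms this] show ?thesis by auto
qed

lemma has_derivative_integral_kernel:
  fixes k :: "real^'m \<Rightarrow> 'n::euclidean_space \<Rightarrow> 'b::banach"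
  assumes d: "\<And>x y. y \<in> cbox a b \<Longrightarrow> (\<lambda>x. k x y) differentiable (at x)"
    and c: "continuous_on (UNIV \<times> cbox a b) (\<lambda>(x, y). k x y)"
    and dc: "\<And>i. continuous_on (UNIV \<times> cbox a b) (\<lambda>(x, y). partial_deriv i (\<lambda>x. k x y) x)"
  shows "((\<lambda>x. integral (cbox a b) (k x)) has_derivative
    (\<lambda>h. \<Sum>i\<in>UNIV. (h $ i) *\<^sub>R integral (cbox a b) (\<lambda>y. partial_deriv i (\<lambda>x. k x y) x))) (at x)"
proof -
  define D where "D x y = (\<Sum>i\<in>UNIV. blinfun_coord i (partial_deriv i (\<lambda>x. k x y) x))" for x y
  have D: "blinfun_apply (D x y) h = (\<Sum>i\<in>UNIV. (h $ i) *\<^sub>R partial_deriv i (\<lambda>x. k x y) x)" for x y h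
    by (simp add: D_def blinfun.sum_left)
  have Dc: "continuous_on (UNIV \<times> cbox a b) (\<lambda>(x, y). D x y)"
    using dc unfolding D_def split_beta' by (intro continuous_intros)
  have "((\<lambda>x. integral (cbox a b) (k x)) has_derivative integral (cbox a b) (D x)) (at x)"
  proof (rule leibniz_rule[where U = UNIV, simplified])
    show "((\<lambda>x. k x t) has_derivative blinfun_apply (D x t)) (at x)" if "t \<in> cbox a b" for x t
      using has_derivative_partial_deriv[OF d[OF that]] by (simp add: D[abs_def])
    show "k x integrable_on cbox a b" for x
      by (rule integrable_continuous[OF continuous_on_slice[OF c]])
  qed (use Dc in auto)
  moreover have "blinfun_apply (integral (cbox a b) (D x)) = (\<lambda>h.
     \<Sum>i\<in>UNIV. (h $ i) *\<^sub>R integral (cbox a b) (\<lambda>y. partial_deriv i (\<lambda>x. k x y) x))"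
  proof
    fix h
    have "D x integrable_on cbox a b"
      by (rule integrable_continuous[OF continuous_on_slice[OF Dc]])
    then have "blinfun_apply (integral (cbox a b) (D x)) h = integral (cbox a b) (\<lambda>y. blinfun_apply (D x y) h)"
      by (rule blinfun_apply_integral)
    also have "\<dots> = (\<Sum>i\<in>UNIV. integral (cbox a b) (\<lambda>y. (h $ i) *\<^sub>R partial_deriv i (\<lambda>x. k x y) x))"
      unfolding D
      by (intro integral_sum integrable_cmul integrable_continuous[OF continuous_on_slice[OF dc]]) simp
    finally show "blinfun_apply (integral (cbox a b) (D x)) h =
      (\<Sum>i\<in>UNIV. (h $ i) *\<^sub>R integral (cbox a b) (\<lambda>y. partial_deriv i (\<lambda>x. k x y) x))" by simp
  qed
  ultimately show ?thesis by simp
qed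

text \<open>Every x-derivative is to be jointly continuous, while y is a mere integration parameter.
  This serves both differentiation under the integral and the uniform convergence of Riemann
  sums.\<close>

definition smooth_kernel ::
    "'n::euclidean_space set \<Rightarrow> (real^'m \<Rightarrow> 'n \<Rightarrow> 'b::real_normed_vector) \<Rightarrow> bool" where
  "smooth_kernel Y k \<longleftrightarrow> (\<forall>y. smooth (\<lambda>x. k x y)) \<and>
     (\<forall>is. continuous_on (UNIV \<times> Y) (\<lambda>(x, y). partial_derivs is (\<lambda>x. k x y) x))"

lemma smooth_kernel_partial_derivs:
  fixes k :: "real^'m \<Rightarrow> 'n::euclidean_space \<Rightarrow> 'b::banach"
  assumes "smooth_kernel (cbox a b) k"
  shows "partial_derivs is (\<lambda>x. integral (cbox a b) (k x)) =
    (\<lambda>x. integral (cbox a b) (\<lambda>y. partial_derivs is (\<lambda>x. k x y) x))"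
    and "(\<lambda>x. integral (cbox a b) (\<lambda>y. partial_derivs is (\<lambda>x. k x y) x)) differentiable (at x)"
proof -
  have s: "smooth (\<lambda>x. k x y)" for y using assms by (simp add: smooth_kernel_def)
  have c: "continuous_on (UNIV \<times> cbox a b) (\<lambda>(x, y). partial_derivs is (\<lambda>x. k x y) x)" for "is"
    using assms by (simp add: smooth_kernel_def)
  have der: "((\<lambda>x. integral (cbox a b) (\<lambda>y. partial_derivs is (\<lambda>x. k x y) x)) has_derivative
    (\<lambda>h. \<Sum>i\<in>UNIV. (h $ i) *\<^sub>R integral (cbox a b) (\<lambda>y. partial_derivs (i # is) (\<lambda>x. k x y) x))) (at x)"
    for "is" x
    unfolding partial_derivs_Cons
    using smooth_differentiable[OF smooth_partial_derivs[OF s]] c[of "is"] c[of "_ # is", unfolded partial_derivs_Cons]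
    by (intro has_derivative_integral_kernel)
  show "(\<lambda>x. integral (cbox a b) (\<lambda>y. partial_derivs is (\<lambda>x. k x y) x)) differentiable (at x)"
    using der unfolding differentiable_def by blast
  show "partial_derivs is (\<lambda>x. integral (cbox a b) (k x)) =
    (\<lambda>x. integral (cbox a b) (\<lambda>y. partial_derivs is (\<lambda>x. k x y) x))"
  proof (induction "is")
    case (Cons i "is")
    show ?case
    proof
      fix x
      have "partial_derivs (i # is) (\<lambda>x. integral (cbox a b) (k x)) x =
         partial_deriv i (\<lambda>x. integral (cbox a b) (\<lambda>y. partial_derivs is (\<lambda>x. k x y) x)) x"
        by (simp add: partial_derivs_Cons Cons.IH)
      also have "\<dots> = (\<Sum>j\<in>UNIV. (axis i 1 $ j) *\<^sub>R integral (cbox a b) (\<lambda>y. partial_derivs (j # is) (\<lambda>x. k x y) x))"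
        by (rule partial_deriv_eqI[OF der])
      also have "\<dots> = (\<Sum>j\<in>UNIV. if j = i then integral (cbox a b) (\<lambda>y. partial_derivs (j # is) (\<lambda>x. k x y) x) else 0)"
        by (intro sum.cong) (auto simp: axis_def)
      finally show "partial_derivs (i # is) (\<lambda>x. integral (cbox a b) (k x)) x =
         integral (cbox a b) (\<lambda>y. partial_derivs (i # is) (\<lambda>x. k x y) x)" by simp
    qed
  qed simp
qed

lemma smooth_kernel_smooth_integral:
  fixes k :: "real^'m \<Rightarrow> 'n::euclidean_space \<Rightarrow> 'b::banach"
  assumes "smooth_kernel (cbox a b) k"
  shows "smooth (\<lambda>x. integral (cbox a b) (k x))"
  unfolding smooth_def smooth_kernel_partial_derivs(1)[OF assms]
  using smooth_kernel_partial_derivs(2)[OF assms] by blast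

text \<open>The error depends on f only through its oscillation e at distance d. One tagged division
  therefore serves a whole family of functions with a common modulus of continuity.\<close>

lemma riemann_sum_error:
  fixes f :: "'a::euclidean_space \<Rightarrow> 'b::banach"
  assumes f: "continuous_on (cbox a b) f" and p: "p tagged_division_of cbox a b"
    and fine: "(\<lambda>x. ball x d) fine p" and "0 \<le> e"
    and e: "\<And>y y'. y \<in> cbox a b \<Longrightarrow> y' \<in> cbox a b \<Longrightarrow> dist y y' < d \<Longrightarrow> norm (f y - f y') \<le> e"
  shows "norm (integral (cbox a b) f - (\<Sum>(y, Q)\<in>p. measure lborel Q *\<^sub>R f y)) \<le> e * measure lborel (cbox a b)"
proof -
  have int: "f integrable_on cbox a b" using f by (rule integrable_continuous)
  have "integral (cbox a b) f - (\<Sum>(y, Q)\<in>p. measure lborel Q *\<^sub>R f y) =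
    (\<Sum>(y, Q)\<in>p. integral Q f - measure lborel Q *\<^sub>R f y)"
    by (simp add: integral_combine_tagged_division_topdown[OF int p] split_beta' sum_subtractf)
  also have "norm \<dots> \<le> (\<Sum>(y, Q)\<in>p. e * measure lborel Q)"
  proof (rule sum_norm_le, clarify)
    fix y Q assume yQ: "(y, Q) \<in> p"
    then obtain u v where Q: "Q = cbox u v" and y: "y \<in> Q" and sub: "Q \<subseteq> cbox a b"
      using p by (meson tagged_division_ofD)
    have Qd: "Q \<subseteq> ball y d" using fine yQ by (auto simp: fine_def)
    have "f integrable_on Q" using int sub Q integrable_on_subcbox by blast
    then have "((\<lambda>z. f z - f y) has_integral (integral Q f - measure lborel Q *\<^sub>R f y)) (cbox u v)"
      unfolding Q by (intro has_integral_diff has_integral_const integrable_integral)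
    then have "norm (integral Q f - measure lborel Q *\<^sub>R f y) \<le> e * measure lborel (cbox u v)"
    proof (rule has_integral_bound[OF \<open>0 \<le> e\<close>])
      show "norm (f z - f y) \<le> e" if "z \<in> cbox u v" for z
      proof (rule e)
        show "dist z y < d" using that Qd Q by (auto simp: dist_commute)
      qed (use that y sub Q in auto)
    qed
    then show "norm (integral Q f - measure lborel Q *\<^sub>R f y) \<le> e * measure lborel Q" by (simp add: Q)
  qed
  also have "\<dots> = e * measure lborel (cbox a b)"
    using additive_content_tagged_division[OF p] by (simp add: split_beta' sum_distrib_left[symmetric])
  finally show ?thesis .
qed

lemma partial_derivs_scaleR:
  "smooth f \<Longrightarrow> partial_derivs is (\<lambda>x. c *\<^sub>R f x) = (\<lambda>x. c *\<^sub>R partial_derivs is f x)"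
  by (rule partial_derivs_bounded_linear[OF _ bounded_linear_scaleR_right])

lemma smooth_scaleR: "smooth f \<Longrightarrow> smooth (\<lambda>x. c *\<^sub>R f x)"
  by (rule smooth_bounded_linear[OF bounded_linear_scaleR_right])

lemma partial_derivs_minus: "smooth f \<Longrightarrow> partial_derivs is (\<lambda>x. - f x) = (\<lambda>x. - partial_derivs is f x)"
  by (rule partial_derivs_bounded_linear[OF _ bounded_linear_minus[OF bounded_linear_ident]])

lemma partial_derivs_diff:
  "smooth f \<Longrightarrow> smooth g \<Longrightarrow>
   partial_derivs is (\<lambda>x. f x - g x) = (\<lambda>x. partial_derivs is f x - partial_derivs is g x)"
  using partial_derivs_add[of f "\<lambda>x. - g x" "is"] smooth_minus[of g] partial_derivs_minus[of g "is"] by simp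

lemma partial_derivs_sum:
  assumes "finite I" "\<And>i. i \<in> I \<Longrightarrow> smooth (f i)"
  shows "partial_derivs is (\<lambda>x. \<Sum>i\<in>I. f i x) = (\<lambda>x. \<Sum>i\<in>I. partial_derivs is (f i) x)"
  using assms by (induction I rule: finite_induct) (simp_all add: partial_derivs_add smooth_sum)

text \<open>Each derivative is uniformly continuous on the compact product of S and the box, and
  only finitely many lists of directions have length at most N, so a least d exists.\<close>

lemma smooth_kernel_uniform:
  fixes k :: "real^'m \<Rightarrow> 'n::euclidean_space \<Rightarrow> 'b::banach"
  assumes k: "smooth_kernel (cbox a b) k" and S: "compact S" and "e > 0"
  shows "\<exists>d>0. \<forall>y\<in>cbox a b. \<forall>y'\<in>cbox a b. dist y y' < d \<longrightarrow> deriv_bound N S (\<lambda>x. k x y - k x y') e"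
proof -
  have "\<exists>d>0. \<forall>y\<in>cbox a b. \<forall>y'\<in>cbox a b. dist y y' < d \<longrightarrow> (\<forall>x\<in>S.
      norm (partial_derivs is (\<lambda>x. k x y) x - partial_derivs is (\<lambda>x. k x y') x) \<le> e)" for "is"
  proof -
    let ?f = "\<lambda>(x, y). partial_derivs is (\<lambda>x. k x y) x"
    have "continuous_on (S \<times> cbox a b) ?f"
      using k unfolding smooth_kernel_def by (meson continuous_on_subset Sigma_mono subset_UNIV order_refl)
    then have "uniformly_continuous_on (S \<times> cbox a b) ?f"
      by (rule compact_uniformly_continuous) (intro compact_Times S compact_cbox)
    then obtain d where d: "d > 0" "\<And>z z'. z \<in> S \<times> cbox a b \<Longrightarrow> z' \<in> S \<times> cbox a b \<Longrightarrow> dist z' z < d \<Longrightarrow> dist (?f z') (?f z) < e"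
      using \<open>e > 0\<close> unfolding uniformly_continuous_on_def by metis
    show ?thesis
    proof (intro exI[of _ d] conjI ballI impI d(1))
      fix y y' x assume "y \<in> cbox a b" "y' \<in> cbox a b" "dist y y' < d" "x \<in> S"
      then have "dist (?f (x, y)) (?f (x, y')) < e"
        by (intro d(2)) (auto simp: dist_Pair_Pair)
      then show "norm (partial_derivs is (\<lambda>x. k x y) x - partial_derivs is (\<lambda>x. k x y') x) \<le> e"
        by (simp add: dist_norm)
    qed
  qed
  then obtain d where d: "\<And>is. d is > 0" "\<And>is y y' x. y \<in> cbox a b \<Longrightarrow> y' \<in> cbox a b \<Longrightarrow> dist y y' < d is \<Longrightarrow> x \<in> S \<Longrightarrow>
      norm (partial_derivs is (\<lambda>x. k x y) x - partial_derivs is (\<lambda>x. k x y') x) \<le> e"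
    by metis
  let ?L = "{is::'m list. length is \<le> N}"
  have fin: "finite ?L"
    using finite_lists_length_le[of "UNIV::'m set" N] by simp
  have ne: "?L \<noteq> {}" by (auto intro: exI[of _ "[]"])
  have s: "smooth (\<lambda>x. k x y)" for y using k by (simp add: smooth_kernel_def)
  show ?thesis
  proof (intro exI[of _ "Min (d ` ?L)"] conjI ballI impI)
    show "Min (d ` ?L) > 0" using fin ne d(1) by simp
    show "deriv_bound N S (\<lambda>x. k x y - k x y') e"
      if "y \<in> cbox a b" "y' \<in> cbox a b" "dist y y' < Min (d ` ?L)" for y y'
      unfolding deriv_bound_def partial_derivs_diff[OF s s]
      using that fin ne by (intro allI impI d(2)) auto
  qed
qed

text \<open>A distribution commutes with integration in a parameter: approximate the integral by Riemann
  sums, which converge together with all derivatives, uniformly on compact sets.\<close>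

lemma tempered_integral:
  fixes k :: "real^'m \<Rightarrow> 'n::euclidean_space \<Rightarrow> complex"
  assumes u: "u \<in> tempered" and g: "g \<in> test_functions" and k: "smooth_kernel (cbox a b) k"
  shows "continuous_on (cbox a b) (\<lambda>y. u (\<lambda>x. g x * k x y))" (is "continuous_on _ ?U")
    and "u (\<lambda>x. g x * integral (cbox a b) (k x)) = integral (cbox a b) (\<lambda>y. u (\<lambda>x. g x * k x y))"
proof -
  obtain C N S where C: "C \<ge> 0" "compact S" and
    bd: "\<forall>(f :: real^'m \<Rightarrow> complex) c. smooth f \<longrightarrow> 0 \<le> c \<longrightarrow> deriv_bound N S f c \<longrightarrow> norm (u (\<lambda>x. g x * f x)) \<le> C * c"
    using tempered_test_bound[OF u g] by blast
  note bd = bd[rule_format]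
  have s: "smooth (\<lambda>x. k x y)" for y using k by (simp add: smooth_kernel_def)
  have gt: "f \<in> schwartz" if "f = (\<lambda>x. g x * h x)" "smooth h" for f h
    unfolding that(1) by (rule test_functions_schwartz[OF test_functions_mult[OF g that(2)]])
  have U: "norm (?U y - ?U y') \<le> C * e"
    if "e > 0" "deriv_bound N S (\<lambda>x. k x y - k x y') e" for e y y'
  proof -
    have "norm (u (\<lambda>x. g x * (k x y - k x y'))) \<le> C * e"
      using that by (intro bd smooth_diff s) auto
    moreover have "u (\<lambda>x. g x * (k x y - k x y')) = ?U y - ?U y'"
      unfolding right_diff_distrib by (rule tempered_diff[OF u gt[OF refl s] gt[OF refl s]])
    ultimately show ?thesis by simp
  qed
  show cont: "continuous_on (cbox a b) ?U"
    unfolding continuous_on_iff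
  proof (intro ballI allI impI)
    fix y and e :: real assume y: "y \<in> cbox a b" and e: "e > 0"
    \<comment> \<open>C may be 0, hence C + 1 in the denominator.\<close>
    define e' where "e' = e / (C + 1)"
    have e': "e' > 0" "C * e' < e" using e C by (auto simp: e'_def field_simps add_nonneg_pos)
    obtain d where d: "d > 0" "\<And>y y'. y \<in> cbox a b \<Longrightarrow> y' \<in> cbox a b \<Longrightarrow> dist y y' < d \<Longrightarrow>
        deriv_bound N S (\<lambda>x. k x y - k x y') e'"
      using smooth_kernel_uniform[OF k C(2) e'(1), of N] by blast
    show "\<exists>d>0. \<forall>y'\<in>cbox a b. dist y' y < d \<longrightarrow> dist (?U y') (?U y) < e"
    proof (intro exI[of _ d] conjI ballI impI d(1))
      fix y' assume "y' \<in> cbox a b" "dist y' y < d"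
      then have "norm (?U y' - ?U y) \<le> C * e'" using y by (intro U e' d(2))
      then show "dist (?U y') (?U y) < e" using e' by (simp add: dist_norm)
    qed
  qed
  let ?K = "\<lambda>x. integral (cbox a b) (k x)"
  let ?c = "measure lborel (cbox a b)"
  have sK: "smooth ?K" using k by (rule smooth_kernel_smooth_integral)
  \<comment> \<open>The same tagged division is used twice: for the integral inside the argument of
    u, and for the integral of the values of u. Each contributes C e times the volume, whence the
    factor 2.\<close>
  have est: "norm (u (\<lambda>x. g x * ?K x) - integral (cbox a b) ?U) \<le> (2 * C * ?c) * e" if e: "e > 0" for e
  proof -
    obtain d where d: "d > 0" "\<And>y y'. y \<in> cbox a b \<Longrightarrow> y' \<in> cbox a b \<Longrightarrow> dist y y' < d \<Longrightarrow>
        deriv_bound N S (\<lambda>x. k x y - k x y') e"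
      using smooth_kernel_uniform[OF k C(2) e, of N] by blast
    have "gauge (\<lambda>x::'n. ball x d)" using d(1) by (simp add: gauge_def)
    then obtain p where p: "p tagged_division_of cbox a b" "(\<lambda>x. ball x d) fine p"
      using fine_division_exists by blast
    have finp: "finite p" using p by auto
    define R where "R x = (\<Sum>(y, Q)\<in>p. measure lborel Q *\<^sub>R k x y)" for x
    have sR: "smooth R" unfolding R_def split_beta' by (intro smooth_sum smooth_scaleR s)
    have "deriv_bound N S (\<lambda>x. ?K x - R x) (e * ?c)"
      unfolding deriv_bound_def
    proof (intro allI impI)
      fix "is" :: "'m list" and x assume isx: "length is \<le> N" "x \<in> S"
      have "partial_derivs is (\<lambda>x. ?K x - R x) x =
        integral (cbox a b) (\<lambda>y. partial_derivs is (\<lambda>x. k x y) x) -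
        (\<Sum>(y, Q)\<in>p. measure lborel Q *\<^sub>R partial_derivs is (\<lambda>x. k x y) x)"
        unfolding partial_derivs_diff[OF sK sR] smooth_kernel_partial_derivs(1)[OF k]
        unfolding R_def[abs_def] split_beta' partial_derivs_sum[OF finp smooth_scaleR[OF s]]
          partial_derivs_scaleR[OF s] ..
      also have "norm \<dots> \<le> e * ?c"
      proof (rule riemann_sum_error[OF _ p])
        show "continuous_on (cbox a b) (\<lambda>y. partial_derivs is (\<lambda>x. k x y) x)"
          by (rule continuous_on_slice) (use k in \<open>simp add: smooth_kernel_def\<close>)
      qed (use e d(2) isx in \<open>auto simp: deriv_bound_def partial_derivs_diff s\<close>)
      finally show "norm (partial_derivs is (\<lambda>x. ?K x - R x) x) \<le> e * ?c" .
    qed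
    then have "norm (u (\<lambda>x. g x * (?K x - R x))) \<le> C * (e * ?c)"
      using e by (intro bd smooth_diff sK sR) auto
    moreover have "u (\<lambda>x. g x * (?K x - R x)) = u (\<lambda>x. g x * ?K x) - u (\<lambda>x. g x * R x)"
      unfolding right_diff_distrib by (rule tempered_diff[OF u gt[OF refl sK] gt[OF refl sR]])
    moreover have "u (\<lambda>x. g x * R x) = (\<Sum>(y, Q)\<in>p. measure lborel Q *\<^sub>R ?U y)"
    proof -
      have "(\<lambda>x. g x * R x) = (\<lambda>x. \<Sum>z\<in>p. of_real (measure lborel (snd z)) * (g x * k x (fst z)))"
        by (simp add: R_def split_beta' sum_distrib_left scaleR_conv_of_real mult_ac)
      moreover have "u (\<lambda>x. \<Sum>z\<in>p. of_real (measure lborel (snd z)) * (g x * k x (fst z))) =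
         (\<Sum>z\<in>p. u (\<lambda>x. of_real (measure lborel (snd z)) * (g x * k x (fst z))))"
      proof (rule conjunct2[OF tempered_sum[OF u finp]])
        fix z
        have "(\<lambda>x. g x * (of_real (measure lborel (snd z)) * k x (fst z))) \<in> test_functions"
          by (intro test_functions_mult g smooth_cmult s)
        then show "(\<lambda>x. of_real (measure lborel (snd z)) * (g x * k x (fst z))) \<in> test_functions"
          by (simp add: mult_ac)
      qed
      ultimately show ?thesis
        by (simp add: tempered_cmult[OF u gt[OF refl s]] split_beta' scaleR_conv_of_real)
    qed
    moreover have "norm (integral (cbox a b) ?U - (\<Sum>(y, Q)\<in>p. measure lborel Q *\<^sub>R ?U y)) \<le> (C * e) * ?c"
    proof (rule riemann_sum_error[OF cont p])
      show "norm (?U y - ?U y') \<le> C * e" if "y \<in> cbox a b" "y' \<in> cbox a b" "dist y y' < d" for y y'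
        using that e by (intro U d(2))
    qed (use C e in auto)
    ultimately have "norm (u (\<lambda>x. g x * ?K x) - integral (cbox a b) ?U) \<le> C * (e * ?c) + (C * e) * ?c"
      by (simp only: norm_minus_commute[of "integral (cbox a b) ?U"] norm_diff_triangle_le)
    then show ?thesis by (simp add: algebra_simps)
  qed
  have "norm (u (\<lambda>x. g x * ?K x) - integral (cbox a b) ?U) \<le> 0 + e" if "e > 0" for e
  proof -
    define M where "M = 2 * C * ?c"
    have M: "M \<ge> 0" using C by (simp add: M_def)
    then have "norm (u (\<lambda>x. g x * ?K x) - integral (cbox a b) ?U) \<le> M * (e / (M + 1))"
      unfolding M_def using that by (intro est) (auto simp: add_nonneg_pos)
    also have "\<dots> \<le> e" using M that by (simp add: field_simps)
    finally show ?thesis by simp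
  qed
  then have "norm (u (\<lambda>x. g x * ?K x) - integral (cbox a b) ?U) \<le> 0"
    by (rule field_le_epsilon)
  then show "u (\<lambda>x. g x * ?K x) = integral (cbox a b) ?U" by simp
qed

section \<open>Fourier transforms of test functions\<close>

lemma integral_lborel_cbox:
  fixes f :: "'a::euclidean_space \<Rightarrow> complex"
  assumes "continuous_on UNIV f" "\<And>x. x \<notin> cbox a b \<Longrightarrow> f x = 0"
  shows "integrable lborel f" "(LINT x|lborel. f x) = integral (cbox a b) f"
proof -
  have eq: "(\<lambda>x. indicator (cbox a b) x *\<^sub>R f x) = f"
    using assms(2) by (auto simp: indicator_def)
  show int: "integrable lborel f"
    using borel_integrable_compact[OF compact_cbox continuous_on_subset[OF assms(1) subset_UNIV], of a b]
    by (simp add: eq)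
  have "(\<lambda>x. if x \<in> cbox a b then f x else 0) = f" using assms(2) by auto
  then have "integral (cbox a b) f = integral UNIV f"
    using Henstock_Kurzweil_Integration.integral_restrict_UNIV[of "cbox a b" f] by simp
  then show "(LINT x|lborel. f x) = integral (cbox a b) f"
    using integral_lborel[OF int] by simp
qed

lemma test_functions_cbox:
  assumes "\<phi> \<in> test_functions"
  obtains a where "\<And>x. x \<notin> cbox (- a) a \<Longrightarrow> \<phi> x = 0"
proof -
  obtain R where R: "\<And>x. norm x \<ge> R \<Longrightarrow> \<phi> x = 0" using test_functionsE[OF assms] by metis
  obtain a where "cball 0 R \<subseteq> cbox (- a) (a :: real^'a)" by (rule bounded_subset_cbox_symmetric[OF bounded_cball])
  then have "norm x \<ge> R" if "x \<notin> cbox (- a) a" for x using that by force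
  then show ?thesis using that R by blast
qed

lemma integral_translate:
  fixes f :: "'a::euclidean_space \<Rightarrow> complex"
  assumes "continuous_on UNIV f"
  shows "(LINT y|lborel. f (c + y)) = (LINT y|lborel. f y)"
proof -
  have "(LINT y|distr lborel borel ((+) c). f y) = (LINT y|lborel. f (c + y))"
    using borel_measurable_continuous_onI[OF assms] by (intro integral_distr) auto
  then show ?thesis by (simp add: lborel_distr_plus)
qed

text \<open>The factor s covers the average of translates (s = 1) as well as the convolution (s =
  -1).\<close>

lemma smooth_kernel_convolution:
  fixes q :: "real^'m \<Rightarrow> complex" and \<psi> :: "real^'m \<Rightarrow> complex"
  assumes q: "smooth q" and \<psi>: "continuous_on Y \<psi>"
  shows "partial_derivs is (\<lambda>x. \<psi> y * q (x + s *\<^sub>R y)) = (\<lambda>x. \<psi> y * partial_derivs is q (x + s *\<^sub>R y))"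
    and "smooth_kernel Y (\<lambda>x y. \<psi> y * q (x + s *\<^sub>R y))"
proof -
  have s: "smooth (\<lambda>x. q (x + s *\<^sub>R y))" for y using smooth_affine[OF q, of 1] by simp
  show eq: "partial_derivs is (\<lambda>x. \<psi> y * q (x + s *\<^sub>R y)) = (\<lambda>x. \<psi> y * partial_derivs is q (x + s *\<^sub>R y))" for "is" y
    using partial_derivs_bounded_linear[OF s bounded_linear_mult_right] partial_derivs_affine[OF q, of "is" 1] by simp
  have "continuous_on (UNIV \<times> Y) (\<lambda>z. partial_derivs is q (fst z + s *\<^sub>R snd z))" for "is"
    by (rule continuous_on_compose2[OF smooth_continuous_on[OF smooth_partial_derivs[OF q], of UNIV]])
      (auto intro!: continuous_intros)
  moreover have "continuous_on (UNIV \<times> Y) (\<lambda>z. \<psi> (snd z))"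
    by (rule continuous_on_compose2[OF \<psi>]) (auto intro!: continuous_intros)
  ultimately show "smooth_kernel Y (\<lambda>x y. \<psi> y * q (x + s *\<^sub>R y))"
    unfolding smooth_kernel_def eq split_beta' by (intro conjI allI smooth_cmult s continuous_on_mult)
qed

text \<open>By translation invariance the integral of \<phi>(x + y) over y does not depend on x;
  differentiating under the integral at x = 0 gives the claim.\<close>

lemma integral_partial_deriv_eq_0:
  fixes \<phi> :: "real^'m \<Rightarrow> complex"
  assumes \<phi>: "\<phi> \<in> test_functions"
  shows "(LINT x|lborel. partial_deriv i \<phi> x) = 0"
proof -
  note s = test_functions_smooth[OF \<phi>]
  obtain R where R: "\<And>x. norm x \<ge> R \<Longrightarrow> \<phi> x = 0" using test_functionsE[OF \<phi>] by metis
  \<comment> \<open>The box contains the supports of all translates by vectors of length below 1, so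
    that one box serves an open neighbourhood of x = 0.\<close>
  obtain a where a: "cball 0 (R + 1) \<subseteq> cbox (- a) (a :: real^'m)"
    by (rule bounded_subset_cbox_symmetric[OF bounded_cball])
  have out: "\<phi> (x + y) = 0" if "x \<in> ball 0 1" "y \<notin> cbox (- a) a" for x y
  proof (rule R)
    have "norm y > R + 1" using that(2) a by force
    moreover have "norm y \<le> norm (x + y) + norm x" using norm_triangle_ineq4[of "x + y" x] by simp
    ultimately show "norm (x + y) \<ge> R" using that(1) by simp
  qed
  have sc: "continuous_on UNIV \<phi>" "continuous_on UNIV (\<lambda>y. \<phi> (x + y))" for x
    using smooth_continuous_on[OF s] smooth_continuous_on[OF smooth_affine[OF s, of 1 x]]
    by (simp_all add: add.commute)
  let ?k = "\<lambda>x y. 1 * \<phi> (x + 1 *\<^sub>R y)"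
  have k: "smooth_kernel (cbox (-a) a) ?k" by (rule smooth_kernel_convolution(2)[OF s]) simp
  have "partial_deriv i (\<lambda>x. integral (cbox (-a) a) (?k x)) 0 = partial_deriv i (\<lambda>x. LINT y|lborel. \<phi> y) 0"
  proof (rule partial_deriv_cong_open[of "ball 0 1"])
    fix x :: "real^'m" assume "x \<in> ball 0 1"
    then have "(LINT y|lborel. \<phi> (x + y)) = integral (cbox (-a) a) (\<lambda>y. \<phi> (x + y))"
      by (intro integral_lborel_cbox(2) sc out)
    then show "integral (cbox (-a) a) (?k x) = (LINT y|lborel. \<phi> y)"
      by (simp add: integral_translate[OF sc(1)])
  qed auto
  moreover have "partial_derivs [i] (\<lambda>x. integral (cbox (-a) a) (?k x)) 0 = integral (cbox (-a) a) (partial_deriv i \<phi>)"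
    unfolding smooth_kernel_partial_derivs(1)[OF k] smooth_kernel_convolution(1)[OF s continuous_on_const]
    by (simp add: partial_derivs_Cons)
  moreover have "partial_deriv i \<phi> y = 0" if "y \<notin> cbox (-a) a" for y
    using partial_derivs_eq_0_open[of "- cball 0 R" \<phi> y "[i]"] R that a
    by (force simp: partial_derivs_Cons)
  ultimately show ?thesis
    using integral_lborel_cbox(2)[OF smooth_continuous_on[OF smooth_partial_deriv[OF s]], where a = "-a" and b = a]
    by (simp add: partial_derivs_Cons)
qed

text \<open>The complex z serves two purposes: at \<open>- \<i>\<close> this is the Fourier kernel,
  and varying z for a fixed direction y produces the entire extensions.\<close>

definition expi :: "complex \<Rightarrow> real^'m \<Rightarrow> real^'m \<Rightarrow> complex" where
  "expi z y x = exp (z * of_real (x \<bullet> y))"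

lemma smooth_inner: "smooth (\<lambda>x. complex_of_real (x \<bullet> y))"
  by (intro smooth_of_real smooth_linear bounded_linear_inner_left)

lemma partial_deriv_inner: "partial_deriv i (\<lambda>x. complex_of_real (x \<bullet> y)) = (\<lambda>x. of_real (y $ i))"
  by (subst partial_deriv_linear)
    (auto simp: inner_axis' inner_axis intro: bounded_linear_compose[OF bounded_linear_of_real bounded_linear_inner_left])

lemma smooth_expi: "smooth (expi z y)"
  unfolding expi_def by (intro smooth_exp smooth_cmult smooth_inner)

lemma partial_derivs_expi:
  "partial_derivs is (\<lambda>x. c * expi z y x) = (\<lambda>x. c * (\<Prod>i\<leftarrow>is. z * of_real (y $ i)) * expi z y x)"
proof (induction "is")
  case (Cons i "is")
  have e: "partial_deriv i (expi z y) x = z * of_real (y $ i) * expi z y x" for x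
  proof -
    have "((\<lambda>w. exp (z * w)) has_field_derivative exp (z * w) * z) (at w)" for w
      by (auto intro!: derivative_eq_intros)
    then have "partial_deriv i (\<lambda>x. exp (z * of_real (x \<bullet> y))) x =
       exp (z * of_real (x \<bullet> y)) * z * partial_deriv i (\<lambda>x. complex_of_real (x \<bullet> y)) x"
      by (rule partial_deriv_compose) (rule smooth_differentiable[OF smooth_inner])
    then show ?thesis by (simp add: partial_deriv_inner expi_def[abs_def])
  qed
  have *: "partial_deriv i (\<lambda>x. d * expi z y x) = (\<lambda>x. d * (z * of_real (y $ i)) * expi z y x)" for d
    by (rule ext, subst partial_deriv_bounded_linear[OF bounded_linear_mult_right smooth_differentiable[OF smooth_expi]])
      (simp add: e)
  show ?case unfolding partial_derivs_Cons Cons.IH * by (simp add: mult_ac)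
qed simp

lemma continuous_on_prod_list_coord:
  "continuous_on Y (\<lambda>y::real^'m. \<Prod>i\<leftarrow>is. z * complex_of_real (y $ i))"
  by (induction "is") (auto intro!: continuous_intros)

lemma smooth_prod_list_coord:
  "smooth (\<lambda>y::real^'m. \<Prod>i\<leftarrow>is. z * complex_of_real (y $ i))"
  by (induction "is") (simp_all add: smooth_mult smooth_cmult smooth_of_real smooth_component)

lemma smooth_kernel_expi:
  fixes c :: "real^'m \<Rightarrow> complex"
  assumes "continuous_on Y c"
  shows "smooth_kernel Y (\<lambda>x y. c y * expi z y x)"
  unfolding smooth_kernel_def partial_derivs_expi split_beta'
proof (intro conjI allI)
  show "smooth (\<lambda>x. c y * expi z y x)" for y by (intro smooth_cmult smooth_expi)
  show "continuous_on (UNIV \<times> Y) (\<lambda>p. c (snd p) * (\<Prod>i\<leftarrow>is. z * of_real (snd p $ i)) * expi z (snd p) (fst p))" for "is"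
  proof -
    have "continuous_on (UNIV \<times> Y) (\<lambda>p. c (snd p))"
      by (rule continuous_on_compose2[OF assms]) (auto intro!: continuous_intros)
    moreover have "continuous_on (UNIV \<times> Y) (\<lambda>p. \<Prod>i\<leftarrow>is. z * complex_of_real (snd p $ i))"
      by (rule continuous_on_compose2[OF continuous_on_prod_list_coord]) (auto intro!: continuous_intros)
    ultimately show ?thesis unfolding expi_def by (intro continuous_intros)
  qed
qed

definition fourier_integral :: "(real^'m \<Rightarrow> complex) \<Rightarrow> real^'m \<Rightarrow> complex" where
  "fourier_integral \<phi> \<xi> = (LINT x|lborel. \<phi> x * expi (- \<i>) x \<xi>)"

lemma fourier_fun_eq:
  fixes f :: "real^'m \<Rightarrow> complex"
  shows "fourier_fun f \<xi> = of_real ((2 * pi) powr (- real CARD('m) / 2)) * fourier_integral f \<xi>"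
  by (simp add: fourier_fun_def fourier_integral_def expi_def)

lemma expi_commute: "expi z x y = expi z y x"
  by (simp add: expi_def inner_commute)

lemma norm_expi [simp]: "norm (expi (- \<i>) x \<xi>) = 1"
  by (simp add: expi_def norm_exp_eq_Re)

lemma continuous_on_fourier_integrand:
  fixes \<phi> :: "real^'m \<Rightarrow> complex"
  shows "smooth \<phi> \<Longrightarrow> continuous_on S (\<lambda>x. \<phi> x * expi (- \<i>) x \<xi>)"
  by (subst expi_commute) (intro smooth_continuous_on smooth_mult smooth_expi)

lemma fourier_integral_cbox:
  fixes \<phi> :: "real^'m \<Rightarrow> complex"
  assumes "smooth \<phi>" "\<And>x. x \<notin> cbox a b \<Longrightarrow> \<phi> x = 0"
  shows "fourier_integral \<phi> \<xi> = integral (cbox a b) (\<lambda>x. \<phi> x * expi (- \<i>) x \<xi>)"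
  unfolding fourier_integral_def
  using assms by (intro integral_lborel_cbox continuous_on_fourier_integrand) auto

lemma fourier_integral_partial_derivs:
  fixes \<phi> :: "real^'m \<Rightarrow> complex"
  assumes \<phi>: "\<phi> \<in> test_functions"
  shows "smooth (fourier_integral \<phi>)"
    and "partial_derivs is (fourier_integral \<phi>) =
      fourier_integral (\<lambda>x. \<phi> x * (\<Prod>i\<leftarrow>is. - \<i> * complex_of_real (x $ i)))"
proof -
  note s = test_functions_smooth[OF \<phi>]
  obtain a where a: "\<And>x. x \<notin> cbox (- a) a \<Longrightarrow> \<phi> x = 0" using test_functions_cbox[OF \<phi>] by metis
  have eq: "fourier_integral \<phi> = (\<lambda>\<xi>. integral (cbox (-a) a) (\<lambda>x. \<phi> x * expi (- \<i>) x \<xi>))"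
    using fourier_integral_cbox[OF s a] by blast
  have k: "smooth_kernel (cbox (-a) a) (\<lambda>\<xi> x. \<phi> x * expi (- \<i>) x \<xi>)"
    by (intro smooth_kernel_expi smooth_continuous_on s)
  show "smooth (fourier_integral \<phi>)" unfolding eq by (rule smooth_kernel_smooth_integral[OF k])
  show "partial_derivs is (fourier_integral \<phi>) =
      fourier_integral (\<lambda>x. \<phi> x * (\<Prod>i\<leftarrow>is. - \<i> * complex_of_real (x $ i)))"
    unfolding eq smooth_kernel_partial_derivs(1)[OF k] partial_derivs_expi
    by (rule ext, subst fourier_integral_cbox[where a = "-a" and b = a],
        intro smooth_mult s smooth_prod_list_coord) (simp_all add: a)
qed

lemma fourier_integral_bounded:
  fixes \<phi> :: "real^'m \<Rightarrow> complex"
  shows "norm (fourier_integral \<phi> \<xi>) \<le> (LINT x|lborel. norm (\<phi> x))"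
  using integral_norm_bound[of lborel "\<lambda>x. \<phi> x * expi (- \<i>) x \<xi>"]
  by (simp add: fourier_integral_def norm_mult)

text \<open>Integration by parts: the derivative of \<phi> times the exponential has integral
  0.\<close>

lemma fourier_integral_partial_deriv:
  fixes \<phi> :: "real^'m \<Rightarrow> complex"
  assumes \<phi>: "\<phi> \<in> test_functions"
  shows "fourier_integral (partial_deriv i \<phi>) \<xi> = \<i> * of_real (\<xi> $ i) * fourier_integral \<phi> \<xi>"
proof -
  note s = test_functions_smooth[OF \<phi>]
  obtain a where a: "\<And>x. x \<notin> cbox (- a) a \<Longrightarrow> \<phi> x = 0" using test_functions_cbox[OF \<phi>] by metis
  have t: "(\<lambda>x. \<phi> x * expi (- \<i>) \<xi> x) \<in> test_functions"
    by (intro test_functions_mult \<phi> smooth_expi)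
  have t': "partial_deriv i \<phi> \<in> test_functions"
    using test_functions_partial_derivs[OF \<phi>, of "[i]"] by (simp add: partial_derivs_Cons)
  have int: "integrable lborel (\<lambda>x. \<psi> x * expi (- \<i>) \<xi> x)" if \<psi>: "\<psi> \<in> test_functions" for \<psi> :: "real^'m \<Rightarrow> complex"
  proof -
    obtain a where "\<And>x. x \<notin> cbox (- a) a \<Longrightarrow> \<psi> x = 0" using test_functions_cbox[OF \<psi>] by metis
    then show ?thesis using \<psi>
      by (intro integral_lborel_cbox(1)[of _ "-a" a] smooth_continuous_on smooth_mult smooth_expi) (auto simp: test_functions_smooth)
  qed
  have e: "partial_deriv i (expi (- \<i>) \<xi>) x = - \<i> * of_real (\<xi> $ i) * expi (- \<i>) \<xi> x" for x
    using partial_derivs_expi[of "[i]" 1 "- \<i>" \<xi>] by (simp add: partial_derivs_Cons fun_eq_iff)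
  have "0 = (LINT x|lborel. partial_deriv i (\<lambda>x. \<phi> x * expi (- \<i>) \<xi> x) x)"
    using integral_partial_deriv_eq_0[OF t] by simp
  also have "\<dots> = (LINT x|lborel. (- \<i> * of_real (\<xi> $ i)) * (\<phi> x * expi (- \<i>) \<xi> x) + partial_deriv i \<phi> x * expi (- \<i>) \<xi> x)"
    by (simp add: partial_deriv_mult smooth_differentiable s smooth_expi e mult_ac)
  also have "\<dots> = (- \<i> * of_real (\<xi> $ i)) * (LINT x|lborel. \<phi> x * expi (- \<i>) \<xi> x) + (LINT x|lborel. partial_deriv i \<phi> x * expi (- \<i>) \<xi> x)"
    by (subst Bochner_Integration.integral_add[OF integrable_mult_right[OF int[OF \<phi>]] int[OF t']]) simp
  finally show ?thesis by (simp add: fourier_integral_def expi_commute[of _ _ \<xi>])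
qed

text \<open>One more power of 1 + |\<xi>| is paid for by the l1 norm of \<xi>, and each coordinate
  factor is absorbed by differentiating \<phi>. Hence the induction is over all test functions at
  once.\<close>

lemma fourier_integral_decay:
  fixes \<phi> :: "real^'m \<Rightarrow> complex"
  assumes "\<phi> \<in> test_functions"
  shows "\<exists>B. \<forall>\<xi>. (1 + norm \<xi>) ^ k * norm (fourier_integral \<phi> \<xi>) \<le> B"
  using assms
proof (induction k arbitrary: \<phi>)
  case 0
  then show ?case using fourier_integral_bounded[of \<phi>] by auto
next
  case (Suc k)
  have "partial_deriv i \<phi> \<in> test_functions" for i
    using test_functions_partial_derivs[OF Suc.prems, of "[i]"] by (simp add: partial_derivs_Cons)
  then have "\<exists>B. \<forall>\<xi>. (1 + norm \<xi>) ^ k * norm (fourier_integral (partial_deriv i \<phi>) \<xi>) \<le> B" for i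
    by (rule Suc.IH)
  then obtain B where B: "\<And>i \<xi>. (1 + norm \<xi>) ^ k * norm (fourier_integral (partial_deriv i \<phi>) \<xi>) \<le> B i"
    by metis
  obtain A where A: "\<And>\<xi>. (1 + norm \<xi>) ^ k * norm (fourier_integral \<phi> \<xi>) \<le> A"
    using Suc.IH[OF Suc.prems] by blast
  have "(1 + norm \<xi>) ^ Suc k * norm (fourier_integral \<phi> \<xi>) \<le> A + (\<Sum>i\<in>UNIV. B i)" for \<xi>
  proof -
    have "(1 + norm \<xi>) ^ Suc k * norm (fourier_integral \<phi> \<xi>) =
      (1 + norm \<xi>) * ((1 + norm \<xi>) ^ k * norm (fourier_integral \<phi> \<xi>))" by simp
    also have "\<dots> \<le> (1 + (\<Sum>i\<in>UNIV. \<bar>\<xi> $ i\<bar>)) * ((1 + norm \<xi>) ^ k * norm (fourier_integral \<phi> \<xi>))"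
      using norm_le_l1_cart[of \<xi>] by (intro mult_right_mono) auto
    also have "\<dots> = (1 + norm \<xi>) ^ k * norm (fourier_integral \<phi> \<xi>) +
        (\<Sum>i\<in>UNIV. (1 + norm \<xi>) ^ k * norm (fourier_integral (partial_deriv i \<phi>) \<xi>))"
      by (simp add: distrib_left sum_distrib_left fourier_integral_partial_deriv[OF Suc.prems] norm_mult mult_ac)
    also have "\<dots> \<le> A + (\<Sum>i\<in>UNIV. B i)" by (intro add_mono sum_mono A B)
    finally show ?thesis .
  qed
  then show ?case by blast
qed

lemma fourier_integral_schwartz:
  fixes \<phi> :: "real^'m \<Rightarrow> complex"
  assumes "\<phi> \<in> test_functions"
  shows "fourier_integral \<phi> \<in> schwartz"
  using fourier_integral_partial_derivs(1)[OF assms]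
proof (rule schwartzI)
  show "\<exists>B. \<forall>x. (1 + norm x) ^ k * norm (partial_derivs is (fourier_integral \<phi>) x) \<le> B" for k "is"
    unfolding fourier_integral_partial_derivs(2)[OF assms]
    by (intro fourier_integral_decay test_functions_mult assms smooth_prod_list_coord)
qed

section \<open>The Fourier--Laplace transform\<close>

text \<open>The remainder is named because differentiation only lowers its index: a derivative of
  \<open>exp_rest n (f x)\<close> is again a remainder times a derivative of f.\<close>

definition exp_rest :: "nat \<Rightarrow> complex \<Rightarrow> complex" where
  "exp_rest n y = exp y - (\<Sum>k<n. y ^ k / fact k)"

lemma DERIV_exp_rest: "(exp_rest (Suc n) has_field_derivative exp_rest n y) (at y)"
proof (induction n)
  case 0
  show ?case unfolding exp_rest_def by (auto intro!: derivative_eq_intros)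
next
  case (Suc n)
  have "((\<lambda>y. y ^ Suc n) has_field_derivative of_nat (Suc n) * y ^ n) (at y)"
    using DERIV_power_Suc[OF DERIV_ident, where n = n] by simp
  then have "((\<lambda>y. exp_rest (Suc n) y - y ^ Suc n / fact (Suc n)) has_field_derivative
      exp_rest n y - of_nat (Suc n) * y ^ n / fact (Suc n)) (at y)"
    by (intro DERIV_diff Suc.IH DERIV_cdivide)
  moreover have "of_nat (Suc n) * y ^ n / fact (Suc n) = y ^ n / fact n" by (simp del: of_nat_Suc)
  ultimately show ?case unfolding exp_rest_def[abs_def] by (simp add: diff_diff_eq)
qed

text \<open>On the disc of radius c the remainder is dominated by the remainder of the real series
  at c.\<close>

lemma exp_rest_uniform:
  assumes "0 \<le> c" "0 < e"
  shows "\<forall>\<^sub>F n in sequentially. \<forall>y. norm y \<le> c \<longrightarrow> norm (exp_rest n y) \<le> e"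
proof -
  have "(\<lambda>n. \<Sum>k<n. c ^ k /\<^sub>R fact k) \<longlonglongrightarrow> exp c"
    using exp_converges[of c] by (simp add: sums_def)
  then have "\<forall>\<^sub>F n in sequentially. dist (\<Sum>k<n. c ^ k /\<^sub>R fact k) (exp c) < e"
    using assms(2) by (rule tendstoD)
  then show ?thesis
  proof eventually_elim
    case (elim n)
    show ?case
    proof (intro allI impI)
      fix y :: complex assume y: "norm y \<le> c"
      have "(\<lambda>k. y ^ (k + n) /\<^sub>R fact (k + n)) sums (exp y - (\<Sum>k<n. y ^ k /\<^sub>R fact k))"
        by (rule sums_split_initial_segment[OF exp_converges])
      moreover have "(\<Sum>k<n. y ^ k /\<^sub>R fact k) = (\<Sum>k<n. y ^ k / fact k)"
        by (intro sum.cong) (auto simp: scaleR_conv_of_real divide_inverse of_real_inverse)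
      ultimately have "(\<lambda>k. y ^ (k + n) /\<^sub>R fact (k + n)) sums exp_rest n y"
        by (simp add: exp_rest_def)
      moreover have "(\<lambda>k. c ^ (k + n) /\<^sub>R fact (k + n)) sums (exp c - (\<Sum>k<n. c ^ k /\<^sub>R fact k))"
        by (rule sums_split_initial_segment[OF exp_converges])
      moreover have "norm (y ^ (k + n) /\<^sub>R fact (k + n)) \<le> c ^ (k + n) /\<^sub>R fact (k + n)" for k
        using power_mono[OF y, of "k + n"] by (simp add: norm_power divide_right_mono divide_inverse[symmetric] mult.commute[of "inverse _"])
      ultimately have "norm (exp_rest n y) \<le> exp c - (\<Sum>k<n. c ^ k /\<^sub>R fact k)"
        using norm_sums_le by blast
      then show "norm (exp_rest n y) \<le> e" using elim by (simp add: dist_norm)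
    qed
  qed
qed

lemma smooth_exp_rest: "smooth f \<Longrightarrow> smooth (\<lambda>x. exp_rest n (f x))"
  unfolding exp_rest_def divide_inverse
  by (intro smooth_diff smooth_exp smooth_sum smooth_mult smooth_power smooth_const)

text \<open>Uniform smallness of the remainders passes to their derivatives, which are remainders
  multiplied by bounded functions.\<close>

lemma deriv_bound_exp_rest:
  fixes f :: "real^'m \<Rightarrow> complex"
  assumes "smooth f" "0 \<le> c" "deriv_bound N S f c" "0 < e"
  shows "\<forall>\<^sub>F n in sequentially. deriv_bound N S (\<lambda>x. exp_rest n (f x)) e"
  using assms(3,4)
proof (induction N arbitrary: e)
  case 0
  from exp_rest_uniform[OF assms(2) 0(2)] show ?case
    by eventually_elim (use 0 in \<open>simp add: deriv_bound_0\<close>)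
next
  case (Suc N)
  \<comment> \<open>Compensates the factor \<open>2 ^ N * c\<close> lost in the product rule; c + 1
    guards against c = 0.\<close>
  define e' where "e' = e / (2 ^ N * (c + 1))"
  have e': "e' > 0" using Suc.prems assms by (simp add: e'_def add_nonneg_pos)
  have e'c: "2 ^ N * e' * c \<le> e" 
  proof -
    have "2 ^ N * e' * c = e * (c / (c + 1))" by (simp add: e'_def)
    also have "\<dots> \<le> e * 1" using Suc.prems(2) assms(2) by (intro mult_left_mono) auto
    finally show ?thesis by simp
  qed
  have "deriv_bound N S f c" by (rule deriv_bound_mono[OF Suc.prems(1)]) auto
  \<comment> \<open>Differentiation lowers the index by one, so the claim is proved at
    \<open>Suc n\<close>: the values come from the shifted uniform estimate, the derivatives from
    the induction hypothesis at n.\<close>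
  from exp_rest_uniform[OF assms(2) Suc.prems(2), THEN sequentially_offset, of 1] Suc.IH[OF this e']
  have "\<forall>\<^sub>F n in sequentially. deriv_bound (Suc N) S (\<lambda>x. exp_rest (Suc n) (f x)) e"
  proof eventually_elim
    case (elim n)
    have "deriv_bound N S (partial_deriv i (\<lambda>x. exp_rest (Suc n) (f x))) e" for i
    proof -
      have "partial_deriv i (\<lambda>x. exp_rest (Suc n) (f x)) = (\<lambda>x. exp_rest n (f x) * partial_deriv i f x)"
        by (intro ext partial_deriv_compose DERIV_exp_rest smooth_differentiable assms)
      moreover have "deriv_bound N S (\<lambda>x. exp_rest n (f x) * partial_deriv i f x) (2 ^ N * e' * c)"
        using elim(2) e' assms(1,2) Suc.prems(1)
        by (intro deriv_bound_mult smooth_exp_rest smooth_partial_deriv) (simp_all add: deriv_bound_Suc)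
      ultimately show ?thesis using e'c by (metis deriv_bound_mono order_refl)
    qed
    moreover have "norm (exp_rest (Suc n) (f x)) \<le> e" if "x \<in> S" for x
      using elim(1) Suc.prems(1) that by (simp add: deriv_bound_Suc)
    ultimately show ?case by (simp add: deriv_bound_Suc)
  qed
  then show ?case 
    using eventually_sequentially_Suc[of "\<lambda>n. deriv_bound (Suc N) S (\<lambda>x. exp_rest n (f x)) e"] by blast
qed

lemma deriv_bound_power:
  fixes f :: "real^'m \<Rightarrow> complex"
  assumes "smooth f" "0 \<le> c" "deriv_bound N S f c"
  shows "deriv_bound N S (\<lambda>x. f x ^ k) ((2 ^ N * c) ^ k)"
proof (induction k)
  case 0
  show ?case using deriv_bound_const[of N S "1::complex"] by simp
next
  case (Suc k)
  have "deriv_bound N S (\<lambda>x. f x * f x ^ k) (2 ^ N * c * (2 ^ N * c) ^ k)"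
    using assms by (intro deriv_bound_mult Suc.IH smooth_power) auto
  then show ?case by simp
qed

lemma deriv_bound_inner:
  assumes "compact S"
  shows "\<exists>b\<ge>0. \<forall>h. deriv_bound N S (\<lambda>x::real^'m. complex_of_real (x \<bullet> h)) (b * norm h)"
proof -
  obtain R where R: "\<And>x. x \<in> S \<Longrightarrow> norm x \<le> R" using compact_imp_bounded[OF assms] by (auto simp: bounded_iff)
  show ?thesis
  proof (intro exI conjI allI)
    \<comment> \<open>This constant dominates both the values, at most |R| |h|, and the first
      derivatives, at most |h|. Higher derivatives vanish.\<close>
    show "\<bar>R\<bar> + 1 \<ge> 0" by simp
    fix h :: "real^'m"
    have v: "norm (complex_of_real (x \<bullet> h)) \<le> (\<bar>R\<bar> + 1) * norm h" if "x \<in> S" for x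
    proof -
      have "\<bar>x \<bullet> h\<bar> \<le> norm x * norm h" by (rule Cauchy_Schwarz_ineq2)
      also have "\<dots> \<le> (\<bar>R\<bar> + 1) * norm h" using R[OF that] by (intro mult_right_mono) auto
      finally show ?thesis by simp
    qed
    show "deriv_bound N S (\<lambda>x. complex_of_real (x \<bullet> h)) ((\<bar>R\<bar> + 1) * norm h)"
    proof (cases N)
      case 0
      then show ?thesis using v by (simp add: deriv_bound_0)
    next
      case (Suc M)
      have "deriv_bound M S (\<lambda>x. complex_of_real (h $ i)) ((\<bar>R\<bar> + 1) * norm h)" for i
      proof (rule deriv_bound_mono[OF deriv_bound_const order_refl order_refl])
        have "\<bar>h $ i\<bar> \<le> 1 * norm h" using component_le_norm_cart[of h i] by simp
        also have "\<dots> \<le> (\<bar>R\<bar> + 1) * norm h" by (intro mult_right_mono) auto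
        finally show "norm (complex_of_real (h $ i)) \<le> (\<bar>R\<bar> + 1) * norm h" by simp
      qed
      then show ?thesis using v by (simp add: Suc deriv_bound_Suc partial_deriv_inner)
    qed
  qed
qed

text \<open>The distribution may be applied to the exponential series term by term, because the series
  converges with all derivatives uniformly on compact sets; submultiplicativity of
  \<^const>\<open>deriv_bound\<close> makes the terms of the series grow geometrically.\<close>

lemma tempered_exp_series:
  fixes u :: "'m::finite functional"
  assumes u: "u \<in> tempered" and g: "g \<in> test_functions"
  shows "\<exists>C M. C \<ge> 0 \<and> M \<ge> 0 \<and>
    (\<forall>h k. norm (u (\<lambda>x. g x * of_real (x \<bullet> h) ^ k)) \<le> C * (M * norm h) ^ k) \<and>
    (\<forall>h z. (\<lambda>k. z ^ k / fact k * u (\<lambda>x. g x * of_real (x \<bullet> h) ^ k)) sums u (\<lambda>x. g x * expi z h x))"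
proof -
  obtain C N S where C: "C \<ge> 0" "compact S" and
    bd: "\<forall>(f :: real^'m \<Rightarrow> complex) c. smooth f \<longrightarrow> 0 \<le> c \<longrightarrow> deriv_bound N S f c \<longrightarrow> norm (u (\<lambda>x. g x * f x)) \<le> C * c"
    using tempered_test_bound[OF u g] by blast
  note bd = bd[rule_format]
  obtain b where b0: "b \<ge> 0" "\<forall>h::real^'m. deriv_bound N S (\<lambda>x. complex_of_real (x \<bullet> h)) (b * norm h)"
    using deriv_bound_inner[OF C(2), of N] by blast
  note b = b0(1) b0(2)[rule_format]
  have gt: "(\<lambda>x. g x * h x) \<in> schwartz" if "smooth h" for h
    by (rule test_functions_schwartz[OF test_functions_mult[OF g that]])
  show ?thesis
  proof (intro exI conjI allI)
    show "C \<ge> 0" by fact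
    show "2 ^ N * b \<ge> 0" using b by simp
    show "norm (u (\<lambda>x. g x * of_real (x \<bullet> h) ^ k)) \<le> C * (2 ^ N * b * norm h) ^ k" for h k
    proof (rule bd)
      have "deriv_bound N S (\<lambda>x. complex_of_real (x \<bullet> h) ^ k) ((2 ^ N * (b * norm h)) ^ k)"
        using b by (intro deriv_bound_power smooth_inner) auto
      then show "deriv_bound N S (\<lambda>x. complex_of_real (x \<bullet> h) ^ k) ((2 ^ N * b * norm h) ^ k)"
        by (simp add: mult.assoc)
    qed (use b smooth_power[OF smooth_inner] in simp_all)
    fix h :: "real^'m" and z :: complex
    define l where "l = (\<lambda>x. z * complex_of_real (x \<bullet> h))"
    have sl: "smooth l" unfolding l_def by (intro smooth_cmult smooth_inner)
    have lb: "deriv_bound N S l (2 ^ N * norm z * (b * norm h))"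
      unfolding l_def using b by (intro deriv_bound_mult deriv_bound_const smooth_inner smooth_const) auto
    have part: "u (\<lambda>x. g x * exp_rest n (l x)) = u (\<lambda>x. g x * expi z h x) -
      (\<Sum>k<n. z ^ k / fact k * u (\<lambda>x. g x * of_real (x \<bullet> h) ^ k))" for n
    proof -
      have t: "(\<lambda>x. z ^ k / fact k * (g x * of_real (x \<bullet> h) ^ k)) \<in> test_functions" for k
      proof -
        have "(\<lambda>x. g x * (z ^ k / fact k * of_real (x \<bullet> h) ^ k)) \<in> test_functions"
          by (intro test_functions_mult g smooth_cmult smooth_power smooth_inner)
        then show ?thesis by (simp add: mult_ac)
      qed
      have eq: "(\<lambda>x. g x * exp_rest n (l x)) =
        (\<lambda>x. g x * expi z h x - (\<Sum>k<n. z ^ k / fact k * (g x * of_real (x \<bullet> h) ^ k)))"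
        by (simp add: exp_rest_def l_def expi_def right_diff_distrib sum_distrib_left power_mult_distrib mult_ac)
      have S: "(\<lambda>x. \<Sum>k<n. z ^ k / fact k * (g x * of_real (x \<bullet> h) ^ k)) \<in> test_functions \<and>
        u (\<lambda>x. \<Sum>k<n. z ^ k / fact k * (g x * of_real (x \<bullet> h) ^ k)) =
        (\<Sum>k<n. u (\<lambda>x. z ^ k / fact k * (g x * of_real (x \<bullet> h) ^ k)))"
        by (rule tempered_sum[OF u finite_lessThan t])
      have "u (\<lambda>x. g x * exp_rest n (l x)) =
        u (\<lambda>x. g x * expi z h x) - u (\<lambda>x. \<Sum>k<n. z ^ k / fact k * (g x * of_real (x \<bullet> h) ^ k))"
        unfolding eq
        using S by (intro tempered_diff[OF u gt[OF smooth_expi]] test_functions_schwartz) blast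
      also have "u (\<lambda>x. \<Sum>k<n. z ^ k / fact k * (g x * of_real (x \<bullet> h) ^ k)) =
         (\<Sum>k<n. z ^ k / fact k * u (\<lambda>x. g x * of_real (x \<bullet> h) ^ k))"
        by (simp only: conjunct2[OF S] tempered_cmult[OF u gt[OF smooth_power[OF smooth_inner]]])
      finally show ?thesis .
    qed
    show "(\<lambda>k. z ^ k / fact k * u (\<lambda>x. g x * of_real (x \<bullet> h) ^ k)) sums u (\<lambda>x. g x * expi z h x)"
      unfolding sums_def
    proof (rule tendstoI)
      fix e :: real assume e: "e > 0"
      define e' where "e' = e / (C + 1)"
      have e': "e' > 0" "C * e' < e" using e C by (auto simp: e'_def field_simps add_nonneg_pos)
      have "\<forall>\<^sub>F n in sequentially. deriv_bound N S (\<lambda>x. exp_rest n (l x)) e'"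
        by (rule deriv_bound_exp_rest[OF sl _ lb e'(1)]) (use b in simp)
      then show "\<forall>\<^sub>F n in sequentially. dist (\<Sum>k<n. z ^ k / fact k * u (\<lambda>x. g x * of_real (x \<bullet> h) ^ k))
          (u (\<lambda>x. g x * expi z h x)) < e"
      proof eventually_elim
        case (elim n)
        then have "norm (u (\<lambda>x. g x * exp_rest n (l x))) \<le> C * e'"
          using e' by (intro bd smooth_exp_rest sl) auto
        then show ?case using e' by (simp add: part dist_norm norm_minus_commute)
      qed
    qed
  qed
qed

text \<open>The series in z converges everywhere, which gives an entire function. Its k-th
  coefficient is at most C (M |h|)^k / k!, and these bounds sum to an exponential.\<close>

lemma fourier_laplace_entire:
  fixes u :: "'m::finite functional"
  assumes u: "u \<in> tempered" and g: "g \<in> test_functions"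
  shows "(\<lambda>z. u (\<lambda>x. g x * expi z h x)) holomorphic_on UNIV"
    and "\<exists>C M. \<forall>z. norm (u (\<lambda>x. g x * expi z h x)) \<le> C * exp (M * norm z)"
proof -
  obtain C M where C0: "C \<ge> 0" "M \<ge> 0"
    "\<forall>h k. norm (u (\<lambda>x. g x * of_real (x \<bullet> h) ^ k)) \<le> C * (M * norm h) ^ k"
    "\<forall>h z. (\<lambda>k. z ^ k / fact k * u (\<lambda>x. g x * of_real (x \<bullet> h) ^ k)) sums u (\<lambda>x. g x * expi z h x)"
    using tempered_exp_series[OF u g] by blast
  note C = C0(1,2) C0(3,4)[rule_format]
  have "(\<lambda>z. u (\<lambda>x. g x * expi z h x)) holomorphic_on ball 0 r" for r
    by (rule power_series_holomorphic[where a = "\<lambda>k. u (\<lambda>x. g x * of_real (x \<bullet> h) ^ k) / fact k"])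
      (use C(4)[of _ h] in \<open>simp add: mult_ac\<close>)
  then have "(\<lambda>z. u (\<lambda>x. g x * expi z h x)) field_differentiable (at z)" for z
    by (intro holomorphic_on_imp_differentiable_at[of _ "ball 0 (norm z + 1)"]) auto
  then show "(\<lambda>z. u (\<lambda>x. g x * expi z h x)) holomorphic_on UNIV"
    by (simp add: holomorphic_on_def field_differentiable_at_within)
  have "norm (u (\<lambda>x. g x * expi z h x)) \<le> C * exp ((M * norm h) * norm z)" for z
  proof (rule norm_sums_le[OF C(4)])
    show "(\<lambda>k. C * (((M * norm h) * norm z) ^ k /\<^sub>R fact k)) sums (C * exp ((M * norm h) * norm z))"
      by (intro sums_mult exp_converges)
    fix k
    have "norm (z ^ k / fact k * u (\<lambda>x. g x * of_real (x \<bullet> h) ^ k)) \<le> norm z ^ k / fact k * (C * (M * norm h) ^ k)"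
      unfolding norm_mult norm_divide norm_power norm_fact by (intro mult_left_mono C) simp
    also have "\<dots> = C * (((M * norm h) * norm z) ^ k /\<^sub>R fact k)"
      by (simp add: power_mult_distrib divide_inverse mult_ac)
    finally show "norm (z ^ k / fact k * u (\<lambda>x. g x * of_real (x \<bullet> h) ^ k)) \<le> C * (((M * norm h) * norm z) ^ k /\<^sub>R fact k)" .
  qed
  then show "\<exists>C M. \<forall>z. norm (u (\<lambda>x. g x * expi z h x)) \<le> C * exp (M * norm z)" by blast
qed

lemma expi_add: "expi z (y + h) x = expi z y x * expi z h x"
  by (simp add: expi_def inner_add_right distrib_left exp_add)

text \<open>If g is a cutoff around the support of u, then z = \<open>- \<i>\<close> gives the
  Fourier transform of u up to normalisation. The test function g is left arbitrary because
  differentiation in y multiplies it by a coordinate.\<close>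

definition fourier_laplace :: "'m::finite functional \<Rightarrow> (real^'m \<Rightarrow> complex) \<Rightarrow> complex \<Rightarrow> real^'m \<Rightarrow> complex" where
  "fourier_laplace u g z y = u (\<lambda>x. g x * expi z y x)"

text \<open>The exponential at y + h factors, and the factor at y is absorbed into the test
  function. In the series for the factor at h the term k = 0 is the value, the term k = 1 the
  derivative, and the rest is of order |h|^2.\<close>

lemma fourier_laplace_has_derivative:
  fixes u :: "'m::finite functional"
  assumes u: "u \<in> tempered" and g: "g \<in> test_functions"
  shows "(fourier_laplace u g z has_derivative
    (\<lambda>h. \<Sum>i\<in>UNIV. (h $ i) *\<^sub>R fourier_laplace u (\<lambda>x. g x * (z * of_real (x $ i))) z y)) (at y)"
proof -
  let ?g = "\<lambda>x. g x * expi z y x"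
  let ?D = "\<lambda>h. \<Sum>i\<in>UNIV. (h $ i) *\<^sub>R fourier_laplace u (\<lambda>x. g x * (z * of_real (x $ i))) z y"
  have gt: "?g \<in> test_functions" by (intro test_functions_mult g smooth_expi)
  obtain C M where C0: "C \<ge> 0" "M \<ge> 0"
    "\<forall>h k. norm (u (\<lambda>x. ?g x * of_real (x \<bullet> h) ^ k)) \<le> C * (M * norm h) ^ k"
    "\<forall>h z. (\<lambda>k. z ^ k / fact k * u (\<lambda>x. ?g x * of_real (x \<bullet> h) ^ k)) sums u (\<lambda>x. ?g x * expi z h x)"
    using tempered_exp_series[OF u gt] by blast
  note C = C0(1,2) C0(3,4)[rule_format]
  have D: "z * u (\<lambda>x. ?g x * of_real (x \<bullet> h)) = ?D h" for h
  proof -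
    have t: "(\<lambda>x. (g x * (z * of_real (x $ i))) * expi z y x) \<in> test_functions" for i
      by (intro test_functions_mult g smooth_expi smooth_cmult smooth_of_real smooth_component)
    have t': "(\<lambda>x. of_real (h $ i) * ((g x * (z * of_real (x $ i))) * expi z y x)) \<in> test_functions" for i
      using test_functions_mult[OF t smooth_const, of i "of_real (h $ i)"] by (simp add: mult_ac)
    have t1: "(\<lambda>x. ?g x * of_real (x \<bullet> h)) \<in> test_functions"
      by (intro test_functions_mult[OF gt] smooth_inner)
    have "z * u (\<lambda>x. ?g x * of_real (x \<bullet> h)) = u (\<lambda>x. z * (?g x * of_real (x \<bullet> h)))"
      by (simp add: tempered_cmult[OF u test_functions_schwartz[OF t1]])
    also have "(\<lambda>x. z * (?g x * of_real (x \<bullet> h))) =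
      (\<lambda>x. \<Sum>i\<in>UNIV. of_real (h $ i) * ((g x * (z * of_real (x $ i))) * expi z y x))"
      by (simp add: inner_vec_def sum_distrib_left mult_ac)
    also have "u \<dots> = (\<Sum>i\<in>UNIV. u (\<lambda>x. of_real (h $ i) * ((g x * (z * of_real (x $ i))) * expi z y x)))"
      by (rule conjunct2[OF tempered_sum[OF u finite_class.finite_UNIV t']])
    also have "\<dots> = ?D h"
      by (simp only: tempered_cmult[OF u test_functions_schwartz[OF t]] fourier_laplace_def scaleR_conv_of_real)
    finally show ?thesis .
  qed
  let ?R = "\<lambda>h. fourier_laplace u g z (y + h) - fourier_laplace u g z y - ?D h"
  \<comment> \<open>From k = 2 on, \<open>fact (k + 2)\<close> is replaced by the smaller
    \<open>fact k\<close>. With q = M |z| |h| this leaves C q^2 exp q, and |h| \<le> 1 removes h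
    from the exponential.\<close>
  define A where "A = C * (M * norm z) ^ 2 * exp (M * norm z)"
  have A: "A \<ge> 0" using C by (simp add: A_def)
  have est: "norm (?R h) \<le> A * norm h ^ 2"
    if h: "norm h \<le> 1" for h
  proof -
    let ?q = "M * norm z * norm h"
    have "(\<lambda>k. z ^ (k + 2) / fact (k + 2) * u (\<lambda>x. ?g x * of_real (x \<bullet> h) ^ (k + 2))) sums
      (u (\<lambda>x. ?g x * expi z h x) - (\<Sum>k<2. z ^ k / fact k * u (\<lambda>x. ?g x * of_real (x \<bullet> h) ^ k)))"
      by (rule sums_split_initial_segment[OF C(4)])
    moreover have "u (\<lambda>x. ?g x * expi z h x) - (\<Sum>k<2. z ^ k / fact k * u (\<lambda>x. ?g x * of_real (x \<bullet> h) ^ k)) =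
       ?R h"
      by (simp add: numeral_2_eq_2 fourier_laplace_def[of u g] expi_add mult.assoc D[symmetric])
    ultimately have s1: "(\<lambda>k. z ^ (k + 2) / fact (k + 2) * u (\<lambda>x. ?g x * of_real (x \<bullet> h) ^ (k + 2))) sums
      ?R h" by simp
    have s2: "(\<lambda>k. C * ?q ^ 2 * (?q ^ k /\<^sub>R fact k)) sums (C * ?q ^ 2 * exp ?q)"
      by (intro sums_mult exp_converges)
    have "norm (?R h) \<le> C * ?q ^ 2 * exp ?q"
    proof (rule norm_sums_le[OF s1 s2])
      fix k
      have "norm (z ^ (k + 2) / fact (k + 2) * u (\<lambda>x. ?g x * of_real (x \<bullet> h) ^ (k + 2)))
        \<le> norm z ^ (k + 2) / fact (k + 2) * (C * (M * norm h) ^ (k + 2))"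
        unfolding norm_mult norm_divide norm_power norm_fact by (intro mult_left_mono C) simp
      also have "\<dots> = C * ?q ^ (k + 2) / fact (k + 2)" by (simp only: power_mult_distrib) (simp add: mult_ac)
      also have "\<dots> \<le> C * ?q ^ (k + 2) / fact k"
        using C by (intro divide_left_mono fact_mono) auto
      also have "\<dots> = C * ?q ^ 2 * (?q ^ k /\<^sub>R fact k)"
        by (simp only: power_add) (simp add: divide_inverse mult_ac)
      finally show "norm (z ^ (k + 2) / fact (k + 2) * u (\<lambda>x. ?g x * of_real (x \<bullet> h) ^ (k + 2))) \<le> C * ?q ^ 2 * (?q ^ k /\<^sub>R fact k)" .
    qed
    also have "\<dots> \<le> C * ?q ^ 2 * exp (M * norm z)"
      using C h by (intro mult_left_mono) (auto simp: mult_left_le)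
    also have "\<dots> = A * norm h ^ 2" by (simp add: A_def power_mult_distrib mult_ac)
    finally show ?thesis .
  qed
  show ?thesis
  proof (rule has_derivativeI_sandwich[where e = 1 and H = "\<lambda>x. A * norm (x - y)"])
    show "bounded_linear ?D"
      by (intro bounded_linear_sum bounded_linear_scaleR_const bounded_linear_component)
    show "norm (fourier_laplace u g z x - fourier_laplace u g z y - ?D (x - y)) / norm (x - y) \<le> A * norm (x - y)"
      if "x \<noteq> y" "dist x y < 1" for x
      using est[of "x - y"] that
      by (simp add: dist_norm pos_divide_le_eq power2_eq_square mult.assoc)
    have "((\<lambda>x. A * norm (x - y)) \<longlongrightarrow> A * norm (y - y)) (at y)" by (intro tendsto_intros)
    then show "((\<lambda>x. A * norm (x - y)) \<longlongrightarrow> 0) (at y)" by simp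
  qed simp
qed

lemma fourier_laplace_partial_deriv:
  fixes u :: "'m::finite functional"
  assumes u: "u \<in> tempered" and g: "g \<in> test_functions"
  shows "partial_deriv i (fourier_laplace u g z) = fourier_laplace u (\<lambda>x. g x * (z * of_real (x $ i))) z"
proof
  fix y
  have "partial_deriv i (fourier_laplace u g z) y =
     (\<Sum>j\<in>UNIV. (axis i 1 $ j) *\<^sub>R fourier_laplace u (\<lambda>x. g x * (z * of_real (x $ j))) z y)"
    by (rule partial_deriv_eqI[OF fourier_laplace_has_derivative[OF u g]])
  also have "\<dots> = (\<Sum>j\<in>UNIV. if j = i then fourier_laplace u (\<lambda>x. g x * (z * of_real (x $ j))) z y else 0)"
    by (intro sum.cong) (auto simp: axis_def)
  finally show "partial_deriv i (fourier_laplace u g z) y = fourier_laplace u (\<lambda>x. g x * (z * of_real (x $ i))) z y"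
    by simp
qed

lemma fourier_laplace_smooth:
  fixes u :: "'m::finite functional"
  assumes u: "u \<in> tempered" and "g \<in> test_functions"
  shows "smooth (fourier_laplace u g z)"
proof -
  have "diff_order n (fourier_laplace u g z)" for n
    using assms(2)
  proof (induction n arbitrary: g)
    case (Suc n)
    have "(\<lambda>x. g x * (z * of_real (x $ i))) \<in> test_functions" for i
      by (intro test_functions_mult Suc.prems smooth_cmult smooth_of_real smooth_component)
    then have "diff_order n (partial_deriv i (fourier_laplace u g z))" for i
      unfolding fourier_laplace_partial_deriv[OF u Suc.prems] by (rule Suc.IH)
    moreover have "fourier_laplace u g z differentiable (at y)" for y
      using fourier_laplace_has_derivative[OF u Suc.prems] unfolding differentiable_def by blast
    ultimately show ?case by (simp add: diff_order_Suc)
  qed simp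
  then show ?thesis by (simp add: smooth_iff_diff_order)
qed

section \<open>The smooth function representing a Fourier transform\<close>

lemma smooth_cnj: "smooth f \<Longrightarrow> smooth (\<lambda>x. cnj (f x))"
  by (rule smooth_bounded_linear[OF bounded_linear_cnj])

text \<open>The difference d = f - g is tested against its own conjugate, localised by |b|^2 with b
  = 1 near \<open>x0\<close>. The resulting integral of |b d|^2 is 0, and its integrand is
  continuous and nonnegative.\<close>

lemma represents_unique:
  fixes f g :: "real^'m \<Rightarrow> complex"
  assumes f: "smooth f" "represents f u" and g: "smooth g" "represents g u"
  shows "f = g"
proof
  fix x0
  define d where "d = (\<lambda>x. f x - g x)"
  define b :: "real^'m \<Rightarrow> complex" where "b = bump x0 1 2"
  have sd: "smooth d" unfolding d_def by (intro smooth_diff f g)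
  have sb: "smooth b" unfolding b_def by (rule smooth_bump)
  have bt: "b \<in> test_functions" unfolding b_def by (rule bump_test_function) auto
  define \<phi> where "\<phi> = (\<lambda>x. b x * (cnj (b x) * cnj (d x)))"
  have \<phi>: "\<phi> \<in> test_functions"
    unfolding \<phi>_def by (intro test_functions_mult bt smooth_mult smooth_cnj sb sd)
  have s\<phi>: "smooth \<phi>" using \<phi> by (rule test_functions_smooth)
  obtain R where R: "\<And>x. norm x \<ge> R \<Longrightarrow> \<phi> x = 0" using test_functionsE[OF \<phi>] by metis
  \<comment> \<open>The open box has to contain \<open>x0\<close>: a vanishing integral says nothing
    about values on a degenerate box.\<close>
  obtain a where a: "cball 0 (\<bar>R\<bar> + norm x0) \<subseteq> box (- a) (a :: real^'m)"
    by (rule bounded_subset_box_symmetric[OF bounded_cball])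
  have x0: "x0 \<in> box (- a) a" using a by (rule subsetD) simp
  have out: "\<phi> x = 0" if "x \<notin> cbox (- a) a" for x
  proof (rule R)
    have "x \<notin> cball 0 (\<bar>R\<bar> + norm x0)" using that a box_subset_cbox by blast
    then have "\<bar>R\<bar> + norm x0 < norm x" by simp
    then show "norm x \<ge> R" using norm_ge_zero[of x0] by linarith
  qed
  have int: "integrable lborel (\<lambda>x. h x * \<phi> x)" "(LINT x|lborel. h x * \<phi> x) = integral (cbox (-a) a) (\<lambda>x. h x * \<phi> x)"
    if "smooth h" for h
  proof -
    have "continuous_on UNIV (\<lambda>x. h x * \<phi> x)" by (intro smooth_continuous_on smooth_mult that s\<phi>)
    then show "integrable lborel (\<lambda>x. h x * \<phi> x)"
      "(LINT x|lborel. h x * \<phi> x) = integral (cbox (-a) a) (\<lambda>x. h x * \<phi> x)"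
      using out integral_lborel_cbox[of "\<lambda>x. h x * \<phi> x" "-a" a] by simp_all
  qed
  define r where "r = (\<lambda>x. (norm (b x * d x))\<^sup>2)"
  have dr: "d x * \<phi> x = of_real (r x)" for x
    using complex_norm_square[of "b x * d x"] by (simp add: \<phi>_def r_def mult_ac)
  have "(LINT x|lborel. d x * \<phi> x) = (LINT x|lborel. f x * \<phi> x) - (LINT x|lborel. g x * \<phi> x)"
    unfolding d_def left_diff_distrib by (intro Bochner_Integration.integral_diff int f g)
  also have "\<dots> = 0" using f(2) g(2) \<phi> by (simp add: represents_def)
  finally have "integral (cbox (-a) a) (\<lambda>x. complex_of_real (r x)) = 0" using int(2)[OF sd] by (simp add: dr)
  moreover have "continuous_on (cbox (-a) a) (\<lambda>x. complex_of_real (r x))"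
    unfolding r_def using smooth_continuous_on[OF sb] smooth_continuous_on[OF sd] by (intro continuous_intros)
  ultimately have "((\<lambda>x. complex_of_real (r x)) has_integral 0) (cbox (-a) a)"
    using integrable_integral[OF integrable_continuous] by metis
  from has_integral_linear[OF this bounded_linear_Re] have "(r has_integral 0) (cbox (-a) a)"
    by (simp add: o_def)
  moreover have "continuous_on (cbox (-a) a) r"
    unfolding r_def using smooth_continuous_on[OF sb] smooth_continuous_on[OF sd] by (intro continuous_intros)
  moreover have "r x \<ge> 0" for x by (simp add: r_def)
  ultimately have "r x0 = 0"
    using has_integral_0_cbox_imp_0[of "-a" a r] x0 box_subset_cbox by blast
  then show "f x0 = g x0" by (simp add: r_def b_def bump_eq_1 d_def)
qed

definition fourier_const :: "'m itself \<Rightarrow> complex" where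
  "fourier_const _ = of_real ((2 * pi) powr (- real CARD('m) / 2))"

lemma fourier_const_nonzero: "fourier_const TYPE('m::finite) \<noteq> 0"
  by (simp add: fourier_const_def)

text \<open>By definition u acts on the transform of \<phi>, a Schwartz function, into which the
  cutoff may be inserted. That transform is an integral over a box containing the support of \<phi>,
  and u may be moved inside the integral.\<close>

lemma fourier_representation:
  fixes u :: "'m::finite functional"
  assumes u: "u \<in> tempered" and \<eta>: "is_cutoff (distr_support u) \<eta>"
  shows "represents (\<lambda>\<xi>. fourier_const TYPE('m) * fourier_laplace u \<eta> (- \<i>) \<xi>) (fourier u)"
  unfolding represents_def
proof
  fix \<phi> :: "real^'m \<Rightarrow> complex"
  assume \<phi>: "\<phi> \<in> test_functions"
  note s = test_functions_smooth[OF \<phi>]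
  have \<eta>t: "\<eta> \<in> test_functions" using \<eta> by (rule is_cutoff_test_function)
  obtain a where a: "\<And>x. x \<notin> cbox (- a) a \<Longrightarrow> \<phi> x = 0" using test_functions_cbox[OF \<phi>] by metis
  let ?c = "fourier_const TYPE('m)"
  have k: "smooth_kernel (cbox (-a) a) (\<lambda>x y. \<phi> y * expi (- \<i>) y x)"
    by (intro smooth_kernel_expi smooth_continuous_on s)
  have "fourier u \<phi> = u (\<lambda>\<xi>. ?c * fourier_integral \<phi> \<xi>)"
    using test_functions_schwartz[OF \<phi>] by (simp add: fourier_def fourier_fun_eq[abs_def] fourier_const_def)
  also have "\<dots> = ?c * u (\<lambda>x. \<eta> x * fourier_integral \<phi> x)"
    by (simp add: tempered_cmult[OF u fourier_integral_schwartz[OF \<phi>]]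
        tempered_cutoff[OF u \<eta> fourier_integral_schwartz[OF \<phi>]])
  also have "u (\<lambda>x. \<eta> x * fourier_integral \<phi> x) =
     u (\<lambda>x. \<eta> x * integral (cbox (-a) a) (\<lambda>y. \<phi> y * expi (- \<i>) y x))"
    by (simp add: fourier_integral_cbox[OF s a])
  also have "\<dots> = integral (cbox (-a) a) (\<lambda>y. u (\<lambda>x. \<eta> x * (\<phi> y * expi (- \<i>) y x)))"
    by (rule tempered_integral(2)[OF u \<eta>t k])
  also have "(\<lambda>y. u (\<lambda>x. \<eta> x * (\<phi> y * expi (- \<i>) y x))) = (\<lambda>y. fourier_laplace u \<eta> (- \<i>) y * \<phi> y)"
  proof
    fix y
    have "u (\<lambda>x. \<phi> y * (\<eta> x * expi (- \<i>) y x)) = \<phi> y * u (\<lambda>x. \<eta> x * expi (- \<i>) y x)"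
      by (intro tempered_cmult u test_functions_schwartz test_functions_mult \<eta>t smooth_expi)
    then show "u (\<lambda>x. \<eta> x * (\<phi> y * expi (- \<i>) y x)) = fourier_laplace u \<eta> (- \<i>) y * \<phi> y"
      by (simp add: fourier_laplace_def mult_ac)
  qed
  also have "integral (cbox (-a) a) \<dots> = (LINT y|lborel. fourier_laplace u \<eta> (- \<i>) y * \<phi> y)"
    by (rule integral_lborel_cbox(2)[symmetric])
      (intro smooth_continuous_on smooth_mult fourier_laplace_smooth u \<eta>t s, simp add: a)
  also have "?c * \<dots> = (LINT y|lborel. ?c * fourier_laplace u \<eta> (- \<i>) y * \<phi> y)"
    by (simp add: mult.assoc)
  finally show "fourier u \<phi> = (LINT y|lborel. ?c * fourier_laplace u \<eta> (- \<i>) y * \<phi> y)" .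
qed

text \<open>Any cutoff is allowed, so two distributions can be compared through a common
  one.\<close>

lemma fourier_c_eq:
  fixes u :: "'m::finite functional"
  assumes u: "u \<in> tempered" and \<eta>: "is_cutoff (distr_support u) \<eta>"
  shows "fourier_c u = (\<lambda>\<xi>. fourier_const TYPE('m) * fourier_laplace u \<eta> (- \<i>) \<xi>)"
proof -
  have s: "smooth (\<lambda>\<xi>. fourier_const TYPE('m) * fourier_laplace u \<eta> (- \<i>) \<xi>)"
    by (intro smooth_cmult fourier_laplace_smooth u is_cutoff_test_function[OF \<eta>])
  show ?thesis
    unfolding fourier_c_def smooth_rep_def
    using s fourier_representation[OF assms] by (intro the_equality) (auto intro: represents_unique)
qed

lemma fourier_c_smooth:
  fixes u :: "'m::finite functional"
  assumes "u \<in> tempered_c"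
  shows "smooth (fourier_c u)"
proof -
  have u: "u \<in> tempered" "compact (distr_support u)" using assms by (auto simp: tempered_c_def)
  obtain \<eta> where \<eta>: "is_cutoff (distr_support u) \<eta>" using cutoff_exists[OF u(2)] by blast
  show ?thesis
    unfolding fourier_c_eq[OF u(1) \<eta>]
    by (intro smooth_cmult fourier_laplace_smooth u is_cutoff_test_function[OF \<eta>])
qed

section \<open>Injectivity of the Fourier transform\<close>

text \<open>The test functions g for which g u has vanishing Fourier transform. They form a linear
  space stable under multiplication by coordinates, hence by polynomials.\<close>

definition fourier_null :: "'m::finite functional \<Rightarrow> (real^'m \<Rightarrow> complex) \<Rightarrow> bool" where
  "fourier_null u g \<longleftrightarrow> g \<in> test_functions \<and> (\<forall>y. fourier_laplace u g (- \<i>) y = 0)"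

lemma fourier_null_add:
  assumes "u \<in> tempered" "fourier_null u f" "fourier_null u g"
  shows "fourier_null u (\<lambda>x. f x + g x)"
proof -
  have t: "(\<lambda>x. h x * expi (- \<i>) y x) \<in> schwartz" if "fourier_null u h" for h y
    using that by (intro test_functions_schwartz test_functions_mult smooth_expi) (simp add: fourier_null_def)
  show ?thesis
    using assms(2,3) tempered_add[OF assms(1) t[OF assms(2)] t[OF assms(3)]]
    by (simp add: fourier_null_def fourier_laplace_def distrib_right test_functions_add)
qed

lemma fourier_null_cmult:
  assumes "u \<in> tempered" "fourier_null u f"
  shows "fourier_null u (\<lambda>x. c * f x)"
proof -
  have f: "f \<in> test_functions" using assms by (simp add: fourier_null_def)
  have t: "(\<lambda>x. f x * expi (- \<i>) y x) \<in> schwartz" for y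
    by (intro test_functions_schwartz test_functions_mult smooth_expi f)
  have "(\<lambda>x. f x * c) \<in> test_functions" by (intro test_functions_mult f smooth_const)
  then show ?thesis
    using assms(2) tempered_cmult[OF assms(1) t, of c]
    by (simp add: fourier_null_def fourier_laplace_def mult.assoc) (simp add: mult.commute)
qed

lemma fourier_null_sum:
  assumes "u \<in> tempered" "finite I" "\<And>i. i \<in> I \<Longrightarrow> fourier_null u (f i)"
  shows "fourier_null u (\<lambda>x. \<Sum>i\<in>I. f i x)"
  using assms(2,3)
proof (induction I rule: finite_induct)
  case empty
  then show ?case
    by (simp add: fourier_null_def zero_test_function fourier_laplace_def tempered_zero[OF assms(1)])
qed (simp add: fourier_null_add[OF assms(1)])

text \<open>Differentiating the vanishing transform in direction i multiplies f by - \<i> times the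
  coordinate; a further factor \<i> undoes the constant.\<close>

lemma fourier_null_coord:
  fixes u :: "'m::finite functional"
  assumes "u \<in> tempered" "fourier_null u f"
  shows "fourier_null u (\<lambda>x. f x * of_real (x $ i - c))"
proof -
  have f: "f \<in> test_functions" "fourier_laplace u f (- \<i>) = (\<lambda>_. 0)" using assms by (auto simp: fourier_null_def)
  have "fourier_laplace u (\<lambda>x. f x * (- \<i> * of_real (x $ i))) (- \<i>) = (\<lambda>_. 0)"
    using fourier_laplace_partial_deriv[OF assms(1) f(1), of i "- \<i>"] by (simp add: f(2))
  moreover have "(\<lambda>x. f x * (- \<i> * of_real (x $ i))) \<in> test_functions"
    by (intro test_functions_mult f smooth_cmult smooth_of_real smooth_component)
  ultimately have "fourier_null u (\<lambda>x. f x * (- \<i> * of_real (x $ i)))" by (simp add: fourier_null_def)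
  then have "fourier_null u (\<lambda>x. \<i> * (f x * (- \<i> * of_real (x $ i))) + (- of_real c) * f x)"
    by (intro fourier_null_add fourier_null_cmult assms)
  then show ?thesis by (simp add: algebra_simps)
qed

definition landau :: "real \<Rightarrow> real^'m \<Rightarrow> real" where
  "landau \<rho> v = 1 - norm v ^ 2 / \<rho> ^ 2"

text \<open>The squared distance is a sum of squares of shifted coordinates, so each power of the
  kernel uses the coordinate rule twice.\<close>

lemma fourier_null_landau:
  fixes u :: "'m::finite functional"
  assumes u: "u \<in> tempered" and f: "fourier_null u f"
  shows "fourier_null u (\<lambda>x. f x * of_real (landau \<rho> (x - y)) ^ n)"
proof (induction n)
  case 0
  show ?case using f by simp
next
  case (Suc n)
  define g where "g = (\<lambda>x. f x * of_real (landau \<rho> (x - y)) ^ n)"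
  have g: "fourier_null u g" unfolding g_def by (rule Suc.IH)
  let ?S = "\<lambda>x. \<Sum>i\<in>UNIV. g x * of_real (x $ i - y $ i) * of_real (x $ i - y $ i)"
  have "fourier_null u (\<lambda>x. g x + of_real (- 1 / \<rho> ^ 2) * ?S x)"
    by (intro fourier_null_add fourier_null_cmult fourier_null_sum fourier_null_coord u g) simp
  moreover have "g x + of_real (- 1 / \<rho> ^ 2) * ?S x = f x * of_real (landau \<rho> (x - y)) ^ Suc n" for x
  proof -
    have "?S x = g x * of_real (norm (x - y) ^ 2)"
      unfolding norm_power2_vec
      by (simp only: of_real_sum sum_distrib_left power2_eq_square of_real_mult mult.assoc vector_minus_component)
    then have "g x + of_real (- 1 / \<rho> ^ 2) * ?S x = g x * of_real (landau \<rho> (x - y))"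
      by (simp add: landau_def algebra_simps)
    then show ?thesis by (simp add: g_def mult_ac)
  qed
  ultimately show ?case by simp
qed

lemma smooth_landau: "smooth (\<lambda>v::real^'m. complex_of_real (landau \<rho> v) ^ n)"
proof -
  have "smooth (\<lambda>v::real^'m. norm v ^ 2)" using smooth_norm_power2[where a = "0::real^'m"] by simp
  then have "smooth (\<lambda>v::real^'m. landau \<rho> v)"
    unfolding landau_def divide_inverse by (rule smooth_diff[OF smooth_const smooth_mult[OF _ smooth_const]])
  then show ?thesis by (intro smooth_power smooth_of_real)
qed

text \<open>From radius d on the kernel is at most \<alpha>^n, while on a box of volume \<kappa>
  inside the closed ball of radius d / 2 it is at least \<beta>^n with \<beta> > \<alpha>. The
  quotient decays with ratio \<gamma> = \<alpha> / \<beta>. The maximum with 0 removes the part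
  beyond radius \<rho>, where the powers grow in absolute value.\<close>

lemma landau_concentration:
  fixes a :: "real^'m"
  assumes "0 < d" "d \<le> \<rho>" and a: "cball 0 \<rho> \<subseteq> cbox (- a) a"
  shows "\<exists>\<kappa> \<gamma>. \<kappa> > 0 \<and> 0 \<le> \<gamma> \<and> \<gamma> < 1 \<and>
    (\<forall>n. integral (cbox (- a) a) (\<lambda>v. max 0 (landau \<rho> v) ^ n) > 0) \<and>
    (\<forall>n v. norm v \<ge> d \<longrightarrow>
      max 0 (landau \<rho> v) ^ n / integral (cbox (- a) a) (\<lambda>v. max 0 (landau \<rho> v) ^ n) \<le> \<gamma> ^ n / \<kappa>)"
proof -
  define \<alpha> where "\<alpha> = 1 - d ^ 2 / \<rho> ^ 2"
  define \<beta> where "\<beta> = 1 - (d / 2) ^ 2 / \<rho> ^ 2"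
  have \<rho>: "\<rho> > 0" using assms by simp
  have "d ^ 2 \<le> \<rho> ^ 2" using assms by (intro power_mono) auto
  then have \<alpha>: "0 \<le> \<alpha>" using \<rho> by (simp add: \<alpha>_def)
  have "(d / 2) ^ 2 < d ^ 2" using assms by (intro power_strict_mono) auto
  then have \<alpha>\<beta>: "\<alpha> < \<beta>" unfolding \<alpha>_def \<beta>_def using \<rho> by (intro diff_strict_left_mono divide_strict_right_mono) auto
  obtain p q where pq: "0 \<in> box p q" "box p q \<subseteq> ball (0::real^'m) (d / 2)"
    using rational_boxes[of "d / 2" "0::real^'m"] assms(1) by auto
  define \<kappa> where "\<kappa> = measure lborel (cbox p q)"
  have "\<forall>i\<in>Basis. p \<bullet> i < q \<bullet> i" using pq(1) by (auto simp: mem_box intro: order_less_trans)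
  then have \<kappa>: "\<kappa> > 0" unfolding \<kappa>_def by (rule content_pos_lt)
  have "closure (box p q) \<subseteq> cball 0 (d / 2)"
    using pq(2) by (intro closure_minimal) auto
  then have cb: "cbox p q \<subseteq> cball 0 (d / 2)" using pq(1) by (metis closure_box empty_iff)
  have sub: "cbox p q \<subseteq> cbox (-a) a"
  proof -
    have "cball 0 (d / 2) \<subseteq> cball (0::real^'m) \<rho>" using assms by (intro subset_cball) auto
    then show ?thesis using cb a by blast
  qed
  let ?m = "\<lambda>v. max 0 (landau \<rho> v)"
  let ?I = "\<lambda>n. integral (cbox (- a) a) (\<lambda>v. ?m v ^ n)"
  have I: "\<kappa> * \<beta> ^ n \<le> ?I n" for n
  proof -
    have int: "(\<lambda>v. ?m v ^ n) integrable_on cbox c d" for c d :: "real^'m"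
      unfolding landau_def by (intro integrable_continuous continuous_intros) (use \<rho> in auto)
    have "\<kappa> * \<beta> ^ n = integral (cbox p q) (\<lambda>v. \<beta> ^ n)" by (simp add: \<kappa>_def)
    also have "\<dots> \<le> integral (cbox p q) (\<lambda>v. ?m v ^ n)"
    proof (rule integral_le)
      fix v assume "v \<in> cbox p q"
      then have "norm v \<le> d / 2" using cb by auto
      then have "norm v ^ 2 \<le> (d / 2) ^ 2" by (intro power_mono) auto
      then have "\<beta> \<le> landau \<rho> v" using \<rho> by (simp add: landau_def \<beta>_def divide_right_mono)
      then show "\<beta> ^ n \<le> ?m v ^ n" using \<alpha> \<alpha>\<beta> by (intro power_mono) auto
    qed (auto intro: int)
    also have "\<dots> \<le> ?I n" by (intro integral_subset_le sub int) simp
    finally show ?thesis .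
  qed
  show ?thesis
  proof (rule exI[of _ \<kappa>], rule exI[of _ "\<alpha> / \<beta>"], intro conjI allI impI)
    show "?I n > 0" for n
    proof -
      have "\<kappa> * \<beta> ^ n > 0" using \<kappa> \<alpha> \<alpha>\<beta> by simp
      then show ?thesis using I[of n] by linarith
    qed
    show "?m v ^ n / ?I n \<le> (\<alpha> / \<beta>) ^ n / \<kappa>" if "norm v \<ge> d" for n v
    proof -
      have "d ^ 2 \<le> norm v ^ 2" using that assms by (intro power_mono) auto
      then have "landau \<rho> v \<le> \<alpha>" using \<rho> by (simp add: landau_def \<alpha>_def divide_right_mono)
      then have "?m v ^ n \<le> \<alpha> ^ n" using \<alpha> by (intro power_mono) auto
      then have "?m v ^ n / ?I n \<le> \<alpha> ^ n / (\<kappa> * \<beta> ^ n)"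
        using I[of n] \<kappa> \<alpha> \<alpha>\<beta> by (intro frac_le) auto
      then show ?thesis by (simp add: power_divide mult.commute)
    qed
  qed (use \<kappa> \<alpha> \<alpha>\<beta> in auto)
qed

text \<open>Convolution with normalised Landau kernels \<open>(1 - |v|\<^sup>2 / \<rho>\<^sup>2)\<^sup>n\<close> approximates a test function
  by polynomials, together with any number of derivatives, on a given compact set.\<close>

lemma landau_approximation:
  fixes \<phi> :: "real^'m \<Rightarrow> complex"
  assumes \<phi>: "\<phi> \<in> test_functions" and R: "\<And>x. norm x \<ge> R \<Longrightarrow> \<phi> x = 0" and "R > 0"
    and S: "compact S" "S \<subseteq> cball 0 r" "r > 0" and \<rho>: "\<rho> = R + r + 1"
    and b: "\<And>x. x \<notin> cbox (- b) b \<Longrightarrow> \<phi> x = 0" and e: "e > 0"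
  obtains n c where "deriv_bound N S
    (\<lambda>x. \<phi> x - c * integral (cbox (- b) b) (\<lambda>y. \<phi> y * of_real (landau \<rho> (x + (- 1) *\<^sub>R y)) ^ n)) e"
proof -
  note s = test_functions_smooth[OF \<phi>]
  obtain a where a: "cball 0 \<rho> \<subseteq> cbox (- a) (a :: real^'m)"
    by (rule bounded_subset_cbox_symmetric[OF bounded_cball])
  let ?m = "\<lambda>v::real^'m. max 0 (landau \<rho> v)"
  let ?I = "\<lambda>n. integral (cbox (- a) a) (\<lambda>v. ?m v ^ n)"
  have \<rho>0: "\<rho> > 0" using assms by simp
  have mc: "continuous_on T (\<lambda>v. ?m v ^ n)" for T n
    unfolding landau_def by (intro continuous_intros) (use \<rho>0 in auto)
  obtain B where B: "B \<ge> 0" "deriv_bound N UNIV \<phi> B" using test_functions_deriv_bound[OF \<phi>] by metis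
  have k1: "smooth_kernel (cbox (-a) a) (\<lambda>x y. 1 * \<phi> (x + 1 *\<^sub>R y))"
    by (rule smooth_kernel_convolution(2)[OF s continuous_on_const])
  obtain d0 where d0: "d0 > 0" "\<And>y y'. y \<in> cbox (-a) a \<Longrightarrow> y' \<in> cbox (-a) a \<Longrightarrow> dist y y' < d0 \<Longrightarrow>
      deriv_bound N S (\<lambda>x. 1 * \<phi> (x + 1 *\<^sub>R y) - 1 * \<phi> (x + 1 *\<^sub>R y')) (e / 2)"
    using smooth_kernel_uniform[OF k1 S(1) half_gt_zero[OF e], of N] by blast
  have sk1: "smooth (\<lambda>x. 1 * \<phi> (x + 1 *\<^sub>R y))" for y using k1 by (simp only: smooth_kernel_def)
  define d where "d = min d0 \<rho>"
  have d: "0 < d" "d \<le> \<rho>" "d \<le> d0" using d0 \<rho>0 by (auto simp: d_def)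
  obtain \<kappa> \<gamma> where \<kappa>: "\<kappa> > 0" "0 \<le> \<gamma>" "\<gamma> < 1" and I: "\<And>n. ?I n > 0"
    and conc: "\<And>n v. norm v \<ge> d \<Longrightarrow> ?m v ^ n / ?I n \<le> \<gamma> ^ n / \<kappa>"
    using landau_concentration[OF d(1,2) a] by blast
  let ?V = "measure lborel (cbox (-a) a)"
  \<comment> \<open>The contribution away from the origin: 2 B bounds an increment of a derivative
    of \<phi>, \<open>?V\<close> is the volume of the box, and \<gamma>^n / \<kappa> bounds the
    normalised kernel.\<close>
  have "(\<lambda>n. (2 * B * ?V / \<kappa>) * \<gamma> ^ n) \<longlonglongrightarrow> (2 * B * ?V / \<kappa>) * 0"
    using \<kappa> by (intro tendsto_intros LIMSEQ_power_zero) auto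
  then have "\<forall>\<^sub>F n in sequentially. (2 * B * ?V / \<kappa>) * \<gamma> ^ n < e / 2"
    by (rule order_tendstoD) (use e in simp)
  then obtain n where n: "(2 * B * ?V / \<kappa>) * \<gamma> ^ n < e / 2" by (auto simp: eventually_sequentially)
  define w where "w = (\<lambda>v. ?m v ^ n / ?I n)"
  have wc: "continuous_on T w" for T unfolding w_def using I[of n] by (intro continuous_on_divide mc continuous_on_const) auto
  have w0: "w v \<ge> 0" for v using I[of n] by (simp add: w_def)
  have w1: "integral (cbox (-a) a) w = 1" using I[of n] by (simp add: w_def)
  define c where "c = complex_of_real (1 / ?I n)"
  let ?P = "\<lambda>x. c * integral (cbox (- b) b) (\<lambda>y. \<phi> y * of_real (landau \<rho> (x + (- 1) *\<^sub>R y)) ^ n)"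
  let ?k = "\<lambda>x v. of_real (w v) * \<phi> (x + 1 *\<^sub>R v)"
  have k: "smooth_kernel (cbox (-a) a) ?k"
    by (rule smooth_kernel_convolution(2)[OF s]) (intro continuous_intros wc)
  have kP: "smooth_kernel (cbox (- b) b) (\<lambda>x y. \<phi> y * of_real (landau \<rho> (x + (- 1) *\<^sub>R y)) ^ n)"
    by (rule smooth_kernel_convolution(2)[OF smooth_landau smooth_continuous_on[OF s]])
  have sP: "smooth ?P" by (intro smooth_cmult smooth_kernel_smooth_integral[OF kP])
  \<comment> \<open>If |x| < r + 1 and |v| \<ge> \<rho>, then \<phi>(x + v) = 0; truncating the
    kernel is therefore invisible, and the polynomial is an average of translates of \<phi>. The
    summand 1 in \<rho> provides an open ball around S, as equality of derivatives requires.\<close>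
  have P: "?P x = integral (cbox (-a) a) (?k x)" if x: "x \<in> ball 0 (r + 1)" for x
  proof -
    let ?f = "\<lambda>y. \<phi> y * of_real (landau \<rho> (x - y)) ^ n"
    have fc: "continuous_on UNIV ?f"
      unfolding landau_def by (intro continuous_intros smooth_continuous_on s) (use \<rho>0 in auto)
    have out: "\<phi> (x + v) = 0" if "norm v \<ge> \<rho>" for v
    proof (rule R)
      have "norm v \<le> norm (x + v) + norm x" using norm_triangle_ineq4[of "x + v" x] by simp
      then show "norm (x + v) \<ge> R" using x that \<rho> by simp
    qed
    have "integral (cbox (- b) b) ?f = (LINT y|lborel. ?f y)"
      by (rule integral_lborel_cbox(2)[symmetric, OF fc]) (simp add: b)
    also have "\<dots> = (LINT v|lborel. ?f (x + v))" by (rule integral_translate[OF fc, symmetric])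
    also have "\<dots> = integral (cbox (-a) a) (\<lambda>v. ?f (x + v))"
    proof (rule integral_lborel_cbox(2))
      show "continuous_on UNIV (\<lambda>v. ?f (x + v))"
        by (rule continuous_on_compose2[OF fc]) (auto intro!: continuous_intros)
      show "?f (x + v) = 0" if "v \<notin> cbox (-a) a" for v
      proof -
        have "norm v \<ge> \<rho>" using that a by force
        then show ?thesis by (simp add: out)
      qed
    qed
    finally have "?P x = integral (cbox (-a) a) (\<lambda>v. c * ?f (x + v))" by simp
    also have "\<dots> = integral (cbox (-a) a) (?k x)"
    proof (rule Henstock_Kurzweil_Integration.integral_cong)
      fix v
      show "c * ?f (x + v) = ?k x v"
      proof (cases "norm v \<ge> \<rho>")
        case False
        then have "norm v ^ 2 \<le> \<rho> ^ 2" by (intro power_mono) auto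
        then have "?m v = landau \<rho> v" using \<rho>0 by (simp add: landau_def)
        then have "c * of_real (landau \<rho> v) ^ n = of_real (w v)" by (simp add: c_def w_def)
        then show ?thesis by (simp add: landau_def mult_ac)
      qed (simp add: out)
    qed
    finally show ?thesis .
  qed
  have "deriv_bound N S (\<lambda>x. \<phi> x - ?P x) e"
    unfolding deriv_bound_def
  proof (intro allI impI)
    fix "is" :: "'m list" and x assume isx: "length is \<le> N" "x \<in> S"
    let ?D = "partial_derivs is \<phi>"
    let ?F = "\<lambda>v. of_real (w v) * ?D x - of_real (w v) * ?D (x + v)"
    have x: "x \<in> ball 0 (r + 1)" using isx(2) S(2) by (auto simp: subset_iff intro: le_less_trans)
    have Dc: "continuous_on UNIV ?D" by (intro smooth_continuous_on smooth_partial_derivs s)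
    have Dxc: "continuous_on T (\<lambda>v. ?D (x + v))" for T
      by (rule continuous_on_compose2[OF Dc]) (auto intro!: continuous_intros)
    have wcc: "continuous_on T (\<lambda>v. complex_of_real (w v))" for T by (intro continuous_intros wc)
    have "partial_derivs is ?P x = partial_derivs is (\<lambda>x. integral (cbox (-a) a) (?k x)) x"
      by (rule partial_derivs_cong_open[OF open_ball P x])
    also have "\<dots> = integral (cbox (-a) a) (\<lambda>v. of_real (w v) * ?D (x + v))"
      unfolding smooth_kernel_partial_derivs(1)[OF k] smooth_kernel_convolution(1)[OF s wcc] by simp
    finally have 1: "partial_derivs is ?P x = integral (cbox (-a) a) (\<lambda>v. of_real (w v) * ?D (x + v))" .
    have "bounded_linear (\<lambda>t. complex_of_real t * ?D x)"
      by (rule bounded_linear_compose[OF bounded_linear_mult_left bounded_linear_of_real])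
    from integral_linear[OF integrable_continuous[OF wc] this]
    have "integral (cbox (-a) a) (\<lambda>v. of_real (w v) * ?D x) = of_real (integral (cbox (-a) a) w) * ?D x"
      by (simp add: o_def)
    \<comment> \<open>The kernel has mass 1, so this derivative is an average of itself and the
      error becomes an average of increments.\<close>
    then have 2: "?D x = integral (cbox (-a) a) (\<lambda>v. of_real (w v) * ?D x)" by (simp add: w1)
    have "partial_derivs is (\<lambda>x. \<phi> x - ?P x) x = ?D x - partial_derivs is ?P x"
      by (simp only: partial_derivs_diff[OF s sP])
    also have "\<dots> = integral (cbox (-a) a) ?F"
      unfolding 1 by (subst 2, rule Henstock_Kurzweil_Integration.integral_diff[symmetric])
        (intro integrable_continuous continuous_on_mult wcc Dxc continuous_on_const)+
    also have "norm \<dots> \<le> integral (cbox (-a) a) (\<lambda>v. w v * (e / 2) + 2 * B * (\<gamma> ^ n / \<kappa>))"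
    proof (rule integral_norm_bound_integral)
      show "?F integrable_on cbox (-a) a"
        by (intro integrable_continuous continuous_on_mult continuous_on_diff wcc Dxc continuous_on_const)
      show "(\<lambda>v. w v * (e / 2) + 2 * B * (\<gamma> ^ n / \<kappa>)) integrable_on cbox (-a) a"
        by (intro integrable_continuous continuous_on_mult continuous_on_add wc continuous_on_const)
      fix v assume v: "v \<in> cbox (-a) a"
      have "norm (?F v) = w v * norm (?D (x + v) - ?D x)"
        using w0[of v] by (simp add: right_diff_distrib[symmetric] norm_mult norm_minus_commute)
      also have "\<dots> \<le> w v * (e / 2) + 2 * B * (\<gamma> ^ n / \<kappa>)"
      \<comment> \<open>Near the origin the increment is small, away from it the kernel is.\<close>
      proof (cases "norm v < d")
        case True
        have "(0::real^'m) \<in> cbox (-a) a" using a \<rho>0 by auto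
        have "norm (?D (x + v) - ?D (x + 0)) \<le> e / 2"
          using d0(2)[OF v \<open>0 \<in> cbox (-a) a\<close>] True d(3) isx
          unfolding deriv_bound_def partial_derivs_diff[OF sk1 sk1]
            smooth_kernel_convolution(1)[OF s continuous_on_const] by simp
        then have "w v * norm (?D (x + v) - ?D x) \<le> w v * (e / 2)" using w0 by (intro mult_left_mono) auto
        moreover have "2 * B * (\<gamma> ^ n / \<kappa>) \<ge> 0" using B \<kappa> by simp
        ultimately show ?thesis by linarith
      next
        case False
        have "norm (?D (x + v) - ?D x) \<le> B + B"
          using B(2) isx by (intro norm_triangle_le_diff add_mono) (auto simp: deriv_bound_def)
        moreover have "w v \<le> \<gamma> ^ n / \<kappa>" unfolding w_def using False by (intro conc) auto
        ultimately have "w v * norm (?D (x + v) - ?D x) \<le> (\<gamma> ^ n / \<kappa>) * (B + B)"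
          using \<kappa> by (intro mult_mono) auto
        moreover have "w v * (e / 2) \<ge> 0" using w0 e by simp
        ultimately show ?thesis by (simp add: mult_ac)
      qed
      finally show "norm (?F v) \<le> w v * (e / 2) + 2 * B * (\<gamma> ^ n / \<kappa>)" .
    qed
    also have "\<dots> = e / 2 + ?V * (2 * B * (\<gamma> ^ n / \<kappa>))"
      by (subst Henstock_Kurzweil_Integration.integral_add)
        (auto intro!: integrable_continuous continuous_on_mult wc continuous_on_const simp: w1)
    also have "?V * (2 * B * (\<gamma> ^ n / \<kappa>)) = (2 * B * ?V / \<kappa>) * \<gamma> ^ n" by simp
    also have "e / 2 + \<dots> \<le> e" using n by linarith
    finally show "norm (partial_derivs is (\<lambda>x. \<phi> x - ?P x) x) \<le> e" .
  qed
  then show ?thesis by (rule that)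
qed

text \<open>The role of the cutoff is expressed by \<open>loc\<close> and not through the support of
  u. For a difference of two distributions, to which this is applied, \<open>loc\<close> follows
  from the same property of both terms.\<close>

lemma fourier_laplace_eq_0_imp:
  fixes u :: "'m::finite functional"
  assumes u: "u \<in> tempered" and \<eta>t: "\<eta> \<in> test_functions"
    and loc: "\<And>\<phi>. \<phi> \<in> test_functions \<Longrightarrow> u (\<lambda>x. \<eta> x * \<phi> x) = u \<phi>"
    and zero: "\<And>y. fourier_laplace u \<eta> (- \<i>) y = 0" and \<phi>: "\<phi> \<in> test_functions"
  shows "u \<phi> = 0"
proof -
  note s = test_functions_smooth[OF \<phi>]
  obtain C N S where C: "C \<ge> 0" "compact S" and
    bd: "\<forall>(f :: real^'m \<Rightarrow> complex) c. smooth f \<longrightarrow> 0 \<le> c \<longrightarrow> deriv_bound N S f c \<longrightarrow> norm (u (\<lambda>x. \<eta> x * f x)) \<le> C * c"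
    using tempered_test_bound[OF u \<eta>t] by blast
  obtain R where R: "R > 0" "\<And>x. norm x \<ge> R \<Longrightarrow> \<phi> x = 0" using test_functionsE[OF \<phi>] by metis
  obtain r where r: "r > 0" "S \<subseteq> cball 0 r"
    using compact_imp_bounded[OF C(2)] by (auto simp: bounded_pos subset_iff)
  obtain b where b: "\<And>x. x \<notin> cbox (- b) b \<Longrightarrow> \<phi> x = 0" using test_functions_cbox[OF \<phi>] by metis
  define \<rho> where "\<rho> = R + r + 1"
  have null: "fourier_null u \<eta>" using zero \<eta>t by (simp add: fourier_null_def)
  have est: "norm (u \<phi>) \<le> C * e" if e: "e > 0" for e
  proof -
    obtain n c where nc: "deriv_bound N S
      (\<lambda>x. \<phi> x - c * integral (cbox (- b) b) (\<lambda>y. \<phi> y * of_real (landau \<rho> (x + (- 1) *\<^sub>R y)) ^ n)) e"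
      by (rule landau_approximation[OF \<phi> R(2,1) C(2) r(2,1) \<rho>_def b e])
    let ?k = "\<lambda>x y. \<phi> y * complex_of_real (landau \<rho> (x + (- 1) *\<^sub>R y)) ^ n"
    let ?P = "\<lambda>x. integral (cbox (- b) b) (?k x)"
    have k: "smooth_kernel (cbox (- b) b) ?k"
      by (rule smooth_kernel_convolution(2)[OF smooth_landau smooth_continuous_on[OF s]])
    have sP: "smooth ?P" by (rule smooth_kernel_smooth_integral[OF k])
    have "u (\<lambda>x. \<eta> x * ?k x y) = 0" for y
    proof -
      have "fourier_null u (\<lambda>x. \<phi> y * (\<eta> x * of_real (landau \<rho> (x - y)) ^ n))"
        by (intro fourier_null_cmult fourier_null_landau u null)
      \<comment> \<open>At frequency 0 the exponential is 1, so a vanishing transform yields a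
        vanishing value of u.\<close>
      then have "fourier_laplace u (\<lambda>x. \<phi> y * (\<eta> x * of_real (landau \<rho> (x - y)) ^ n)) (- \<i>) 0 = 0"
        by (simp add: fourier_null_def)
      then show ?thesis by (simp add: fourier_laplace_def expi_def mult_ac)
    qed
    then have "u (\<lambda>x. \<eta> x * ?P x) = 0" using tempered_integral(2)[OF u \<eta>t k] by simp
    have tP: "(\<lambda>x. \<eta> x * ?P x) \<in> schwartz" "(\<lambda>x. \<eta> x * \<phi> x) \<in> schwartz"
      by (intro test_functions_schwartz test_functions_mult \<eta>t sP s)+
    have "u (\<lambda>x. \<eta> x * (\<phi> x - c * ?P x)) = u (\<lambda>x. \<eta> x * \<phi> x - c * (\<eta> x * ?P x))"
      by (simp add: algebra_simps)
    also have "\<dots> = u (\<lambda>x. \<eta> x * \<phi> x) - c * u (\<lambda>x. \<eta> x * ?P x)"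
      using tempered_diff[OF u tP(2) schwartz_cmult[OF tP(1)]] tempered_cmult[OF u tP(1)] by simp
    also have "\<dots> = u \<phi>"
      using \<open>u (\<lambda>x. \<eta> x * ?P x) = 0\<close> loc[OF \<phi>] by simp
    finally have "u \<phi> = u (\<lambda>x. \<eta> x * (\<phi> x - c * ?P x))" by simp
    also have "norm \<dots> \<le> C * e"
      using nc e by (intro bd[rule_format] smooth_diff smooth_cmult s sP) auto
    finally show ?thesis .
  qed
  have "norm (u \<phi>) \<le> 0 + e" if "e > 0" for e
  proof -
    have "norm (u \<phi>) \<le> C * (e / (C + 1))" using that C by (intro est) (auto simp: add_nonneg_pos)
    also have "\<dots> \<le> e" using C that by (simp add: field_simps)
    finally show ?thesis by simp
  qed
  then have "norm (u \<phi>) \<le> 0" by (rule field_le_epsilon)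
  then show ?thesis by simp
qed

section \<open>Differences of distributions and injectivity\<close>

lemma schwartz_norm_mono:
  assumes "f \<in> schwartz" "M \<le> N"
  shows "\<bar>schwartz_norm M f\<bar> \<le> \<bar>schwartz_norm N f\<bar>"
proof (rule schwartz_norm_le)
  fix "is" :: "'a list" and x assume "length is \<le> M"
  then have "(1 + norm x) ^ N * norm (partial_derivs is f x) \<le> schwartz_norm N f"
    using assms by (intro schwartz_norm_upper) auto
  moreover have "(1 + norm x) ^ M * norm (partial_derivs is f x) \<le> (1 + norm x) ^ N * norm (partial_derivs is f x)"
    using assms(2) by (intro mult_right_mono power_increasing) auto
  ultimately show "(1 + norm x) ^ M * norm (partial_derivs is f x) \<le> \<bar>schwartz_norm N f\<bar>" by linarith
qed

lemma temperedI:
  assumes "\<And>\<phi> \<psi>. \<phi> \<in> schwartz \<Longrightarrow> \<psi> \<in> schwartz \<Longrightarrow> u (\<lambda>x. \<phi> x + \<psi> x) = u \<phi> + u \<psi>"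
    and "\<And>c \<phi>. \<phi> \<in> schwartz \<Longrightarrow> u (\<lambda>x. c * \<phi> x) = c * u \<phi>"
    and bd: "\<And>\<phi>. \<phi> \<in> schwartz \<Longrightarrow> norm (u \<phi>) \<le> C * \<bar>schwartz_norm N \<phi>\<bar>"
    and "\<And>\<phi>. \<phi> \<notin> schwartz \<Longrightarrow> u \<phi> = 0"
  shows "u \<in> tempered"
proof -
  have "norm (u \<phi>) \<le> C * schwartz_norm N \<phi>" if "\<phi> \<in> schwartz" for \<phi>
  proof -
    have "0 \<le> (1 + norm (0::real^'a)) ^ N * norm (partial_derivs [] \<phi> 0)" by simp
    also have "\<dots> \<le> schwartz_norm N \<phi>" by (rule schwartz_norm_upper[OF that]) simp
    finally show ?thesis using bd[OF that] by simp
  qed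
  then show ?thesis unfolding tempered_def using assms by blast
qed

lemma tempered_functional_diff:
  assumes u: "u \<in> tempered" and v: "v \<in> tempered"
  shows "(\<lambda>\<phi>. u \<phi> - v \<phi>) \<in> tempered"
proof -
  obtain C N where C: "C \<ge> 0" "\<And>f. f \<in> schwartz \<Longrightarrow> norm (u f) \<le> C * \<bar>schwartz_norm N f\<bar>"
    using tempered_normE[OF u] by metis
  obtain D M where D: "D \<ge> 0" "\<And>f. f \<in> schwartz \<Longrightarrow> norm (v f) \<le> D * \<bar>schwartz_norm M f\<bar>"
    using tempered_normE[OF v] by metis
  show ?thesis
  proof (rule temperedI)
    fix \<phi> :: "real^'a \<Rightarrow> complex" assume \<phi>: "\<phi> \<in> schwartz"
    have "norm (u \<phi> - v \<phi>) \<le> C * \<bar>schwartz_norm N \<phi>\<bar> + D * \<bar>schwartz_norm M \<phi>\<bar>"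
      by (intro norm_triangle_le_diff add_mono C D \<phi>)
    also have "\<dots> \<le> C * \<bar>schwartz_norm (max N M) \<phi>\<bar> + D * \<bar>schwartz_norm (max N M) \<phi>\<bar>"
      by (intro add_mono mult_left_mono schwartz_norm_mono \<phi> C D) auto
    finally show "norm (u \<phi> - v \<phi>) \<le> (C + D) * \<bar>schwartz_norm (max N M) \<phi>\<bar>"
      by (simp add: distrib_right)
  next
    fix \<phi> :: "real^'a \<Rightarrow> complex" assume "\<phi> \<notin> schwartz"
    then show "u \<phi> - v \<phi> = 0" using u v by (simp add: tempered_def)
  qed (simp_all add: tempered_add[OF u] tempered_add[OF v] tempered_cmult[OF u] tempered_cmult[OF v] algebra_simps)
qed

text \<open>A cutoff for both supports replaces a Schwartz function by a test function without
  changing either value, so no density argument is made. Outside \<open>schwartz\<close> both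
  functionals are 0 by normalisation.\<close>

lemma tempered_c_eqI:
  fixes u v :: "'m::finite functional"
  assumes u: "u \<in> tempered_c" and v: "v \<in> tempered_c"
    and eq: "\<And>\<phi>. \<phi> \<in> test_functions \<Longrightarrow> u \<phi> = v \<phi>"
  shows "u = v"
proof
  fix \<phi>
  have u': "u \<in> tempered" "compact (distr_support u)" and v': "v \<in> tempered" "compact (distr_support v)"
    using u v by (auto simp: tempered_c_def)
  obtain \<eta> where \<eta>: "is_cutoff (distr_support u \<union> distr_support v) \<eta>"
    using cutoff_exists[OF compact_Un[OF u'(2) v'(2)]] by blast
  show "u \<phi> = v \<phi>"
  proof (cases "\<phi> \<in> schwartz")
    case True
    have "(\<lambda>x. \<eta> x * \<phi> x) \<in> test_functions"
      by (intro test_functions_mult is_cutoff_test_function[OF \<eta>] schwartz_smooth True)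
    then show ?thesis
      using eq tempered_cutoff[OF u'(1) is_cutoff_mono[OF \<eta> Un_upper1] True]
        tempered_cutoff[OF v'(1) is_cutoff_mono[OF \<eta> Un_upper2] True] by simp
  next
    case False
    then show ?thesis using u'(1) v'(1) by (simp add: tempered_def)
  qed
qed

lemma fourier_c_injective:
  fixes u v :: "'m::finite functional"
  assumes u: "u \<in> tempered_c" and v: "v \<in> tempered_c" and eq: "fourier_c u = fourier_c v"
  shows "u = v"
proof (rule tempered_c_eqI[OF u v])
  fix \<phi> :: "real^'m \<Rightarrow> complex" assume \<phi>: "\<phi> \<in> test_functions"
  have u': "u \<in> tempered" "compact (distr_support u)" and v': "v \<in> tempered" "compact (distr_support v)"
    using u v by (auto simp: tempered_c_def)
  obtain \<eta> where \<eta>: "is_cutoff (distr_support u \<union> distr_support v) \<eta>"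
    using cutoff_exists[OF compact_Un[OF u'(2) v'(2)]] by blast
  note \<eta>u = is_cutoff_mono[OF \<eta> Un_upper1] and \<eta>v = is_cutoff_mono[OF \<eta> Un_upper2]
  have "fourier_laplace u \<eta> (- \<i>) y = fourier_laplace v \<eta> (- \<i>) y" for y
    using fun_cong[OF eq, of y] fourier_const_nonzero[where 'm = 'm]
    unfolding fourier_c_eq[OF u'(1) \<eta>u] fourier_c_eq[OF v'(1) \<eta>v] by simp
  then have "fourier_laplace (\<lambda>\<phi>. u \<phi> - v \<phi>) \<eta> (- \<i>) y = 0" for y
    by (simp add: fourier_laplace_def)
  moreover have "u (\<lambda>x. \<eta> x * \<psi> x) - v (\<lambda>x. \<eta> x * \<psi> x) = u \<psi> - v \<psi>" if "\<psi> \<in> test_functions" for \<psi>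
    using that by (simp add: tempered_cutoff[OF u'(1) \<eta>u] tempered_cutoff[OF v'(1) \<eta>v] test_functions_schwartz)
  ultimately have "u \<phi> - v \<phi> = 0"
    using fourier_laplace_eq_0_imp[OF tempered_functional_diff[OF u'(1) v'(1)] is_cutoff_test_function[OF \<eta>] _ _ \<phi>]
    by blast
  then show "u \<phi> = v \<phi>" by simp
qed

section \<open>Multiplication by a smooth function\<close>

lemma distr_mult_eq:
  assumes "h \<in> tempered_c"
  obtains \<eta> where "is_cutoff (distr_support h) \<eta>"
    "distr_mult w h = (\<lambda>\<phi>. if \<phi> \<in> schwartz then h (\<lambda>x. \<eta> x * (w x * \<phi> x)) else 0)"
proof (rule that)
  have "compact (distr_support h)" using assms by (simp add: tempered_c_def)
  then show "is_cutoff (distr_support h) (SOME \<eta>. is_cutoff (distr_support h) \<eta>)"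
    by (rule someI_ex[OF cutoff_exists])
qed (simp add: distr_mult_def Let_def)

lemma distr_mult_test_function:
  assumes h: "h \<in> tempered_c" and w: "smooth w" and \<phi>: "\<phi> \<in> test_functions"
  shows "distr_mult w h \<phi> = h (\<lambda>x. w x * \<phi> x)"
proof -
  obtain \<eta> where \<eta>: "is_cutoff (distr_support h) \<eta>" and
    eq: "distr_mult w h = (\<lambda>\<phi>. if \<phi> \<in> schwartz then h (\<lambda>x. \<eta> x * (w x * \<phi> x)) else 0)"
    by (rule distr_mult_eq[OF h])
  have "(\<lambda>x. \<phi> x * w x) \<in> schwartz"
    by (intro test_functions_schwartz test_functions_mult \<phi> w)
  then have "(\<lambda>x. w x * \<phi> x) \<in> schwartz" by (simp add: mult.commute)
  then show ?thesis
    using h tempered_cutoff[OF _ \<eta>] test_functions_schwartz[OF \<phi>] by (simp add: eq tempered_c_def)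
qed

text \<open>Continuity is the estimate for multiples of the fixed test function \<eta> w, whatever
  the growth of w, since Schwartz norms bound all derivatives involved. The support lies in that of
  \<eta>, which suffices for compactness.\<close>

lemma distr_mult_tempered_c:
  fixes h :: "'m::finite functional"
  assumes h: "h \<in> tempered_c" and w: "smooth w"
  shows "distr_mult w h \<in> tempered_c"
proof -
  have h': "h \<in> tempered" using h by (simp add: tempered_c_def)
  obtain \<eta> where \<eta>: "is_cutoff (distr_support h) \<eta>" and
    eq: "distr_mult w h = (\<lambda>\<phi>. if \<phi> \<in> schwartz then h (\<lambda>x. \<eta> x * (w x * \<phi> x)) else 0)"
    by (rule distr_mult_eq[OF h])
  have \<eta>w: "(\<lambda>x. \<eta> x * w x) \<in> test_functions"
    by (intro test_functions_mult w is_cutoff_test_function[OF \<eta>])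
  have t: "(\<lambda>x. \<eta> x * (w x * \<phi> x)) \<in> test_functions" if "smooth \<phi>" for \<phi>
    by (intro test_functions_mult smooth_mult w that is_cutoff_test_function[OF \<eta>])
  have S: "(\<lambda>x. \<eta> x * (w x * \<phi> x)) \<in> schwartz" if "\<phi> \<in> schwartz" for \<phi>
    by (intro test_functions_schwartz t schwartz_smooth that)
  obtain C N T where C: "C \<ge> 0" "compact T" and
    bd: "\<forall>(f :: real^'m \<Rightarrow> complex) c. smooth f \<longrightarrow> 0 \<le> c \<longrightarrow> deriv_bound N T f c \<longrightarrow>
      norm (h (\<lambda>x. (\<eta> x * w x) * f x)) \<le> C * c"
    using tempered_test_bound[OF h' \<eta>w] by blast
  have "distr_mult w h \<in> tempered"
  proof (rule temperedI)
    fix \<phi> \<psi> :: "real^'m \<Rightarrow> complex" assume a: "\<phi> \<in> schwartz" "\<psi> \<in> schwartz"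
    have "(\<lambda>x. \<eta> x * (w x * (\<phi> x + \<psi> x))) = (\<lambda>x. \<eta> x * (w x * \<phi> x) + \<eta> x * (w x * \<psi> x))"
      by (simp add: distrib_left)
    then show "distr_mult w h (\<lambda>x. \<phi> x + \<psi> x) = distr_mult w h \<phi> + distr_mult w h \<psi>"
      using a tempered_add[OF h' S S] by (simp add: eq schwartz_add)
  next
    fix c and \<phi> :: "real^'m \<Rightarrow> complex" assume a: "\<phi> \<in> schwartz"
    have "(\<lambda>x. \<eta> x * (w x * (c * \<phi> x))) = (\<lambda>x. c * (\<eta> x * (w x * \<phi> x)))" by (simp add: mult_ac)
    then show "distr_mult w h (\<lambda>x. c * \<phi> x) = c * distr_mult w h \<phi>"
      using a tempered_cmult[OF h' S] by (simp add: eq schwartz_cmult)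
  next
    fix \<phi> :: "real^'m \<Rightarrow> complex" assume a: "\<phi> \<in> schwartz"
    have "deriv_bound N T \<phi> \<bar>schwartz_norm N \<phi>\<bar>"
      unfolding deriv_bound_def
    proof (intro allI impI)
      fix "is" :: "'m list" and x :: "real^'m" assume "length is \<le> N"
      have "1 * norm (partial_derivs is \<phi> x) \<le> (1 + norm x) ^ N * norm (partial_derivs is \<phi> x)"
        by (intro mult_right_mono one_le_power) auto
      also have "\<dots> \<le> schwartz_norm N \<phi>" using a \<open>length is \<le> N\<close> by (rule schwartz_norm_upper)
      finally show "norm (partial_derivs is \<phi> x) \<le> \<bar>schwartz_norm N \<phi>\<bar>" by simp
    qed
    then have "norm (h (\<lambda>x. (\<eta> x * w x) * \<phi> x)) \<le> C * \<bar>schwartz_norm N \<phi>\<bar>"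
      using schwartz_smooth[OF a] by (intro bd[rule_format]) auto
    then show "norm (distr_mult w h \<phi>) \<le> C * \<bar>schwartz_norm N \<phi>\<bar>" using a by (simp add: eq mult.assoc)
  qed (simp add: eq)
  moreover have "distr_support (distr_mult w h) \<subseteq> fun_support \<eta>"
  proof -
    have "distr_mult w h \<phi> = 0" if \<phi>: "\<phi> \<in> test_functions" "fun_support \<phi> \<subseteq> - fun_support \<eta>" for \<phi>
    proof -
      have "\<eta> x * (w x * \<phi> x) = 0" for x
        using \<phi>(2) not_in_fun_support[of x \<phi>] not_in_fun_support[of x \<eta>] by auto
      then have "(\<lambda>x. \<eta> x * (w x * \<phi> x)) = (\<lambda>x. 0)" by blast
      then show ?thesis by (simp only: eq tempered_zero[OF h'] if_cancel)
    qed
    moreover have "open (- fun_support \<eta>)" by (simp add: fun_support_def open_Compl)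
    ultimately have "- fun_support \<eta> \<in> {V. open V \<and> (\<forall>\<phi>\<in>test_functions. fun_support \<phi> \<subseteq> V \<longrightarrow> distr_mult w h \<phi> = 0)}"
      by simp
    then show ?thesis unfolding distr_support_def by blast
  qed
  moreover have "compact (fun_support \<eta>)"
    using is_cutoff_test_function[OF \<eta>] by (simp add: test_functions_def)
  moreover have "closed (distr_support (distr_mult w h))"
    unfolding distr_support_def by (intro closed_Compl open_Union) auto
  ultimately show ?thesis
    using bounded_subset compact_eq_bounded_closed unfolding tempered_c_def by blast
qed

text \<open>As w has no zeros, every test function is w times another test function.\<close>

lemma distr_mult_injective:
  fixes w :: "real^'m \<Rightarrow> complex"
  assumes w: "smooth w" "\<And>x. w x \<noteq> 0" and h: "h \<in> tempered_c" and k: "k \<in> tempered_c"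
    and eq: "distr_mult w h = distr_mult w k"
  shows "h = k"
proof (rule tempered_c_eqI[OF h k])
  fix \<phi> :: "real^'m \<Rightarrow> complex" assume \<phi>: "\<phi> \<in> test_functions"
  define \<psi> where "\<psi> = (\<lambda>x. \<phi> x * inverse (w x))"
  have \<psi>: "\<psi> \<in> test_functions" unfolding \<psi>_def by (intro test_functions_mult \<phi> smooth_inverse w)
  have "(\<lambda>x. w x * \<psi> x) = \<phi>" using w(2) by (simp add: \<psi>_def fun_eq_iff)
  then show "h \<phi> = k \<phi>"
    using distr_mult_test_function[OF h w(1) \<psi>] distr_mult_test_function[OF k w(1) \<psi>] eq by simp
qed

section \<open>Entire functions of exponential type\<close>

definition exp_type :: "(complex \<Rightarrow> complex) \<Rightarrow> bool" where
  "exp_type f \<longleftrightarrow> f holomorphic_on UNIV \<and> (\<exists>C\<ge>0. \<exists>M\<ge>0. \<forall>z. norm (f z) \<le> C * exp (M * norm z))"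

lemma exp_typeI:
  assumes "f holomorphic_on UNIV" "\<And>z. norm (f z) \<le> C * exp (M * norm z)"
  shows "exp_type f"
proof -
  have "norm (f z) \<le> \<bar>C\<bar> * exp (\<bar>M\<bar> * norm z)" for z
  proof -
    have "norm (f z) \<le> C * exp (M * norm z)" by (rule assms)
    also have "\<dots> \<le> \<bar>C\<bar> * exp (\<bar>M\<bar> * norm z)"
      by (intro mult_mono) (auto intro: mult_right_mono)
    finally show ?thesis .
  qed
  then show ?thesis using assms(1) unfolding exp_type_def by (meson abs_ge_zero)
qed

lemma exp_type_holomorphic: "exp_type f \<Longrightarrow> f holomorphic_on UNIV"
  by (simp add: exp_type_def)

lemma exp_typeE:
  assumes "exp_type f"
  obtains C M where "C \<ge> 0" "M \<ge> 0" "\<And>z. norm (f z) \<le> C * exp (M * norm z)"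
  using assms unfolding exp_type_def by blast

lemma exp_type_mult:
  assumes "exp_type f" "exp_type g"
  shows "exp_type (\<lambda>z. f z * g z)"
proof -
  obtain C M where C: "C \<ge> 0" "\<And>z. norm (f z) \<le> C * exp (M * norm z)" using exp_typeE[OF assms(1)] by metis
  obtain D L where D: "D \<ge> 0" "\<And>z. norm (g z) \<le> D * exp (L * norm z)" using exp_typeE[OF assms(2)] by metis
  show ?thesis
  proof (rule exp_typeI)
    show "(\<lambda>z. f z * g z) holomorphic_on UNIV"
      by (intro holomorphic_on_mult exp_type_holomorphic assms)
    fix z
    have "norm (f z * g z) \<le> (C * exp (M * norm z)) * (D * exp (L * norm z))"
      unfolding norm_mult by (intro mult_mono C D) (use C in auto)
    moreover have "exp ((M + L) * norm z) = exp (M * norm z) * exp (L * norm z)"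
      by (simp add: distrib_right exp_add)
    ultimately show "norm (f z * g z) \<le> (C * D) * exp ((M + L) * norm z)"
      by (simp add: mult_ac)
  qed
qed

lemma exp_type_add:
  assumes "exp_type f" "exp_type g"
  shows "exp_type (\<lambda>z. f z + g z)"
proof -
  obtain C M where C: "C \<ge> 0" "M \<ge> 0" "\<And>z. norm (f z) \<le> C * exp (M * norm z)" using exp_typeE[OF assms(1)] by metis
  obtain D L where D: "D \<ge> 0" "L \<ge> 0" "\<And>z. norm (g z) \<le> D * exp (L * norm z)" using exp_typeE[OF assms(2)] by metis
  show ?thesis
  proof (rule exp_typeI)
    show "(\<lambda>z. f z + g z) holomorphic_on UNIV"
      by (intro holomorphic_on_add exp_type_holomorphic assms)
    fix z
    have "norm (f z + g z) \<le> C * exp (M * norm z) + D * exp (L * norm z)"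
      by (intro norm_triangle_mono C D)
    also have "\<dots> \<le> C * exp ((M + L) * norm z) + D * exp ((M + L) * norm z)"
      using C D by (intro add_mono mult_left_mono) (auto intro!: mult_right_mono)
    finally show "norm (f z + g z) \<le> (C + D) * exp ((M + L) * norm z)"
      by (simp add: distrib_right)
  qed
qed

lemma exp_type_exp: "exp_type (\<lambda>z. exp (c + d * z))"
proof (rule exp_typeI)
  show "(\<lambda>z. exp (c + d * z)) holomorphic_on UNIV" by (intro holomorphic_intros)
  fix z
  have "norm (exp (c + d * z)) = exp (Re c) * exp (Re (d * z))" by (simp add: exp_add norm_mult)
  also have "\<dots> \<le> exp (Re c) * exp (norm d * norm z)"
    using complex_Re_le_cmod[of "d * z"] by (simp add: norm_mult)
  finally show "norm (exp (c + d * z)) \<le> exp (Re c) * exp (norm d * norm z)" .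
qed

lemma exp_type_const: "exp_type (\<lambda>z. c)"
  by (rule exp_typeI[of _ "norm c" 0]) auto

lemma exp_type_minus: "exp_type f \<Longrightarrow> exp_type (\<lambda>z. - f z)"
  using exp_type_mult[OF exp_type_const[of "-1"]] by simp

lemma exp_type_diff: "exp_type f \<Longrightarrow> exp_type g \<Longrightarrow> exp_type (\<lambda>z. f z - g z)"
  using exp_type_add[OF _ exp_type_minus, of f g] by simp

text \<open>On the real axis this is the conjugate of f, so that squared moduli there extend to
  entire functions.\<close>

lemma exp_type_cnj:
  assumes "exp_type f"
  shows "exp_type (\<lambda>z. cnj (f (cnj z)))"
proof -
  obtain C M where C: "\<And>z. norm (f z) \<le> C * exp (M * norm z)" using exp_typeE[OF assms] by metis
  show ?thesis
  proof (rule exp_typeI)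
    show "(\<lambda>z. cnj (f (cnj z))) holomorphic_on UNIV"
    proof -
      have "range cnj = UNIV" by (metis complex_cnj_cnj surj_def)
      then show ?thesis
        using holomorphic_on_compose_cnj_cnj[of f UNIV] exp_type_holomorphic[OF assms] by (simp add: o_def)
    qed
    show "norm (cnj (f (cnj z))) \<le> C * exp (M * norm z)" for z using C[of "cnj z"] by simp
  qed
qed

text \<open>If f is not identically 0, then g vanishes on a nonempty open set, hence
  everywhere.\<close>

lemma entire_mult_eq_0:
  assumes "f holomorphic_on UNIV" "g holomorphic_on UNIV" "\<And>z. f z * g z = 0"
  shows "(\<forall>z. f z = 0) \<or> (\<forall>z. g z = 0)"
proof (rule ccontr)
  assume "\<not> ?thesis"
  then obtain z0 z1 where z: "f z0 \<noteq> 0" "g z1 \<noteq> 0" by blast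
  let ?S = "{z. f z \<noteq> 0}"
  have "continuous_on UNIV f" using assms(1) by (rule holomorphic_on_imp_continuous_on)
  then have "open ?S" by (auto intro!: open_Collect_neq continuous_intros)
  have "g z1 = (\<lambda>_. 0) z1"
  proof (rule analytic_continuation_open[of ?S UNIV g "\<lambda>_. 0"])
    show "?S \<noteq> {}" using z by blast
    show "g z = 0" if "z \<in> ?S" for z using assms(3)[of z] that by simp
  qed (use \<open>open ?S\<close> assms in auto)
  with z show False by simp
qed

lemma entire_prod_eq_0:
  assumes "finite I" "\<And>i. i \<in> I \<Longrightarrow> f i holomorphic_on UNIV" "\<And>z. (\<Prod>i\<in>I. f i z) = 0"
  shows "\<exists>i\<in>I. \<forall>z. f i z = 0"
  using assms
proof (induction I rule: finite_induct)
  case (insert i I)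
  have "(\<lambda>z. \<Prod>i\<in>I. f i z) holomorphic_on UNIV"
    by (intro holomorphic_on_prod insert.prems) auto
  moreover have "f i z * (\<Prod>i\<in>I. f i z) = 0" for z using insert.prems(2)[of z] insert.hyps by simp
  ultimately consider "\<forall>z. f i z = 0" | "\<forall>z. (\<Prod>i\<in>I. f i z) = 0"
    using entire_mult_eq_0[of "f i"] insert.prems(1) by blast
  then show ?case
  proof cases
    case 2
    then have "\<exists>i\<in>I. \<forall>z. f i z = 0" using insert.prems by (intro insert.IH) auto
    then show ?thesis by blast
  qed auto
qed auto

lemma entire_eq_0_real:
  assumes "f holomorphic_on UNIV" "e > 0" "\<And>t::real. \<bar>t\<bar> < e \<Longrightarrow> f (of_real t) = 0"
  shows "f z = 0"
proof (rule analytic_continuation[of f UNIV "of_real ` {t. \<bar>t\<bar> < e}" 0])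
  show "0 islimpt (of_real ` {t. \<bar>t\<bar> < e} :: complex set)"
    unfolding islimpt_approachable
  proof (intro allI impI)
    fix d :: real assume "d > 0"
    then have "\<bar>min d e / 2\<bar> < e" "\<bar>min d e / 2\<bar> < d" "min d e / 2 \<noteq> 0" using assms(2) by auto
    then have "complex_of_real (min d e / 2) \<in> of_real ` {t. \<bar>t\<bar> < e}"
      "complex_of_real (min d e / 2) \<noteq> 0" "dist (complex_of_real (min d e / 2)) 0 < d"
      by (simp_all only: imageI mem_Collect_eq of_real_eq_0_iff dist_0_norm norm_of_real dist_commute[of _ 0]) simp_all
    then show "\<exists>x'\<in>of_real ` {t. \<bar>t\<bar> < e}. x' \<noteq> 0 \<and> dist x' (0::complex) < d" by blast
  qed
qed (use assms in auto)

text \<open>Finitely many rotations of a sector cover the plane, so the product of the correspondingly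
  rotated copies of \<open>f\<close> tends to 0 at infinity and Liouville's theorem applies.\<close>

lemma entire_eq_0_sector:
  assumes f: "f holomorphic_on UNIV" "\<And>z. norm (f z) \<le> C * exp (M * norm z)"
    and w0: "norm w0 = 1" and e: "e > 0" and d: "d > 0"
    and sector: "\<And>s r. norm s = 1 \<Longrightarrow> norm (s - w0) < e \<Longrightarrow> r \<ge> 0 \<Longrightarrow>
      norm (f (of_real r * s)) \<le> D * exp (L * r - d * r ^ 2)"
  shows "f z = 0"
proof -
  \<comment> \<open>The directions that multiplication by \<open>\<omega>\<close> carries into the
    sector. A unit s is carried onto \<open>w0\<close> itself by \<open>w0 / s\<close>, and
    compactness of the circle leaves finitely many rotations.\<close>
  let ?T = "\<lambda>\<omega>::complex. {s. norm (\<omega> * s - w0) < e}"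
  have "open (?T \<omega>)" for \<omega> by (intro open_Collect_less continuous_intros)
  moreover have "sphere 0 1 \<subseteq> (\<Union>\<omega>\<in>sphere 0 1. ?T \<omega>)"
  proof
    fix s :: complex assume s: "s \<in> sphere 0 1"
    then have "s \<noteq> 0" by auto
    then have "s \<in> ?T (w0 / s)" "w0 / s \<in> sphere 0 1" using e w0 s by (auto simp: norm_divide)
    then show "s \<in> (\<Union>\<omega>\<in>sphere 0 1. ?T \<omega>)" by blast
  qed
  ultimately obtain \<Omega> where \<Omega>: "\<Omega> \<subseteq> sphere 0 1" "finite \<Omega>" "sphere 0 1 \<subseteq> (\<Union>\<omega>\<in>\<Omega>. ?T \<omega>)"
    using compactE_image[of "sphere 0 1" "sphere 0 1" ?T] by auto
  define h where "h = (\<lambda>z. \<Prod>\<omega>\<in>\<Omega>. f (\<omega> * z))"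
  have fh: "(\<lambda>z. f (\<omega> * z)) holomorphic_on UNIV" for \<omega>
    using holomorphic_on_compose_gen[of "\<lambda>z. \<omega> * z" UNIV f UNIV] f(1) by (simp add: o_def holomorphic_intros)
  have hh: "h holomorphic_on UNIV" unfolding h_def by (intro holomorphic_on_prod fh)
  define A where "A = max \<bar>C\<bar> \<bar>D\<bar>"
  define B where "B = max \<bar>M\<bar> \<bar>L\<bar>"
  have A: "A \<ge> 0" "\<bar>C\<bar> \<le> A" "\<bar>D\<bar> \<le> A" and B: "M \<le> B" "L \<le> B" by (auto simp: A_def B_def)
  have bound: "norm (h z) \<le> A ^ card \<Omega> * exp (real (card \<Omega>) * B * norm z - d * norm z ^ 2)" if "z \<noteq> 0" for z
  proof -
    define r where "r = norm z"
    define s where "s = z / of_real r"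
    have r: "r > 0" and s: "norm s = 1" and z: "z = of_real r * s"
      using that by (auto simp: r_def s_def norm_divide)
    obtain \<omega>0 where \<omega>0: "\<omega>0 \<in> \<Omega>" "norm (\<omega>0 * s - w0) < e" using \<Omega>(3) s by auto
    \<comment> \<open>One factor alone supplies the Gaussian. The other factors add to the linear
      exponent but leave d as it is.\<close>
    let ?b = "\<lambda>\<omega>. A * exp (B * r) * (if \<omega> = \<omega>0 then exp (- (d * r ^ 2)) else 1)"
    have "norm (f (\<omega> * z)) \<le> ?b \<omega>" if "\<omega> \<in> \<Omega>" for \<omega>
    proof (cases "\<omega> = \<omega>0")
      case True
      have "norm \<omega>0 = 1" using \<omega>0 \<Omega>(1) by auto
      then have "norm (f (of_real r * (\<omega>0 * s))) \<le> D * exp (L * r - d * r ^ 2)"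
        using \<omega>0 s r by (intro sector) (auto simp: norm_mult)
      also have "\<dots> \<le> A * exp (B * r - d * r ^ 2)"
        using A B r by (intro mult_mono) (auto intro!: mult_right_mono)
      also have "\<dots> = ?b \<omega>" using True by (simp add: exp_diff exp_minus divide_inverse)
      finally show ?thesis using True by (simp add: z mult_ac)
    next
      case False
      have "norm \<omega> = 1" using that \<Omega>(1) by auto
      then have "norm (f (\<omega> * z)) \<le> C * exp (M * r)" using f(2)[of "\<omega> * z"] by (simp add: norm_mult r_def)
      also have "\<dots> \<le> A * exp (B * r)" using A B r by (intro mult_mono) (auto intro!: mult_right_mono)
      finally show ?thesis using False by simp
    qed
    then have "(\<Prod>\<omega>\<in>\<Omega>. norm (f (\<omega> * z))) \<le> (\<Prod>\<omega>\<in>\<Omega>. ?b \<omega>)" by (intro prod_mono) auto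
    also have "\<dots> = (A * exp (B * r)) ^ card \<Omega> * exp (- (d * r ^ 2))"
      using \<omega>0(1) \<Omega>(2) by (simp add: prod.distrib prod.delta)
    also have "\<dots> = A ^ card \<Omega> * exp (real (card \<Omega>) * B * r - d * r ^ 2)"
      by (simp add: power_mult_distrib exp_diff exp_minus divide_inverse exp_of_nat_mult mult.assoc)
    finally show ?thesis by (simp add: h_def prod_norm r_def)
  qed
  have lim: "((\<lambda>r. A ^ card \<Omega> * exp (a * r - d * r ^ 2)) \<longlongrightarrow> 0) at_top" for a
  proof -
    have "filterlim (\<lambda>r. - a + d * r) at_top at_top"
      by (intro filterlim_tendsto_add_at_top[OF tendsto_const]
          filterlim_tendsto_pos_mult_at_top[OF tendsto_const d] filterlim_ident)
    then have "filterlim (\<lambda>r. r * (- a + d * r)) at_top at_top"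
      by (intro filterlim_at_top_mult_at_top filterlim_ident)
    then have "filterlim (\<lambda>r. - (r * (- a + d * r))) at_bot at_top"
      by (simp add: filterlim_uminus_at_top)
    moreover have "(\<lambda>r. - (r * (- a + d * r))) = (\<lambda>r. a * r - d * r ^ 2)"
      by (auto simp: algebra_simps power2_eq_square)
    ultimately have "((\<lambda>r. exp (a * r - d * r ^ 2)) \<longlongrightarrow> 0) at_top"
      by (metis (mono_tags) filterlim_compose[OF exp_at_bot])
    then show ?thesis by (rule tendsto_mult_right_zero)
  qed
  have "(h \<longlongrightarrow> 0) at_infinity"
  proof (rule Lim_null_comparison)
    show "\<forall>\<^sub>F z in at_infinity. norm (h z) \<le> A ^ card \<Omega> * exp (real (card \<Omega>) * B * norm z - d * norm z ^ 2)"
      using eventually_not_equal_at_infinity[of 0] by eventually_elim (rule bound)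
    show "((\<lambda>z::complex. A ^ card \<Omega> * exp (real (card \<Omega>) * B * norm z - d * norm z ^ 2)) \<longlongrightarrow> 0) at_infinity"
      by (rule filterlim_compose[OF lim filterlim_norm_at_top])
  qed
  then have "h z = 0" for z by (rule Liouville_weak_0[OF hh])
  then obtain \<omega> where \<omega>: "\<omega> \<in> \<Omega>" "\<And>z. f (\<omega> * z) = 0"
    using entire_prod_eq_0[OF \<Omega>(2), of "\<lambda>\<omega> z. f (\<omega> * z)"] fh unfolding h_def by blast
  have "\<omega> \<noteq> 0" using \<omega>(1) \<Omega>(1) by auto
  then show ?thesis using \<omega>(2)[of "z / \<omega>"] by simp
qed

text \<open>In a sector around a direction \<open>w0\<close> with \<open>w0\<^sup>2 = \<mp> \<i>\<close> the first Gaussian factor grows while the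
  quotient of the second by the first decays; hence \<open>f\<close> decays like a Gaussian there.\<close>

lemma exp_type_gaussian_combination:
  assumes \<beta>: "\<beta> \<notin> \<real>" and f: "exp_type f" and g: "exp_type g" and k: "exp_type k"
    and eq: "\<And>z. f z * exp (\<beta> * z ^ 2) + g z * exp (cnj \<beta> * z ^ 2) = k z"
  shows "f z = 0"
proof -
  define b where "b = Im \<beta>"
  have b: "b \<noteq> 0" using \<beta> by (simp add: b_def complex_is_Real_iff)
  \<comment> \<open>In this direction \<beta> z^2 has real part |b| and (cnj \<beta> - \<beta>) z^2
    has real part - 2 |b|.\<close>
  define w0 where "w0 = csqrt (- \<i> * of_real (sgn b))"
  have w2: "w0 ^ 2 = - \<i> * of_real (sgn b)" by (simp add: w0_def)
  then have "norm w0 ^ 2 = 1" using b by (simp add: norm_power[symmetric] norm_mult sgn_if)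
  then have w0: "norm w0 = 1" by (simp add: power2_eq_1_iff)
      (metis norm_ge_zero not_one_le_zero neg_0_le_iff_le)
  \<comment> \<open>Half of |b| keeps both inequalities at \<open>w0\<close> strict, so they persist
    nearby by continuity.\<close>
  define d where "d = \<bar>b\<bar> / 2"
  have d: "d > 0" using b by (simp add: d_def)
  have w0d: "Re (\<beta> * w0 ^ 2) > d" "Re ((cnj \<beta> - \<beta>) * w0 ^ 2) < - d"
    using b by (auto simp: w2 d_def b_def sgn_if)
  have T: "((\<lambda>s. Re (\<gamma> * s ^ 2)) \<longlongrightarrow> Re (\<gamma> * w0 ^ 2)) (nhds w0)" for \<gamma>
    by (intro tendsto_intros filterlim_ident)
  have "\<forall>\<^sub>F s in nhds w0. Re (\<beta> * s ^ 2) > d" "\<forall>\<^sub>F s in nhds w0. Re ((cnj \<beta> - \<beta>) * s ^ 2) < - d"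
    using order_tendstoD(1)[OF T w0d(1)] order_tendstoD(2)[OF T w0d(2)] by blast+
  then have "\<forall>\<^sub>F s in nhds w0. Re (\<beta> * s ^ 2) > d \<and> Re ((cnj \<beta> - \<beta>) * s ^ 2) < - d"
    by (rule eventually_conj)
  then obtain e where e: "e > 0" "\<And>s. norm (s - w0) < e \<Longrightarrow> Re (\<beta> * s ^ 2) > d \<and> Re ((cnj \<beta> - \<beta>) * s ^ 2) < - d"
    by (auto simp: eventually_nhds_metric dist_norm)
  obtain C M where C: "C \<ge> 0" "M \<ge> 0" "\<And>z. norm (k z) \<le> C * exp (M * norm z)" using exp_typeE[OF k] by metis
  obtain D L where D: "D \<ge> 0" "L \<ge> 0" "\<And>z. norm (g z) \<le> D * exp (L * norm z)" using exp_typeE[OF g] by metis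
  obtain A B where A: "\<And>z. norm (f z) \<le> A * exp (B * norm z)" using exp_typeE[OF f] by metis
  show ?thesis
  proof (rule entire_eq_0_sector[OF exp_type_holomorphic[OF f] A w0 e(1) d])
    fix s :: complex and r :: real
    assume s: "norm s = 1" "norm (s - w0) < e" and r: "r \<ge> 0"
    let ?z = "of_real r * s"
    have nz: "norm ?z = r" using s r by (simp add: norm_mult)
    have re: "Re (\<gamma> * ?z ^ 2) = r ^ 2 * Re (\<gamma> * s ^ 2)" for \<gamma>
    proof -
      have "\<gamma> * ?z ^ 2 = of_real (r ^ 2) * (\<gamma> * s ^ 2)" by (simp add: power_mult_distrib mult_ac)
      moreover have "Re (of_real c * w) = c * Re w" for c w by simp
      ultimately show ?thesis by metis
    qed
    \<comment> \<open>The identity is solved for f by dividing by the growing Gaussian.\<close>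
    have "f ?z = (f ?z * exp (\<beta> * ?z ^ 2)) * exp (- \<beta> * ?z ^ 2)"
      by (simp add: mult.assoc exp_add[symmetric])
    also have "\<dots> = (k ?z - g ?z * exp (cnj \<beta> * ?z ^ 2)) * exp (- \<beta> * ?z ^ 2)"
      by (simp add: eq[symmetric])
    also have "\<dots> = k ?z * exp (- \<beta> * ?z ^ 2) - g ?z * exp ((cnj \<beta> - \<beta>) * ?z ^ 2)"
      by (simp add: left_diff_distrib mult.assoc exp_add[symmetric])
    finally have "norm (f ?z) \<le> norm (k ?z) * exp (Re (- \<beta> * ?z ^ 2)) + norm (g ?z) * exp (Re ((cnj \<beta> - \<beta>) * ?z ^ 2))"
      by (metis norm_triangle_ineq4 norm_mult norm_exp_eq_Re)
    also have "\<dots> \<le> (C * exp (M * r)) * exp (- (d * r ^ 2)) + (D * exp (L * r)) * exp (- (d * r ^ 2))"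
    proof (intro add_mono mult_mono)
      show "norm (k ?z) \<le> C * exp (M * r)" using C(3)[of ?z] by (simp add: nz)
      show "norm (g ?z) \<le> D * exp (L * r)" using D(3)[of ?z] by (simp add: nz)
      have "d \<le> Re (\<beta> * s ^ 2)" "Re ((cnj \<beta> - \<beta>) * s ^ 2) \<le> - d"
        using e(2)[OF s(2)] less_imp_le by blast+
      then have "r ^ 2 * d \<le> r ^ 2 * Re (\<beta> * s ^ 2)" "r ^ 2 * Re ((cnj \<beta> - \<beta>) * s ^ 2) \<le> r ^ 2 * (- d)"
        using mult_left_mono[OF _ zero_le_power2] by blast+
      then show "exp (Re (- \<beta> * ?z ^ 2)) \<le> exp (- (d * r ^ 2))"
        "exp (Re ((cnj \<beta> - \<beta>) * ?z ^ 2)) \<le> exp (- (d * r ^ 2))"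
        unfolding mult_minus_left uminus_complex.simps re exp_le_cancel_iff
        by (simp_all only: mult.commute[of d] mult_minus_right neg_le_iff_le)
    qed (use C D in auto)
    also have "\<dots> \<le> (C * exp ((M + L) * r)) * exp (- (d * r ^ 2)) + (D * exp ((M + L) * r)) * exp (- (d * r ^ 2))"
      using C D r by (intro add_mono mult_right_mono mult_left_mono) (auto intro!: mult_right_mono)
    also have "\<dots> = (C + D) * exp ((M + L) * r - d * r ^ 2)"
      by (simp add: distrib_right exp_diff exp_minus divide_inverse mult.assoc)
    finally show "norm (f ?z) \<le> (C + D) * exp ((M + L) * r - d * r ^ 2)" .
  qed
qed

section \<open>Phase retrieval\<close>

text \<open>The polynomial in t is the squared norm along a line. The weight s treats both operators
  at once: 0 stands for \<open>F_op\<close>, 1 for \<open>F_lin\<close>.\<close>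

lemma phase_retrieval_line:
  assumes P: "exp_type P" "P 0 \<noteq> 0" and A: "exp_type A" and B: "exp_type B"
    and \<alpha>: "\<alpha> \<notin> \<real>" and c2: "c2 \<noteq> (0::real)" and \<epsilon>: "\<epsilon> > 0"
    and eq: "\<And>t::real. \<bar>t\<bar> < \<epsilon> \<Longrightarrow>
      (cmod (P (of_real t) * exp (\<alpha> * of_real (c0 + c1 * t + c2 * t\<^sup>2)) + A (of_real t)))\<^sup>2 - s * (cmod (A (of_real t)))\<^sup>2 =
      (cmod (P (of_real t) * exp (\<alpha> * of_real (c0 + c1 * t + c2 * t\<^sup>2)) + B (of_real t)))\<^sup>2 - s * (cmod (B (of_real t)))\<^sup>2"
  shows "A z = B z"
proof -
  define Ps where "Ps = (\<lambda>z. cnj (P (cnj z)))"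
  define As where "As = (\<lambda>z. cnj (A (cnj z)))"
  define Bs where "Bs = (\<lambda>z. cnj (B (cnj z)))"
  have Ps: "exp_type Ps" and As: "exp_type As" and Bs: "exp_type Bs"
    unfolding Ps_def As_def Bs_def by (intro exp_type_cnj P A B)+
  define \<beta> where "\<beta> = \<alpha> * of_real c2"
  have \<beta>: "\<beta> \<notin> \<real>" using \<alpha> c2 by (simp add: \<beta>_def complex_is_Real_iff)
  \<comment> \<open>The mixed terms of the expanded squares yield f and g. The constant and linear
    parts of the phase give factors of exponential type and are put into them, so that only t^2
    remains in the Gaussian. The pure squares of A and B form k.\<close>
  define f where "f = (\<lambda>z. P z * (As z - Bs z) * exp (\<alpha> * of_real c0 + (\<alpha> * of_real c1) * z))"
  define g where "g = (\<lambda>z. Ps z * (A z - B z) * exp (cnj \<alpha> * of_real c0 + (cnj \<alpha> * of_real c1) * z))"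
  define k where "k = (\<lambda>z. of_real (1 - s) * (B z * Bs z - A z * As z))"
  have f: "exp_type f" unfolding f_def by (intro exp_type_mult exp_type_diff exp_type_exp P As Bs)
  have g: "exp_type g" unfolding g_def by (intro exp_type_mult exp_type_diff exp_type_exp Ps A B)
  have k: "exp_type k" unfolding k_def by (intro exp_type_mult exp_type_diff exp_type_const As Bs A B)
  \<comment> \<open>The identity is given for small real t only; as H is entire, it extends to the
    plane.\<close>
  define H where "H = (\<lambda>z. f z * exp (\<beta> * z ^ 2) + g z * exp (cnj \<beta> * z ^ 2) - k z)"
  have H: "H z = 0" for z
  proof (rule entire_eq_0_real[where f = H, OF _ \<epsilon>])
    have "(\<lambda>z. exp (\<gamma> * z ^ 2)) holomorphic_on UNIV" for \<gamma> by (intro holomorphic_intros)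
    then show "H holomorphic_on UNIV"
      unfolding H_def
      by (intro holomorphic_on_diff holomorphic_on_add holomorphic_on_mult exp_type_holomorphic[OF f]
          exp_type_holomorphic[OF g] exp_type_holomorphic[OF k])
    fix t :: real assume t: "\<bar>t\<bar> < \<epsilon>"
    let ?T = "complex_of_real t"
    let ?q = "c0 + c1 * t + c2 * t\<^sup>2"
    define e where "e = exp (\<alpha> * of_real ?q)"
    have e1: "exp (\<alpha> * of_real c0 + (\<alpha> * of_real c1) * ?T) * exp (\<beta> * ?T ^ 2) = e"
      by (simp add: e_def \<beta>_def exp_add[symmetric] algebra_simps)
    have "cnj e = exp (cnj \<alpha> * of_real ?q)" by (simp add: e_def exp_cnj)
    then have e2: "exp (cnj \<alpha> * of_real c0 + (cnj \<alpha> * of_real c1) * ?T) * exp (cnj \<beta> * ?T ^ 2) = cnj e"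
      by (simp add: \<beta>_def exp_add[symmetric] algebra_simps)
    have sq: "complex_of_real ((cmod x)\<^sup>2) = x * cnj x" for x
      by (rule complex_norm_square)
    from arg_cong[OF eq[OF t], of complex_of_real]
    have "(P ?T * e + A ?T) * cnj (P ?T * e + A ?T) - of_real s * (A ?T * cnj (A ?T)) =
      (P ?T * e + B ?T) * cnj (P ?T * e + B ?T) - of_real s * (B ?T * cnj (B ?T))"
      unfolding e_def[symmetric] of_real_diff of_real_mult sq .
    then have "P ?T * (cnj (A ?T) - cnj (B ?T)) * e + cnj (P ?T) * (A ?T - B ?T) * cnj e =
      of_real (1 - s) * (B ?T * cnj (B ?T) - A ?T * cnj (A ?T))"
      by (simp add: algebra_simps)
    then have "P ?T * (As ?T - Bs ?T) * e + Ps ?T * (A ?T - B ?T) * cnj e = k ?T"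
      by (simp add: k_def As_def Bs_def Ps_def)
    moreover have "f ?T * exp (\<beta> * ?T ^ 2) = P ?T * (As ?T - Bs ?T) * e"
      unfolding f_def e1[symmetric] by (simp only: mult.assoc)
    moreover have "g ?T * exp (cnj \<beta> * ?T ^ 2) = Ps ?T * (A ?T - B ?T) * cnj e"
      unfolding g_def e2[symmetric] by (simp only: mult.assoc)
    ultimately show "H ?T = 0" by (simp add: H_def)
  qed
  have "f z = 0" for z
    by (rule exp_type_gaussian_combination[OF \<beta> f g k]) (use H in \<open>simp add: H_def\<close>)
  then have "P z * (As z - Bs z) = 0" for z by (simp add: f_def)
  then have "(\<forall>z. P z = 0) \<or> (\<forall>z. As z - Bs z = 0)"
    by (intro entire_mult_eq_0 exp_type_holomorphic P exp_type_diff As Bs)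
  then have "As (cnj z) = Bs (cnj z)" using P(2) by auto
  then show ?thesis by (simp add: As_def Bs_def)
qed

text \<open>The exponential at the base point a is absorbed into the test function. What remains is
  entire in the multiple of b, evaluated at - \<i> z.\<close>

lemma fourier_c_line:
  fixes u :: "'m::finite functional"
  assumes "u \<in> tempered_c"
  shows "\<exists>E. exp_type E \<and> (\<forall>t. E (of_real t) = fourier_c u (a + t *\<^sub>R b))"
proof -
  have u: "u \<in> tempered" "compact (distr_support u)" using assms by (auto simp: tempered_c_def)
  obtain \<eta> where \<eta>: "is_cutoff (distr_support u) \<eta>" using cutoff_exists[OF u(2)] by blast
  let ?g = "\<lambda>x. \<eta> x * expi (- \<i>) a x"
  have g: "?g \<in> test_functions"
    by (intro test_functions_mult is_cutoff_test_function[OF \<eta>] smooth_expi)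
  define G where "G = (\<lambda>z. u (\<lambda>x. ?g x * expi z b x))"
  have G: "G holomorphic_on UNIV" "\<exists>C M. \<forall>z. norm (G z) \<le> C * exp (M * norm z)"
    unfolding G_def by (rule fourier_laplace_entire[OF u(1) g])+
  obtain C M where C: "\<And>z. norm (G z) \<le> C * exp (M * norm z)" using G(2) by blast
  have "exp_type (\<lambda>z. G (- \<i> * z))"
  proof (rule exp_typeI)
    show "(\<lambda>z. G (- \<i> * z)) holomorphic_on UNIV"
      using holomorphic_on_compose_gen[of "\<lambda>z. - \<i> * z" UNIV G UNIV] G(1) by (simp add: o_def holomorphic_intros)
    show "norm (G (- \<i> * z)) \<le> C * exp (M * norm z)" for z using C[of "- \<i> * z"] by (simp add: norm_mult)
  qed
  then have "exp_type (\<lambda>z. fourier_const TYPE('m) * G (- \<i> * z))"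
    by (intro exp_type_mult exp_type_const)
  moreover have "fourier_const TYPE('m) * G (- \<i> * of_real t) = fourier_c u (a + t *\<^sub>R b)" for t
  proof -
    have "expi (- \<i>) (a + t *\<^sub>R b) x = expi (- \<i>) a x * expi (- \<i> * of_real t) b x" for x
      unfolding expi_add by (simp add: expi_def mult.assoc)
    then show ?thesis
      by (simp add: fourier_c_eq[OF u(1) \<eta>] fourier_laplace_def G_def mult.assoc)
  qed
  ultimately show ?thesis by blast
qed

lemma open_line:
  fixes a b :: "'a::real_normed_vector"
  assumes "open U" "a \<in> U"
  shows "\<exists>\<epsilon>>0. \<forall>t. \<bar>t\<bar> < \<epsilon> \<longrightarrow> a + t *\<^sub>R b \<in> U"
proof -
  have "open ((\<lambda>t::real. a + t *\<^sub>R b) -` U)"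
    by (intro open_vimage assms continuous_intros)
  moreover have "0 \<in> (\<lambda>t::real. a + t *\<^sub>R b) -` U" using assms by simp
  ultimately obtain \<epsilon> where "\<epsilon> > 0" "\<forall>t. dist t 0 < \<epsilon> \<longrightarrow> t \<in> (\<lambda>t::real. a + t *\<^sub>R b) -` U"
    unfolding open_dist by blast
  then show ?thesis by (intro exI[of _ \<epsilon>]) (simp add: dist_norm)
qed

lemma zero_tempered_c: "((\<lambda>_. 0) :: 'm::finite functional) \<in> tempered_c"
proof -
  have "((\<lambda>_. 0) :: 'm functional) \<in> tempered" by (rule temperedI[where C = 0]) auto
  moreover have "distr_support ((\<lambda>_. 0) :: 'm functional) = {}" by (auto simp: distr_support_def)
  ultimately show ?thesis by (simp add: tempered_c_def)
qed

text \<open>Every \<xi> lies on a line through a point of U. The entire extension along it vanishes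
  near t = 0, hence also at t = 1, which is \<xi>.\<close>

lemma fourier_c_eq_0_open:
  fixes p :: "'m::finite functional"
  assumes p: "p \<in> tempered_c" and U: "open U" "U \<noteq> {}" and zero: "\<And>\<xi>. \<xi> \<in> U \<Longrightarrow> fourier_c p \<xi> = 0"
  shows "p = (\<lambda>_. 0)"
proof (rule fourier_c_injective[OF p zero_tempered_c])
  obtain a where a: "a \<in> U" using U(2) by blast
  have "fourier_c p \<xi> = 0" for \<xi>
  proof -
    obtain E where E: "exp_type E" "\<And>t. E (of_real t) = fourier_c p (a + t *\<^sub>R (\<xi> - a))"
      using fourier_c_line[OF p] by blast
    obtain \<epsilon> where \<epsilon>: "\<epsilon> > 0" "\<And>t. \<bar>t\<bar> < \<epsilon> \<Longrightarrow> a + t *\<^sub>R (\<xi> - a) \<in> U"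
      using open_line[OF U(1) a] by blast
    have "E (of_real 1) = 0"
      by (rule entire_eq_0_real[OF exp_type_holomorphic[OF E(1)] \<epsilon>(1)]) (simp only: E(2) zero \<epsilon>(2))
    then show ?thesis by (simp only: E(2)) simp
  qed
  moreover have "fourier_c (\<lambda>_. 0) \<xi> = 0" for \<xi> :: "real^'m"
  proof -
    have z: "((\<lambda>_. 0) :: 'm functional) \<in> tempered" "compact (distr_support ((\<lambda>_. 0) :: 'm functional))"
      using zero_tempered_c[where 'm = 'm] by (simp_all add: tempered_c_def)
    obtain \<eta> where \<eta>: "is_cutoff (distr_support ((\<lambda>_. 0) :: 'm functional)) \<eta>"
      using cutoff_exists[OF z(2)] by blast
    show ?thesis by (simp add: fourier_c_eq[OF z(1) \<eta>] fourier_laplace_def)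
  qed
  ultimately show "fourier_c p = fourier_c (\<lambda>_. 0)" by (simp add: fun_eq_iff)
qed

lemma phase_retrieval:
  fixes w :: "real^'m \<Rightarrow> complex" and p h h' :: "'m functional"
  assumes w: "smooth w" "\<And>x. w x \<noteq> 0" and \<alpha>: "\<alpha> \<notin> \<real>"
    and p: "p \<in> tempered_c" "p \<noteq> (\<lambda>_. 0)" and h: "h \<in> tempered_c" and h': "h' \<in> tempered_c"
    and U: "open U" "U \<noteq> {}"
    and eq: "\<And>\<xi>. \<xi> \<in> U \<Longrightarrow>
      F_op w \<alpha> p h \<xi> - s * (cmod (fourier_c (distr_mult w h) \<xi>))\<^sup>2 =
      F_op w \<alpha> p h' \<xi> - s * (cmod (fourier_c (distr_mult w h') \<xi>))\<^sup>2"
  shows "h = h'"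
proof -
  \<comment> \<open>All lines are drawn through a, where the transform of p does not vanish; on each
    of them the extension of that transform is therefore not identically 0.\<close>
  obtain a where a: "a \<in> U" "fourier_c p a \<noteq> 0"
    using fourier_c_eq_0_open[OF p(1) U] p(2) by blast
  note wh = distr_mult_tempered_c[OF h w(1)] and wh' = distr_mult_tempered_c[OF h' w(1)]
  have line: "fourier_c (distr_mult w h) (a + t *\<^sub>R b) = fourier_c (distr_mult w h') (a + t *\<^sub>R b)"
    if b: "b \<noteq> 0" for b t
  proof -
    obtain P where P: "exp_type P" "\<And>t. P (of_real t) = fourier_c p (a + t *\<^sub>R b)"
      using fourier_c_line[OF p(1)] by blast
    obtain A where A: "exp_type A" "\<And>t. A (of_real t) = fourier_c (distr_mult w h) (a + t *\<^sub>R b)"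
      using fourier_c_line[OF wh] by blast
    obtain B where B: "exp_type B" "\<And>t. B (of_real t) = fourier_c (distr_mult w h') (a + t *\<^sub>R b)"
      using fourier_c_line[OF wh'] by blast
    obtain \<epsilon> where \<epsilon>: "\<epsilon> > 0" "\<And>t. \<bar>t\<bar> < \<epsilon> \<Longrightarrow> a + t *\<^sub>R b \<in> U"
      using open_line[OF U(1) a(1)] by blast
    have sq: "(\<Sum>i\<in>UNIV. ((a + t *\<^sub>R b) $ i)\<^sup>2) = a \<bullet> a + 2 * (a \<bullet> b) * t + (b \<bullet> b) * t\<^sup>2" for t
      by (simp only: norm_power2_vec[symmetric] power2_norm_eq_inner)
        (simp add: inner_simps inner_commute power2_eq_square algebra_simps)
    have "A (of_real t) = B (of_real t)"
    proof (rule phase_retrieval_line[OF P(1) _ A(1) B(1) \<alpha> _ \<epsilon>(1)])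
      show "P 0 \<noteq> 0" using P(2)[of 0] a(2) by simp
      show "b \<bullet> b \<noteq> 0" using b by simp
      fix t :: real assume "\<bar>t\<bar> < \<epsilon>"
      from eq[OF \<epsilon>(2)[OF this]]
      show "(cmod (P (of_real t) * exp (\<alpha> * of_real (a \<bullet> a + 2 * (a \<bullet> b) * t + (b \<bullet> b) * t\<^sup>2)) + A (of_real t)))\<^sup>2 -
          s * (cmod (A (of_real t)))\<^sup>2 =
        (cmod (P (of_real t) * exp (\<alpha> * of_real (a \<bullet> a + 2 * (a \<bullet> b) * t + (b \<bullet> b) * t\<^sup>2)) + B (of_real t)))\<^sup>2 -
          s * (cmod (B (of_real t)))\<^sup>2"
        unfolding F_op_def sq P(2) A(2) B(2) .
    qed
    then show ?thesis by (simp only: A(2) B(2))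
  qed
  have "fourier_c (distr_mult w h) \<xi> = fourier_c (distr_mult w h') \<xi>" for \<xi>
  proof (cases "\<xi> = a")
    case True
    \<comment> \<open>The point a determines no direction; any nonzero vector will do.\<close>
    have "axis undefined 1 \<noteq> (0::real^'m)" by (simp add: axis_eq_0_iff)
    from line[OF this, of 0] show ?thesis by (simp add: True)
  next
    case False
    then show ?thesis using line[of "\<xi> - a" 1] by simp
  qed
  then have "distr_mult w h = distr_mult w h'" by (intro fourier_c_injective wh wh') (simp add: fun_eq_iff)
  then show ?thesis by (rule distr_mult_injective[OF w h h'])
qed

section \<open>Smoothness of the data and conclusion\<close>

lemma smooth_cmod_power2:
  assumes "smooth (f :: real^'m \<Rightarrow> complex)"
  shows "smooth (\<lambda>x. (cmod (f x))\<^sup>2)"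
  unfolding cmod_power2
  by (intro smooth_add smooth_power smooth_bounded_linear[OF bounded_linear_Re assms]
      smooth_bounded_linear[OF bounded_linear_Im assms])

lemma smooth_F:
  fixes w :: "real^'m \<Rightarrow> complex" and p h :: "'m functional"
  assumes "smooth w" "p \<in> tempered_c" "h \<in> tempered_c"
  shows "smooth (F_op w \<alpha> p h)" "smooth (F_lin w \<alpha> p h)"
proof -
  have wh: "smooth (fourier_c (distr_mult w h))"
    by (intro fourier_c_smooth distr_mult_tempered_c assms)
  have "smooth (\<lambda>\<xi>::real^'m. \<Sum>i\<in>UNIV. (\<xi> $ i)\<^sup>2)"
    by (intro smooth_sum smooth_power smooth_component)
  then have "smooth (\<lambda>\<xi>. fourier_c p \<xi> * exp (\<alpha> * of_real (\<Sum>i\<in>UNIV. (\<xi> $ i)\<^sup>2)) + fourier_c (distr_mult w h) \<xi>)"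
    by (intro smooth_add smooth_mult smooth_exp smooth_cmult smooth_of_real fourier_c_smooth[OF assms(2)] wh)
  then show "smooth (F_op w \<alpha> p h)" "smooth (F_lin w \<alpha> p h)"
    unfolding F_op_def[abs_def] F_lin_def[abs_def]
    by (intro smooth_diff smooth_cmod_power2 wh; assumption)+
qed

theorem theorem1:
  fixes w :: "real^'m \<Rightarrow> complex" and \<alpha> :: complex and p :: "'m functional"
  assumes "smooth w" and "\<forall>x. w x \<noteq> 0"
    and "\<alpha> \<notin> \<real>"
    and "p \<in> tempered_c" and "p \<noteq> (\<lambda>_. 0)"
  shows "(\<forall>h\<in>tempered_c. smooth (F_op w \<alpha> p h)) \<and>
         (\<forall>h\<in>tempered_c. smooth (F_lin w \<alpha> p h)) \<and>
         inj_on (F_op w \<alpha> p) tempered_c \<and>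
         inj_on (F_lin w \<alpha> p) tempered_c \<and>
         (\<forall>U. open U \<and> U \<noteq> {} \<longrightarrow>
           (\<forall>h\<in>tempered_c. \<forall>h'\<in>tempered_c.
             ((\<forall>\<xi>\<in>U. F_op w \<alpha> p h \<xi> = F_op w \<alpha> p h' \<xi>) \<longrightarrow> h = h') \<and>
             ((\<forall>\<xi>\<in>U. F_lin w \<alpha> p h \<xi> = F_lin w \<alpha> p h' \<xi>) \<longrightarrow> h = h')))"
proof -
  have w: "\<And>x. w x \<noteq> 0" using assms(2) by blast
  have F: "h = h'" if "open U" "U \<noteq> {}" "h \<in> tempered_c" "h' \<in> tempered_c"
    "\<forall>\<xi>\<in>U. F_op w \<alpha> p h \<xi> = F_op w \<alpha> p h' \<xi>" for U h h'
    by (rule phase_retrieval[OF assms(1) w assms(3-5) that(3,4,1,2), of 0]) (use that(5) in simp)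
  have F_lin: "h = h'" if "open U" "U \<noteq> {}" "h \<in> tempered_c" "h' \<in> tempered_c"
    "\<forall>\<xi>\<in>U. F_lin w \<alpha> p h \<xi> = F_lin w \<alpha> p h' \<xi>" for U h h'
    by (rule phase_retrieval[OF assms(1) w assms(3-5) that(3,4,1,2), of 1])
      (use that(5) in \<open>simp add: F_lin_def F_op_def\<close>)
  \<comment> \<open>Injectivity is uniqueness for the whole space as open set.\<close>
  have inj: "inj_on (F_op w \<alpha> p) tempered_c"
    by (rule inj_onI, rule F[OF open_UNIV UNIV_not_empty]) simp_all
  have inj_lin: "inj_on (F_lin w \<alpha> p) tempered_c"
    by (rule inj_onI, rule F_lin[OF open_UNIV UNIV_not_empty]) simp_all
  show ?thesis
  proof (intro conjI ballI allI impI inj inj_lin)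
    fix h :: "'m functional" assume "h \<in> tempered_c"
    then show "smooth (F_op w \<alpha> p h)" "smooth (F_lin w \<alpha> p h)" by (rule smooth_F[OF assms(1,4)])+
  qed (use F F_lin in metis)+
qed

end
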